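(* For every even $n$, there is a simple polygon $P$ with $n$ vertices that has $2^{\Omega(n)}$ combinatorially distinct Aleksandrov gluings.
   Context: A gluing of a polygon $P$ is a length-preserving identification of $\partial P$ with itself (finitely many open intervals glued isometrically in pairs, endpoints identified, transitively). An Aleksandrov gluing is one where at most $2\pi$ total face angle is glued at any point and the result is homeomorphic to a sphere. Two gluings are combinatorially distinct when their gluing trees differ. The gluing tree of a gluing is the labeled tree that is the image of $\partial P$ after identification: its nodes are the images of points of $\partial P$ identified with more or fewer than one other distinct point, together with images of points to which a vertex of $P$ is glued; each node is labeled by the set of vertices and edges of $P$ glued there (a point interior to an edge glued only to itself is a leaf labeled by its edge). *)

theory Defs
  imports "HOL-Analysis.Analysis"
begin

(* A polygon with n vertices is given by p :: nat => complex; vertex i is p (i mod n),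
   edge i joins p i to p ((i+1) mod n).  The boundary is parametrised by arclength
   t in [0, perim). *)

definition elen :: "nat \<Rightarrow> (nat \<Rightarrow> complex) \<Rightarrow> nat \<Rightarrow> real" where
  "elen n p i = cmod (p (Suc i mod n) - p (i mod n))"

definition cum :: "nat \<Rightarrow> (nat \<Rightarrow> complex) \<Rightarrow> nat \<Rightarrow> real" where
  "cum n p i = (\<Sum>j<i. elen n p j)"

definition perim :: "nat \<Rightarrow> (nat \<Rightarrow> complex) \<Rightarrow> real" where
  "perim n p = cum n p n"

(* index of the edge containing boundary parameter t (t in [0,perim)) *)
definition eidx :: "nat \<Rightarrow> (nat \<Rightarrow> complex) \<Rightarrow> real \<Rightarrow> nat" where
  "eidx n p t = card {j. 1 \<le> j \<and> j < n \<and> cum n p j \<le> t}"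

definition bpt :: "nat \<Rightarrow> (nat \<Rightarrow> complex) \<Rightarrow> real \<Rightarrow> complex" where
  "bpt n p t = (let i = eidx n p t in
      p i + of_real ((t - cum n p i) / elen n p i) * (p (Suc i mod n) - p i))"

definition bdry :: "nat \<Rightarrow> (nat \<Rightarrow> complex) \<Rightarrow> complex set" where
  "bdry n p = bpt n p ` {0..<perim n p}"

definition region :: "nat \<Rightarrow> (nat \<Rightarrow> complex) \<Rightarrow> complex set" where
  "region n p = bdry n p \<union> inside (bdry n p)"

definition prv :: "nat \<Rightarrow> nat \<Rightarrow> nat" where
  "prv n i = (i + n - 1) mod n"

definition turn :: "nat \<Rightarrow> (nat \<Rightarrow> complex) \<Rightarrow> nat \<Rightarrow> complex" where
  "turn n p i = (p (Suc i mod n) - p i) / (p i - p (prv n i))"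

(* twice the signed area (shoelace); positive means counterclockwise *)
definition sarea :: "nat \<Rightarrow> (nat \<Rightarrow> complex) \<Rightarrow> real" where
  "sarea n p = (\<Sum>i<n. Im (cnj (p i) * p (Suc i mod n)))"

(* simple polygon with n (genuine) vertices, listed counterclockwise *)
definition simple_polygon :: "nat \<Rightarrow> (nat \<Rightarrow> complex) \<Rightarrow> bool" where
  "simple_polygon n p \<longleftrightarrow> n \<ge> 3 \<and>
     (\<forall>i<n. p (Suc i mod n) \<noteq> p i) \<and>
     inj_on (bpt n p) {0..<perim n p} \<and>
     (\<forall>i<n. Arg (turn n p i) \<noteq> 0) \<and>
     sarea n p > 0"

definition iangle :: "nat \<Rightarrow> (nat \<Rightarrow> complex) \<Rightarrow> nat \<Rightarrow> real" where
  "iangle n p i = pi - Arg (turn n p i)"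

definition fangle :: "nat \<Rightarrow> (nat \<Rightarrow> complex) \<Rightarrow> real \<Rightarrow> real" where
  "fangle n p t = (if t \<in> cum n p ` {..<n} then iangle n p (eidx n p t) else pi)"

(* circle R / L Z, represented by [0,L) *)
definition cmodL :: "real \<Rightarrow> real \<Rightarrow> real" where
  "cmodL L x = x - L * of_int \<lfloor>x / L\<rfloor>"

definition cio :: "real \<Rightarrow> real \<Rightarrow> real \<Rightarrow> real set" where
  "cio L a b = {x \<in> {0..<L}. if a < b then a < x \<and> x < b
                              else if b < a then a < x \<or> x < b else x \<noteq> a}"

definition arcs :: "real \<Rightarrow> real set \<Rightarrow> (real \<times> real) set" where
  "arcs L T = {(a, b). a \<in> T \<and> b \<in> T \<and> a \<noteq> b \<and> cio L a b \<inter> T = {}}"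

(* isometry of the circle x |-> e*x + c (mod L), with e = 1 or -1 *)
definition isom :: "real \<Rightarrow> real \<times> real \<Rightarrow> real \<Rightarrow> real" where
  "isom L ec x = cmodL L (fst ec * x + snd ec)"

definition gluing_data :: "real \<Rightarrow> real set \<Rightarrow> (real \<times> real \<Rightarrow> real \<times> real) \<Rightarrow> bool" where
  "gluing_data L T \<psi> \<longleftrightarrow> finite T \<and> T \<subseteq> {0..<L} \<and> card T \<ge> 2 \<and>
     (\<forall>A\<in>arcs L T. fst (\<psi> A) \<in> {-1, 1} \<and>
        (\<exists>B\<in>arcs L T. B \<noteq> A \<and>
            isom L (\<psi> A) ` cio L (fst A) (snd A) = cio L (fst B) (snd B) \<and>
            (\<forall>x\<in>cio L (fst A) (snd A). isom L (\<psi> B) (isom L (\<psi> A) x) = x)))"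

definition glue_step :: "real \<Rightarrow> real set \<Rightarrow> (real \<times> real \<Rightarrow> real \<times> real) \<Rightarrow> real \<Rightarrow> real \<Rightarrow> bool" where
  "glue_step L T \<psi> s t \<longleftrightarrow> (\<exists>A\<in>arcs L T.
      s \<in> insert (fst A) (insert (snd A) (cio L (fst A) (snd A))) \<and> t = isom L (\<psi> A) s)"

definition glued :: "real \<Rightarrow> real set \<Rightarrow> (real \<times> real \<Rightarrow> real \<times> real) \<Rightarrow> real \<Rightarrow> real \<Rightarrow> bool" where
  "glued L T \<psi> s t \<longleftrightarrow> s \<in> {0..<L} \<and> t \<in> {0..<L} \<and>
      (\<lambda>x y. glue_step L T \<psi> x y \<or> glue_step L T \<psi> y x)\<^sup>*\<^sup>* s t"

definition is_gluing :: "nat \<Rightarrow> (nat \<Rightarrow> complex) \<Rightarrow> (real \<Rightarrow> real \<Rightarrow> bool) \<Rightarrow> bool" where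
  "is_gluing n p R \<longleftrightarrow> (\<exists>T \<psi>. gluing_data (perim n p) T \<psi> \<and> R = glued (perim n p) T \<psi>)"

definition pt_rel :: "nat \<Rightarrow> (nat \<Rightarrow> complex) \<Rightarrow> (real \<Rightarrow> real \<Rightarrow> bool) \<Rightarrow> complex \<Rightarrow> complex \<Rightarrow> bool" where
  "pt_rel n p R x y \<longleftrightarrow> x = y \<or>
     (\<exists>s t. s \<in> {0..<perim n p} \<and> t \<in> {0..<perim n p} \<and> R s t \<and> x = bpt n p s \<and> y = bpt n p t)"

(* the quotient P / ~ is homeomorphic to the 2-sphere *)
definition glues_to_sphere :: "nat \<Rightarrow> (nat \<Rightarrow> complex) \<Rightarrow> (real \<Rightarrow> real \<Rightarrow> bool) \<Rightarrow> bool" where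
  "glues_to_sphere n p R \<longleftrightarrow> (\<exists>f :: complex \<Rightarrow> real^3.
     continuous_on (region n p) f \<and> f ` region n p = sphere 0 1 \<and>
     (\<forall>x\<in>region n p. \<forall>y\<in>region n p. f x = f y \<longleftrightarrow> pt_rel n p R x y))"

definition aleksandrov_gluing :: "nat \<Rightarrow> (nat \<Rightarrow> complex) \<Rightarrow> (real \<Rightarrow> real \<Rightarrow> bool) \<Rightarrow> bool" where
  "aleksandrov_gluing n p R \<longleftrightarrow> is_gluing n p R \<and>
     (\<forall>s\<in>{0..<perim n p}. finite {t. R s t} \<and>
         (\<Sum>t\<in>{t. R s t}. fangle n p t) \<le> 2 * pi) \<and>
     glues_to_sphere n p R"

datatype item = Vtx nat | Edg nat

definition item_of :: "nat \<Rightarrow> (nat \<Rightarrow> complex) \<Rightarrow> real \<Rightarrow> item" where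
  "item_of n p t = (if t \<in> cum n p ` {..<n} then Vtx (eidx n p t) else Edg (eidx n p t))"

definition tree_nodes :: "nat \<Rightarrow> (nat \<Rightarrow> complex) \<Rightarrow> (real \<Rightarrow> real \<Rightarrow> bool) \<Rightarrow> real set set" where
  "tree_nodes n p R = {C. \<exists>s\<in>{0..<perim n p}. C = {t. R s t} \<and>
                         (card C \<noteq> 2 \<or> (\<exists>i<n. cum n p i \<in> C))}"

definition node_label :: "nat \<Rightarrow> (nat \<Rightarrow> complex) \<Rightarrow> real set \<Rightarrow> item set" where
  "node_label n p C = item_of n p ` C"

definition tree_adj :: "nat \<Rightarrow> (nat \<Rightarrow> complex) \<Rightarrow> (real \<Rightarrow> real \<Rightarrow> bool) \<Rightarrow> real set \<Rightarrow> real set \<Rightarrow> bool" where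
  "tree_adj n p R C D \<longleftrightarrow> C \<noteq> D \<and>
     (\<exists>s\<in>C. \<exists>t\<in>D. cio (perim n p) s t \<inter> \<Union>(tree_nodes n p R) = {})"

definition same_gluing_tree :: "nat \<Rightarrow> (nat \<Rightarrow> complex) \<Rightarrow> (real \<Rightarrow> real \<Rightarrow> bool) \<Rightarrow> (real \<Rightarrow> real \<Rightarrow> bool) \<Rightarrow> bool" where
  "same_gluing_tree n p R1 R2 \<longleftrightarrow> (\<exists>h. bij_betw h (tree_nodes n p R1) (tree_nodes n p R2) \<and>
     (\<forall>C\<in>tree_nodes n p R1. node_label n p (h C) = node_label n p C) \<and>
     (\<forall>C\<in>tree_nodes n p R1. \<forall>D\<in>tree_nodes n p R1.
         tree_adj n p R1 C D \<longleftrightarrow> tree_adj n p R2 (h C) (h D)))"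

end

theory Submission
  imports Defs
begin

text \<open>
  Let \<open>n = 2m\<close> and let \<open>P\<close> be the star with \<open>m\<close> tips of a tiny angle \<open>2\<epsilon>\<close>, alternating with \<open>m\<close>
  reflex vertices of angle \<open>2\<pi> - 2\<pi>/m - 2\<epsilon>\<close>, all edges having length 2. Choose any set of reflex
  vertices (except one), zip the two edges at each of them together, and fold the remaining boundary
  in half about the midpoint of a fixed edge. An unzipped reflex vertex then always meets tips only,
  because a zip removes two edges, which is a full period of the alternation of tips and reflex
  vertices, while folding about the midpoint of an edge exchanges the two kinds. With
  \<open>\<epsilon> = \<pi>/m\<^sup>2\<close> even a reflex vertex together with all tips has total angle at most \<open>2\<pi>\<close>. The zipped
  reflex vertices are exactly those that form a node on their own, so all \<open>2\<^bsup>m-1\<^esup>\<close> gluing trees differ.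

  The quotient is identified with the sphere by explicit maps: the star region is radially a disc, the
  Cayley transform opens it to the closed upper half-plane with the fold point at infinity, each zip is
  a piecewise linear map of the half-plane that folds a boundary interval onto a slit and translates
  the rest of the boundary, and finally \<open>z \<mapsto> z\<^sup>2\<close> folds the boundary line in half.
\<close>

section \<open>Zipping the half-plane along boundary intervals\<close>

text \<open>The sphere condition asks for a continuous surjection whose fibres are exactly the glued
  classes, so the bulk of the work is to show that two descriptions of one relation agree: the
  transitive closure of a pairing of arcs, and equality of values under an explicit map. Both are
  reduced to integers. A fold at the midpoint of an edge of length 2 suggests cutting the boundary
  into unit arcs; zips and fold then pair whole arcs, and the zips move each surviving arc by an
  integer translation. The reflex vertex that is never zipped is an end of the folded edge: its
  block contains the fold point, which is sent to infinity and so has to stay clear of all zips. The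
  value of \<epsilon> comes from requiring m \<epsilon> = pi/m: the m tips then have total angle 2
  pi/m, while a reflex vertex leaves 2 pi/m + 2 \<epsilon> free.\<close>

text \<open>
  On a quarter-plane with coordinates \<open>u = \<bar>x\<bar> - y\<close> (arc length along its boundary) and \<open>v = min \<bar>x\<bar> y\<close>
  this is the shift \<open>u \<mapsto> u - 2\<close>; the two quarter-planes left and right of \<open>x = 0\<close> are treated symmetrically.
\<close>

definition zipm :: "real \<Rightarrow> complex \<Rightarrow> complex" where
  "zipm c z = (let x = Re z - c; y = Im z in
     Complex (c + max (- y) (min x y) + max (x - y - 2) 0 - max (- x - y - 2) 0)
             (min \<bar>x\<bar> y + max (2 + y - \<bar>x\<bar>) 0))"

abbreviation UHP :: "complex set" where
  "UHP \<equiv> {z. Im z \<ge> 0}"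

lemma Im_zipm_nonneg: "Im z \<ge> 0 \<Longrightarrow> Im (zipm c z) \<ge> 0"
  by (auto simp: zipm_def Let_def)

lemma Im_zipm_eq_0D:
  assumes "Im z \<ge> 0" "Im (zipm c z) = 0"
  shows "Im z = 0" "\<bar>Re z - c\<bar> \<ge> 2"
  using assms by (auto simp: zipm_def Let_def min_def max_def split: if_splits)

lemma zipm_real:
  "\<bar>x - c\<bar> \<le> 2 \<Longrightarrow> zipm c (of_real x) = Complex c (2 - \<bar>x - c\<bar>)"
  "x \<ge> c + 2 \<Longrightarrow> zipm c (of_real x) = of_real (x - 2)"
  "x \<le> c - 2 \<Longrightarrow> zipm c (of_real x) = of_real (x + 2)"
  by (auto simp: zipm_def Let_def complex_eq_iff)

text \<open>On each of the two quarter-planes the map shifts the arc-length coordinate injectively.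
  A coincidence therefore needs one point from each side with images on the common axis; such points
  have equal arc-length coordinate, so they are the same axis point or mirror images in the boundary
  interval.\<close>

lemma zipm_eqD:
  assumes "Im z \<ge> 0" "Im w \<ge> 0" "zipm c z = zipm c w"
  shows "z = w \<or> (Im z = 0 \<and> Im w = 0 \<and> Re z + Re w = 2 * c \<and> \<bar>Re z - c\<bar> \<le> 2)"
proof -
  define x y u v where "x = Re z - c" "y = Im z" "u = Re w - c" "v = Im w"
  have 1: "max (- y) (min x y) + max (x - y - 2) 0 - max (- x - y - 2) 0
       = max (- v) (min u v) + max (u - v - 2) 0 - max (- u - v - 2) 0"
   and 2: "min \<bar>x\<bar> y + max (2 + y - \<bar>x\<bar>) 0 = min \<bar>u\<bar> v + max (2 + v - \<bar>u\<bar>) 0"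
    using assms(3) by (auto simp: zipm_def Let_def x_y_u_v_def)
  have "y \<ge> 0" "v \<ge> 0" using assms by (auto simp: x_y_u_v_def)
  have "(x = u \<and> y = v) \<or> (y = 0 \<and> v = 0 \<and> x + u = 0 \<and> \<bar>x\<bar> \<le> 2)"
    using 1 2 \<open>y \<ge> 0\<close> \<open>v \<ge> 0\<close>
    by (cases "x \<ge> 0"; cases "u \<ge> 0"; cases "\<bar>x\<bar> \<le> y"; cases "\<bar>u\<bar> \<le> v"; simp add: min_def max_def abs_if split: if_splits; smt (verit))
  then show ?thesis by (auto simp: x_y_u_v_def complex_eq_iff)
qed

lemma zipm_surj:
  assumes "Im w \<ge> 0"
  shows "\<exists>z. Im z \<ge> 0 \<and> zipm c z = w"
proof -
  define X Y where "X = Re w - c" "Y = Im w"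
  \<comment> \<open>The shift coordinates of the preimage, the summand 2 undoing the shift;
    \<open>s\<close> below records the side of the axis.\<close>
  define u v where "u = \<bar>X\<bar> - Y + 2" "v = min \<bar>X\<bar> Y"
  define s where "s = (if X \<ge> 0 then 1 else -1 :: real)"
  have "Y \<ge> 0" using assms by (simp add: X_Y_def)
  then have "zipm c (Complex (c + s * (v + max u 0)) (v + max (- u) 0)) = w"
    unfolding zipm_def Let_def u_v_def s_def complex_eq_iff
    by (auto simp: X_Y_def min_def max_def abs_if split: if_splits)
  moreover have "v + max (- u) 0 \<ge> 0" using \<open>Y \<ge> 0\<close> by (auto simp: u_v_def)
  ultimately show ?thesis by (metis complex.sel(2))
qed

lemma continuous_on_zipm: "continuous_on A (zipm c)"
proof -
  have "zipm c = (\<lambda>z. of_real (c + max (- Im z) (min (Re z - c) (Im z)) + max ((Re z - c) - Im z - 2) 0 - max (- (Re z - c) - Im z - 2) 0)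
     + \<i> * of_real (min \<bar>Re z - c\<bar> (Im z) + max (2 + Im z - \<bar>Re z - c\<bar>) 0))"
    by (auto simp: zipm_def Let_def complex_eq_iff)
  then show ?thesis by (simp only:) (intro continuous_intros)
qed

text \<open>Bounded displacement is what lets any finite composition of zips extend continuously to
  infinity.\<close>

lemma cmod_zipm_diff:
  assumes "Im z \<ge> 0"
  shows "cmod (zipm c z - z) \<le> 4"
proof -
  have "\<bar>Re (zipm c z - z)\<bar> \<le> 2" "\<bar>Im (zipm c z - z)\<bar> \<le> 2"
    using assms by (auto simp: zipm_def Let_def min_def max_def abs_if)
  then show ?thesis using cmod_le[of "zipm c z - z"] by linarith
qed

text \<open>
  The boundary line is cut into blocks \<open>[4i, 4i+4]\<close> with a reflex vertex in the middle; \<open>B\<close> is the set of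
  zipped blocks, processed from left to right. \<open>nzip\<close> counts the zips so far, which shift the centre of
  the next one by \<open>- 2 nzip\<close>, and \<open>arcpos\<close> is the image of an unzipped unit arc \<open>[j, j+1]\<close>.
\<close>

primrec nzip :: "nat set \<Rightarrow> nat \<Rightarrow> int" where
  "nzip B 0 = 0"
| "nzip B (Suc q) = nzip B q + (if q \<in> B then 1 else 0)"

primrec zips :: "nat set \<Rightarrow> nat \<Rightarrow> complex \<Rightarrow> complex" where
  "zips B 0 z = z"
| "zips B (Suc q) z = (if q \<in> B then zipm (of_int (4 * int q + 2 - 2 * nzip B q)) (zips B q z) else zips B q z)"

primrec arcpos :: "nat set \<Rightarrow> nat \<Rightarrow> int \<Rightarrow> int" where
  "arcpos B 0 j = j"
| "arcpos B (Suc q) j = arcpos B q j + (if q \<in> B then if j < 4 * int q + 2 then 2 else - 2 else 0)"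

definition unzipped :: "nat set \<Rightarrow> nat \<Rightarrow> int \<Rightarrow> bool" where
  "unzipped B q j \<longleftrightarrow> (\<forall>i<q. i \<in> B \<longrightarrow> j < 4 * int i \<or> j \<ge> 4 * int i + 4)"

text \<open>Reflection of the boundary line inside one zipped block. Neighbouring blocks share an
  endpoint, so the ends of a run of zipped blocks become one point; this is why the fibres are
  described by the closure of this relation and not by a single step.\<close>

definition zstep :: "nat set \<Rightarrow> nat \<Rightarrow> real \<Rightarrow> real \<Rightarrow> bool" where
  "zstep B q x y \<longleftrightarrow> (\<exists>i<q. i \<in> B \<and> \<bar>x - (4 * real i + 2)\<bar> \<le> 2 \<and> x + y = 2 * (4 * real i + 2))"

lemma unzipped_Suc:
  "unzipped B (Suc q) j \<longleftrightarrow> unzipped B q j \<and> (q \<in> B \<longrightarrow> j < 4 * int q \<or> j \<ge> 4 * int q + 4)"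
  by (auto simp: unzipped_def less_Suc_eq)

lemma arcpos_right: "j \<ge> 4 * int q \<Longrightarrow> arcpos B q j = j - 2 * nzip B q"
  by (induction q) auto

lemma arcpos_left: "j < 0 \<Longrightarrow> arcpos B q j = j + 2 * nzip B q"
  by (induction q) auto

text \<open>Zips never carry a surviving arc across the front \<open>4 * q\<close>. This decides on
  which side of the next zip centre its image lies.\<close>

lemma arcpos_less:
  "unzipped B q j \<Longrightarrow> j < 4 * int q \<Longrightarrow> arcpos B q j < 4 * int q - 2 * nzip B q"
proof (induction q)
  case (Suc q)
  then show ?case
    using arcpos_right[of q j B] by (cases "j < 4 * int q") (auto simp: unzipped_Suc)
qed (auto)

text \<open>A zip removes four arcs and moves both sides inwards by 2, so the gap closes and the
  survivors again fill all integer positions.\<close>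

lemma arcpos_surj: "\<exists>j. unzipped B q j \<and> arcpos B q j = v"
proof (induction q arbitrary: v)
  case 0
  then show ?case by (auto simp: unzipped_def)
next
  case (Suc q)
  show ?case
  proof (cases "q \<in> B")
    case False
    with Suc[of v] show ?thesis by (auto simp: unzipped_Suc)
  next
    case True
    show ?thesis
    proof (cases "v < 4 * int q + 2 - 2 * nzip B q")
      case v: True
      \<comment> \<open>A position left of the zip centre comes from the left side, which this zip
        moves by + 2.\<close>
      obtain j where j: "unzipped B q j" "arcpos B q j = v - 2" using Suc by blast
      then have "j < 4 * int q" using v arcpos_right[of q j B] by linarith
      with j True show ?thesis by (intro exI[of _ j]) (auto simp: unzipped_Suc)
    next
      case v: False
      define j where "j = v + 2 * nzip B q + 2"
      have "j \<ge> 4 * int q + 4" using v by (simp add: j_def)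
      moreover from this have "unzipped B q j" by (auto simp: unzipped_def)
      ultimately show ?thesis
        using True arcpos_right[of q j B] by (intro exI[of _ j]) (auto simp: unzipped_Suc j_def)
    qed
  qed
qed

lemma arcpos_inj:
  "unzipped B q i \<Longrightarrow> unzipped B q j \<Longrightarrow> arcpos B q i = arcpos B q j \<Longrightarrow> i = j"
proof (induction q)
  case (Suc q)
  have *: "\<not> (i < 4 * int q \<and> j \<ge> 4 * int q + 4)"
    if "unzipped B (Suc q) i" "q \<in> B" "arcpos B (Suc q) i = arcpos B (Suc q) j" for i j
    using that arcpos_less[of B q i] arcpos_right[of q j B] by (auto simp: unzipped_Suc)
  show ?case
  proof (cases "q \<in> B")
    case True
    then show ?thesis using Suc *[of i j] *[of j i] by (auto simp: unzipped_Suc)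
  qed (use Suc in \<open>auto simp: unzipped_Suc\<close>)
qed auto

text \<open>The shifts by 2 and by - 2 agree modulo 4, so the residue of an image depends only on
  the arc and the number of zips. All surviving reflex vertices thus share one residue, which is
  what later keeps them from being glued to each other.\<close>

lemma arcpos_mod4: "(arcpos B q j - j - 2 * nzip B q) mod 4 = 0"
proof (induction q)
  case (Suc q)
  then show ?case by (simp; presburger)
qed auto

lemma Im_zips_nonneg: "Im z \<ge> 0 \<Longrightarrow> Im (zips B q z) \<ge> 0"
  by (induction q) (auto simp: Im_zipm_nonneg)

lemma Im_zips_eq_0D: "Im z \<ge> 0 \<Longrightarrow> Im (zips B q z) = 0 \<Longrightarrow> Im z = 0"
  by (induction q) (auto split: if_splits dest: Im_zipm_eq_0D(1)[OF Im_zips_nonneg])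

lemma continuous_on_zips: "continuous_on A (zips B q)"
proof (induction q)
  case (Suc q)
  show ?case
  proof (cases "q \<in> B")
    case True
    have "continuous_on A (\<lambda>z. zipm (of_int (4 * int q + 2 - 2 * nzip B q)) (zips B q z))"
      by (rule continuous_on_compose2[OF continuous_on_zipm[of UNIV] Suc]) auto
    with True show ?thesis by simp
  qed (use Suc in simp)
qed (simp add: continuous_on_id)

lemma zips_surj: "Im w \<ge> 0 \<Longrightarrow> \<exists>z. Im z \<ge> 0 \<and> zips B q z = w"
proof (induction q arbitrary: w)
  case (Suc q)
  show ?case
  proof (cases "q \<in> B")
    case True
    obtain v where v: "Im v \<ge> 0" "zipm (of_int (4 * int q + 2 - 2 * nzip B q)) v = w"
      using zipm_surj[OF Suc.prems] by blast
    with Suc.IH[of v] True show ?thesis by auto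
  qed (use Suc in auto)
qed auto

lemma cmod_zips_diff: "Im z \<ge> 0 \<Longrightarrow> cmod (zips B q z - z) \<le> 4 * real q"
proof (induction q)
  case (Suc q)
  have "cmod (zipm c (zips B q z) - z) \<le> 4 + 4 * real q" for c
    using Suc cmod_zipm_diff[OF Im_zips_nonneg[OF Suc.prems], of c B q]
      norm_triangle_ineq[of "zipm c (zips B q z) - zips B q z" "zips B q z - z"]
    by simp
  with Suc show ?case by auto
qed auto

text \<open>The bridge from the planar map to the integers. The closed arc lies weakly on one side
  of each zipped interval, so every zip acts on it as one of the two translations, endpoints
  included.\<close>

lemma zips_unzipped:
  assumes "unzipped B q j" "of_int j \<le> x" "x \<le> of_int j + 1"
  shows "zips B q (of_real x) = of_real (x + of_int (arcpos B q j - j))"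
  using assms(1)
proof (induction q)
  case (Suc q)
  then have IH: "zips B q (of_real x) = of_real (x + of_int (arcpos B q j - j))" and u: "unzipped B q j"
    by (auto simp: unzipped_Suc)
  show ?case
  proof (cases "q \<in> B")
    case True
    define d where "d = real_of_int (arcpos B q j - j)"
    have z: "zips B (Suc q) (of_real x) = zipm (of_int (4 * int q + 2 - 2 * nzip B q)) (of_real (x + d))"
      using True IH by (simp add: d_def)
    consider "j < 4 * int q" | "j \<ge> 4 * int q + 4" using Suc.prems True by (auto simp: unzipped_Suc)
    then show ?thesis
    proof cases
      case 1
      then have "arcpos B q j + 1 \<le> 4 * int q - 2 * nzip B q" using arcpos_less[OF u] by simp
      then have "real_of_int (arcpos B q j + 1) \<le> real_of_int (4 * int q - 2 * nzip B q)" by linarith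
      then have "x + d \<le> real_of_int (4 * int q + 2 - 2 * nzip B q) - 2" using assms by (simp add: d_def)
      from zipm_real(3)[OF this] z 1 True show ?thesis by (simp add: d_def)
    next
      case 2
      have "real_of_int (4 * int q + 4) \<le> j" using 2 by linarith
      then have "x + d \<ge> real_of_int (4 * int q + 2 - 2 * nzip B q) + 2"
        using assms 2 arcpos_right[of q j B] by (simp add: d_def)
      from zipm_real(2)[OF this] z 2 True show ?thesis by (simp add: d_def)
    qed
  qed (use IH in auto)
qed auto

lemma zips_right:
  assumes "x \<ge> 4 * real q"
  shows "zips B q (of_real x) = of_real (x - 2 * of_int (nzip B q))"
proof -
  have f: "\<lfloor>x\<rfloor> \<ge> 4 * int q" using assms by (simp add: le_floor_iff)
  then have "unzipped B q \<lfloor>x\<rfloor>" by (auto simp: unzipped_def)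
  from zips_unzipped[OF this, of x] show ?thesis using arcpos_right[OF f, of B] by simp
qed

lemma zips_left:
  assumes "x \<le> 0"
  shows "zips B q (of_real x) = of_real (x + 2 * of_int (nzip B q))"
proof -
  \<comment> \<open>Not the floor: for x = 0 this gives the arc - 1, which lies left of all blocks,
    whereas arc 0 may be zipped.\<close>
  define j where "j = \<lceil>x\<rceil> - 1"
  have f: "j < 0" using assms by (simp add: j_def)
  then have "unzipped B q j" by (auto simp: unzipped_def)
  moreover have "of_int j \<le> x" "x \<le> of_int j + 1" unfolding j_def by linarith+
  ultimately show ?thesis using zips_unzipped[of B q j x] arcpos_left[OF f, of B] by simp
qed

lemma zstep_mono: "zstep B q x y \<Longrightarrow> zstep B (Suc q) x y"
  by (auto simp: zstep_def less_Suc_eq)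

lemma zips_zstep: "zstep B q x y \<Longrightarrow> zips B q (of_real x) = zips B q (of_real y)"
proof (induction q)
  case (Suc q)
  show ?case
  proof (cases "zstep B q x y")
    case False
    with Suc.prems have q: "q \<in> B" "\<bar>x - (4 * real q + 2)\<bar> \<le> 2" "x + y = 2 * (4 * real q + 2)"
      by (auto simp: zstep_def less_Suc_eq)
    then have "x \<ge> 4 * real q" "y \<ge> 4 * real q" by (auto simp: abs_le_iff)
    note r = this[THEN zips_right[where B = B]]
    define c where "c = real_of_int (4 * int q + 2 - 2 * nzip B q)"
    define k where "k = real_of_int (nzip B q)"
    have c: "c = 4 * real q + 2 - 2 * k" by (simp add: c_def k_def)
    have "zipm c (of_real (x - 2 * k)) = zipm c (of_real (y - 2 * k))"
      using q c by (subst (1 2) zipm_real(1)) auto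
    with r q(1) show ?thesis by (simp add: c_def k_def)
  qed (use Suc in simp)
qed (simp add: zstep_def)

text \<open>A coincidence that is new with zip \<open>q\<close> happens between two boundary points
  of the current block. Each argument is linked by earlier zips to such a point, and one
  \<open>zstep\<close> joins the two.\<close>

lemma zips_eqD:
  assumes "Im z \<ge> 0" "Im w \<ge> 0" "zips B q z = zips B q w"
  shows "z = w \<or> (Im z = 0 \<and> Im w = 0 \<and> (zstep B q)\<^sup>*\<^sup>* (Re z) (Re w))"
  using assms
proof (induction q arbitrary: z w)
  case (Suc q)
  have mono: "(zstep B (Suc q))\<^sup>*\<^sup>* x y" if "(zstep B q)\<^sup>*\<^sup>* x y" for x y
    using that by (rule rtranclp_mono[THEN predicate2D, rotated]) (auto intro: zstep_mono)
  show ?case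
  proof (cases "zips B q z = zips B q w")
    case True
    then show ?thesis using Suc.IH[of z w] Suc.prems mono by blast
  next
    case False
    with Suc.prems have q: "q \<in> B" by (auto split: if_splits)
    define c where "c = real_of_int (4 * int q + 2 - 2 * nzip B q)"
    define k where "k = real_of_int (nzip B q)"
    have c: "c = 4 * real q + 2 - 2 * k" by (simp add: c_def k_def)
    have "zipm c (zips B q z) = zipm c (zips B q w)" using Suc.prems q by (simp add: c_def)
    from zipm_eqD[OF Im_zips_nonneg Im_zips_nonneg this] Suc.prems False
    have *: "Im (zips B q z) = 0" "Im (zips B q w) = 0"
       "Re (zips B q z) + Re (zips B q w) = 2 * c" "\<bar>Re (zips B q z) - c\<bar> \<le> 2" by auto
    then have im: "Im z = 0" "Im w = 0" using Suc.prems Im_zips_eq_0D by blast+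
    \<comment> \<open>Undoing the shift of the right-hand ray gives points of block \<open>q\<close>
      with the same images. They can differ from \<open>Re z\<close> and \<open>Re w\<close>,
      because the left end of the block may already be zipped to points further left.\<close>
    define x y where "x = Re (zips B q z) + 2 * k" "y = Re (zips B q w) + 2 * k"
    have "x \<ge> 4 * real q" "y \<ge> 4 * real q" using * c by (auto simp: x_y_def)
    note r = this[THEN zips_right[where B = B]]
    have "zips B q z = zips B q (of_real x)" "zips B q (of_real y) = zips B q w"
      using r * by (auto simp: x_y_def k_def complex_eq_iff)
    then have "(zstep B q)\<^sup>*\<^sup>* (Re z) x" "(zstep B q)\<^sup>*\<^sup>* y (Re w)"
      using Suc.IH[of z "of_real x"] Suc.IH[of "of_real y" w] Suc.prems by auto
    moreover have "zstep B (Suc q) x y" using q * c by (auto simp: zstep_def x_y_def)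
    ultimately have "(zstep B (Suc q))\<^sup>*\<^sup>* (Re z) (Re w)"
      using mono by (meson rtranclp.rtrancl_into_rtrancl rtranclp_trans)
    then show ?thesis using im by blast
  qed
qed auto

section \<open>Gluings of a circle along unit arcs\<close>

definition wrap :: "int \<Rightarrow> real \<Rightarrow> real" where
  "wrap K x = (if x = of_int K then 0 else x)"

definition int_points :: "int \<Rightarrow> real set" where
  "int_points K = of_int ` {0..<K}"

text \<open>The reversing isometry that exchanges the arcs j and \<open>pt j\<close>, in the
  sign-and-offset form read by \<open>isom\<close>; the floor turns the stored left endpoint back
  into the index j.\<close>

definition flip :: "(int \<Rightarrow> int) \<Rightarrow> real \<times> real \<Rightarrow> real \<times> real" where
  "flip pt A = (- 1, fst A + of_int (pt \<lfloor>fst A\<rfloor>) + 1)"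

definition seg :: "int \<Rightarrow> int \<Rightarrow> real \<times> real" where
  "seg K j = (of_int j, wrap K (of_int (j + 1)))"

lemma cmodL_id: "0 \<le> x \<Longrightarrow> x < L \<Longrightarrow> cmodL L x = x"
proof -
  assume "0 \<le> x" "x < L"
  then have "\<lfloor>x / L\<rfloor> = 0" by (auto simp: floor_eq_iff)
  then show ?thesis by (simp add: cmodL_def)
qed

lemma cmodL_add: "L > 0 \<Longrightarrow> cmodL L (L + x) = cmodL L x"
  by (simp add: cmodL_def add_divide_distrib algebra_simps)

lemma cmodL_wrap: "K > 0 \<Longrightarrow> 0 \<le> x \<Longrightarrow> x \<le> of_int K \<Longrightarrow> cmodL (of_int K) x = wrap K x"
  using cmodL_add[of "of_int K" 0] by (auto simp: wrap_def cmodL_id)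

lemma cmodL_wrap_add:
  "K > 0 \<Longrightarrow> 0 \<le> x \<Longrightarrow> x \<le> of_int K \<Longrightarrow> cmodL (of_int K) (of_int K + x) = wrap K x"
  using cmodL_add[of "of_int K" x] by (simp add: cmodL_wrap)

lemma cio_seg:
  assumes "K \<ge> 2" "j \<in> {0..<K}"
  shows "cio (of_int K) (fst (seg K j)) (snd (seg K j)) = {of_int j<..<of_int j + 1}"
proof (cases "j + 1 = K")
  case True
  then have "real_of_int K = of_int j + 1" by linarith
  then show ?thesis using assms True by (auto simp: cio_def seg_def wrap_def)
next
  case False
  then have "j + 1 < K" using assms by auto
  then have "real_of_int (j + 1) < of_int K" by linarith
  then show ?thesis using assms False by (auto simp: cio_def seg_def wrap_def)
qed

lemma arcs_int_points:
  assumes "K \<ge> 2"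
  shows "arcs (of_int K) (int_points K) = seg K ` {0..<K}"
proof (intro equalityI subsetI)
  fix A assume "A \<in> arcs (of_int K) (int_points K)"
  then obtain i j where A: "A = (of_int i, of_int j)" and ij: "i \<in> {0..<K}" "j \<in> {0..<K}" "i \<noteq> j"
    and emp: "cio (of_int K) (of_int i) (of_int j) \<inter> int_points K = {}"
    by (auto simp: arcs_def int_points_def)
  have no: "\<not> (if i < j then i < l \<and> l < j else i < l \<or> l < j)" if "l \<in> {0..<K}" for l
  proof
    assume "if i < j then i < l \<and> l < j else i < l \<or> l < j"
    then have "real_of_int l \<in> cio (of_int K) (of_int i) (of_int j) \<inter> int_points K"
      using that ij by (auto simp: cio_def int_points_def split: if_splits)
    with emp show False by blast
  qed
  have "j = i + 1 \<or> (i = K - 1 \<and> j = 0)"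
    proof (cases "i < j")
    case True
    then show ?thesis using no[of "i + 1"] ij by auto
  next
    case False
    have "i + 1 \<notin> {0..<K}" using no[of "i + 1"] False by auto
    moreover have "\<not> 0 < j" using no[of 0] False ij by auto
    ultimately show ?thesis using ij by auto
  qed
  then have "A = seg K i" using ij by (auto simp: A seg_def wrap_def)
  then show "A \<in> seg K ` {0..<K}" using ij by blast
next
  fix A assume "A \<in> seg K ` {0..<K}"
  then obtain j where j: "j \<in> {0..<K}" "A = seg K j" by blast
  have "cio (of_int K) (fst (seg K j)) (snd (seg K j)) \<inter> int_points K = {}"
  proof -
    have False if "real_of_int j < of_int l" "of_int l < real_of_int j + 1" for l
    proof -
      have "j < l" "l < j + 1" using that by linarith+
      then show False by simp
    qed
    then show ?thesis unfolding cio_seg[OF assms j(1)] by (auto simp: int_points_def)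
  qed
  moreover have "fst A \<in> int_points K" using j by (auto simp: seg_def int_points_def)
  moreover have "snd A \<in> int_points K"
  proof (cases "j + 1 = K")
    case True
    have "snd A = of_int 0" using True j by (simp add: seg_def wrap_def)
    then show ?thesis using assms unfolding int_points_def by (metis atLeastLessThan_iff image_eqI order_refl zero_less_numeral order_less_le_trans)
  next
    case False
    then have "snd A = of_int (j + 1)" "j + 1 \<in> {0..<K}" using j by (auto simp: seg_def wrap_def)
    then show ?thesis unfolding int_points_def by blast
  qed
  moreover have "fst A \<noteq> snd A" using j assms by (auto simp: seg_def wrap_def)
  ultimately show "A \<in> arcs (of_int K) (int_points K)"
    using j(2) by (auto simp: arcs_def case_prod_unfold)
qed

text \<open>The delicate point is x = K, represented by 0: the formula then yields a value that is
  too large by K, and reduction modulo K repairs it.\<close>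

lemma isom_flip:
  assumes "K \<ge> 2" "j \<in> {0..<K}" "pt j \<in> {0..<K}" "of_int j \<le> x" "x \<le> of_int j + 1"
  shows "isom (of_int K) (flip pt (seg K j)) (wrap K x) = wrap K (of_int (j + pt j) + 1 - x)"
proof -
  have le: "real_of_int (pt j + 1) \<le> of_int K" using assms by auto
  have pos: "real_of_int (pt j) \<ge> 0" using assms by auto
  show ?thesis
  proof (cases "x = of_int K")
    case True
    then have "real_of_int (j + 1) \<ge> of_int K" using assms by simp
    then have "j + 1 \<ge> K" by linarith
    then have "j = K - 1" using assms by auto
    then have "isom (of_int K) (flip pt (seg K j)) (wrap K x) = cmodL (of_int K) (of_int K + of_int (pt j))"
      using True by (simp add: isom_def flip_def seg_def wrap_def)
    also have "\<dots> = wrap K (of_int (pt j))" using assms le pos by (intro cmodL_wrap_add) auto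
    also have "of_int (pt j) = of_int (j + pt j) + 1 - x" using True \<open>j = K - 1\<close> by simp
    finally show ?thesis .
  next
    case False
    then have "isom (of_int K) (flip pt (seg K j)) (wrap K x) = cmodL (of_int K) (of_int (j + pt j) + 1 - x)"
      by (simp add: isom_def flip_def seg_def wrap_def algebra_simps)
    also have "\<dots> = wrap K (of_int (j + pt j) + 1 - x)" using assms le pos by (intro cmodL_wrap) auto
    finally show ?thesis .
  qed
qed

text \<open>The offset \<open>j + pt j + 1\<close> is symmetric in the two arcs of a pair, so the
  two flips undo each other.\<close>

lemma gluing_data_flip:
  assumes K: "K \<ge> 2" and pt: "\<And>j. j \<in> {0..<K} \<Longrightarrow> pt j \<in> {0..<K} \<and> pt j \<noteq> j \<and> pt (pt j) = j"
  shows "gluing_data (of_int K) (int_points K) (flip pt)"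
  unfolding gluing_data_def arcs_int_points[OF K] ball_simps bex_simps
proof (intro conjI ballI)
  show "finite (int_points K)" by (simp add: int_points_def)
  show "int_points K \<subseteq> {0..<real_of_int K}" by (auto simp: int_points_def)
  have "card (int_points K) = nat K" by (simp add: int_points_def card_image inj_on_def)
  then show "2 \<le> card (int_points K)" using K by simp
next
  fix j assume j: "j \<in> {0..<K}"
  note p = pt[OF j]
  show "fst (flip pt (seg K j)) \<in> {- 1, 1}" by (simp add: flip_def)
  have w: "wrap K x = x" if "of_int i < x" "x < of_int i + 1" "i \<in> {0..<K}" for x i
  proof -
    have "real_of_int (i + 1) \<le> of_int K" using that by auto
    then show ?thesis using that by (simp add: wrap_def)
  qed
  have iso: "isom (of_int K) (flip pt (seg K i)) x = of_int (i + pt i) + 1 - x"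
    if "of_int i < x" "x < of_int i + 1" "i \<in> {0..<K}" for x i
    using isom_flip[of K i pt x] that w[of i x] w[of "pt i" "of_int (i + pt i) + 1 - x"] pt[of i] K by simp
  show "\<exists>i\<in>{0..<K}. seg K i \<noteq> seg K j \<and>
     isom (of_int K) (flip pt (seg K j)) ` cio (of_int K) (fst (seg K j)) (snd (seg K j)) =
       cio (of_int K) (fst (seg K i)) (snd (seg K i)) \<and>
     (\<forall>x\<in>cio (of_int K) (fst (seg K j)) (snd (seg K j)).
        isom (of_int K) (flip pt (seg K i)) (isom (of_int K) (flip pt (seg K j)) x) = x)"
  proof (intro bexI[of _ "pt j"] conjI)
    show "pt j \<in> {0..<K}" using p by blast
    show "seg K (pt j) \<noteq> seg K j" using p by (auto simp: seg_def)
    show "isom (of_int K) (flip pt (seg K j)) ` cio (of_int K) (fst (seg K j)) (snd (seg K j)) =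
       cio (of_int K) (fst (seg K (pt j))) (snd (seg K (pt j)))"
      unfolding cio_seg[OF K j] cio_seg[OF K conjunct1[OF p]]
    proof (intro equalityI subsetI)
      fix y assume "y \<in> {real_of_int (pt j)<..<of_int (pt j) + 1}"
      then have "of_int (j + pt j) + 1 - y \<in> {real_of_int j<..<of_int j + 1}" by auto
      then show "y \<in> isom (of_int K) (flip pt (seg K j)) ` {of_int j<..<of_int j + 1}"
        using iso[of j "of_int (j + pt j) + 1 - y"] j
        by (intro image_eqI[of _ _ "of_int (j + pt j) + 1 - y"]) auto
    qed (use iso[of j] j in auto)
    show "\<forall>x\<in>cio (of_int K) (fst (seg K j)) (snd (seg K j)).
        isom (of_int K) (flip pt (seg K (pt j))) (isom (of_int K) (flip pt (seg K j)) x) = x"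
      unfolding cio_seg[OF K j] using iso[of j] iso[of "pt j"] p j by auto
  qed
qed

text \<open>Letting x run through the unwrapped closed arc treats the last arc, whose right end is
  stored as 0, like all the others.\<close>

lemma glue_step_flip_iff:
  assumes K: "K \<ge> 2" and pt: "\<And>j. j \<in> {0..<K} \<Longrightarrow> pt j \<in> {0..<K}"
  shows "glue_step (of_int K) (int_points K) (flip pt) s t \<longleftrightarrow>
    (\<exists>j\<in>{0..<K}. \<exists>x. of_int j \<le> x \<and> x \<le> of_int j + 1 \<and> s = wrap K x \<and> t = wrap K (of_int (j + pt j) + 1 - x))"
    (is "?L \<longleftrightarrow> ?R")
proof -
  have *: "s \<in> insert (fst (seg K j)) (insert (snd (seg K j)) (cio (of_int K) (fst (seg K j)) (snd (seg K j))))
       \<longleftrightarrow> (\<exists>x. of_int j \<le> x \<and> x \<le> of_int j + 1 \<and> s = wrap K x)" (is "?l \<longleftrightarrow> ?r")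
    if j: "j \<in> {0..<K}" for j
  proof
    have le: "real_of_int (j + 1) \<le> of_int K" using j by auto
    have lt: "real_of_int j < of_int K" using j by auto
    { assume ?l
      then consider "s = of_int j" | "s = wrap K (of_int j + 1)" | "of_int j < s" "s < of_int j + 1"
        unfolding cio_seg[OF K j] by (auto simp: seg_def)
      then show ?r
      proof cases
        case 1
        then show ?thesis using lt by (intro exI[of _ "of_int j"]) (auto simp: wrap_def)
      next
        case 2
        then show ?thesis by (intro exI[of _ "of_int j + 1"]) auto
      next
        case 3
        then show ?thesis using le by (intro exI[of _ s]) (auto simp: wrap_def)
      qed }
    { assume ?r
      then obtain x where x: "of_int j \<le> x" "x \<le> of_int j + 1" "s = wrap K x" by blast
      consider "x = of_int j" | "x = of_int j + 1" | "of_int j < x" "x < of_int j + 1" using x by linarith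
      then show ?l
        unfolding cio_seg[OF K j] using x lt le by cases (auto simp: seg_def wrap_def) }
  qed
  have "?L \<longleftrightarrow> (\<exists>j\<in>{0..<K}. (\<exists>x. of_int j \<le> x \<and> x \<le> of_int j + 1 \<and> s = wrap K x)
      \<and> t = isom (of_int K) (flip pt (seg K j)) s)"
    unfolding glue_step_def arcs_int_points[OF K] bex_simps using * by blast
  also have "\<dots> \<longleftrightarrow> ?R"
  proof (intro bex_cong refl)
    fix j assume j: "j \<in> {0..<K}"
    note iso = isom_flip[where K = K and j = j and pt = pt, OF K j pt[OF j]]
    show "(\<exists>x. of_int j \<le> x \<and> x \<le> of_int j + 1 \<and> s = wrap K x) \<and> t = isom (of_int K) (flip pt (seg K j)) s
      \<longleftrightarrow> (\<exists>x. of_int j \<le> x \<and> x \<le> of_int j + 1 \<and> s = wrap K x \<and> t = wrap K (of_int (j + pt j) + 1 - x))"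
      using iso by force
  qed
  finally show ?thesis .
qed

lemma glued_refl: "s \<in> {0..<L} \<Longrightarrow> glued L T \<psi> s s"
  by (simp add: glued_def)

lemma glued_sym: "glued L T \<psi> s t \<Longrightarrow> glued L T \<psi> t s"
proof -
  have "symp (\<lambda>x y. glue_step L T \<psi> x y \<or> glue_step L T \<psi> y x)" by (auto simp: symp_def)
  then show "glued L T \<psi> s t \<Longrightarrow> glued L T \<psi> t s"
    unfolding glued_def by (metis symp_rtranclp sympD)
qed

lemma glued_trans: "glued L T \<psi> s t \<Longrightarrow> glued L T \<psi> t u \<Longrightarrow> glued L T \<psi> s u"
  unfolding glued_def by auto

lemma wrap_range: "K > 0 \<Longrightarrow> 0 \<le> x \<Longrightarrow> x \<le> of_int K \<Longrightarrow> wrap K x \<in> {0..<of_int K}"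
  by (auto simp: wrap_def)

lemma glued_flip_step:
  assumes K: "K \<ge> 2" and pt: "\<And>j. j \<in> {0..<K} \<Longrightarrow> pt j \<in> {0..<K}"
    and j: "j \<in> {0..<K}" "of_int j \<le> x" "x \<le> of_int j + 1"
  shows "glued (of_int K) (int_points K) (flip pt) (wrap K x) (wrap K (of_int (j + pt j) + 1 - x))"
proof -
  have "glue_step (of_int K) (int_points K) (flip pt) (wrap K x) (wrap K (of_int (j + pt j) + 1 - x))"
    
    by (subst glue_step_flip_iff[OF K pt]) (use j in auto)
  moreover have "real_of_int (pt j + 1) \<le> of_int K" "real_of_int (j + 1) \<le> of_int K" "real_of_int (pt j) \<ge> 0" "real_of_int j \<ge> 0"
    using pt[OF j(1)] j(1) by auto
  then have "wrap K x \<in> {0..<of_int K}" "wrap K (of_int (j + pt j) + 1 - x) \<in> {0..<of_int K}"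
    using j K by (intro wrap_range; simp)+
  ultimately show ?thesis by (auto simp: glued_def)
qed

text \<open>Serves for two invariants: the boundary map to the sphere, giving one inclusion between
  classes and fibres, and the property of being a vertex.\<close>

lemma glued_flip_invariant:
  assumes K: "K \<ge> 2" and pt: "\<And>j. j \<in> {0..<K} \<Longrightarrow> pt j \<in> {0..<K}"
    and inv: "\<And>j x. j \<in> {0..<K} \<Longrightarrow> of_int j \<le> x \<Longrightarrow> x \<le> of_int j + 1 \<Longrightarrow>
       g (wrap K x) = g (wrap K (of_int (j + pt j) + 1 - x))"
    and "glued (of_int K) (int_points K) (flip pt) s t"
  shows "g s = g t"
proof -
  have "(\<lambda>x y. glue_step (of_int K) (int_points K) (flip pt) x y \<or> glue_step (of_int K) (int_points K) (flip pt) y x)\<^sup>*\<^sup>* s t"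
    using assms(4) by (simp add: glued_def)
  then show ?thesis
  proof induction
    case (step y z)
    have *: "g x = g y" if st: "glue_step (of_int K) (int_points K) (flip pt) x y" for x y
    proof -
      obtain j u where "j \<in> {0..<K}" "of_int j \<le> u" "u \<le> of_int j + 1"
        "x = wrap K u" "y = wrap K (of_int (j + pt j) + 1 - u)"
        using st by (subst (asm) glue_step_flip_iff[OF K pt]) auto
      then show ?thesis using inv by simp
    qed
    have "g y = g z" using step.hyps(2) *[of y z] *[of z y] by auto
    with step show ?case by simp
  qed simp
qed

section \<open>The pairing of the arcs\<close>

text \<open>
  Arc \<open>j\<close> is the part \<open>[j, j+1]\<close> of the boundary; the fold at infinity takes place at \<open>t = 4m - 1\<close>. After all
  zips the boundary line is folded about \<open>2m - 1\<close>, which pairs the arc positions \<open>v\<close> and \<open>4m - 3 - v\<close>.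
\<close>

definition partner :: "nat \<Rightarrow> nat set \<Rightarrow> int \<Rightarrow> int" where
  "partner m B j =
    (if j = 4 * int m - 1 then 4 * int m - 2
     else if j = 4 * int m - 2 then 4 * int m - 1
     else if unzipped B (m - 1) j
       then (THE i. unzipped B (m - 1) i \<and> arcpos B (m - 1) i = 4 * int m - 3 - arcpos B (m - 1) j)
     else 8 * (j div 4) + 3 - j)"

text \<open>All positions below \<open>2 * nzip B q\<close> are taken by arcs left of 0, and
  \<open>arcpos\<close> is injective on unzipped arcs.\<close>

lemma arcpos_nonneg:
  assumes "unzipped B q j" "j \<ge> 0"
  shows "arcpos B q j \<ge> 2 * nzip B q"
proof (rule ccontr)
  define i where "i = arcpos B q j - 2 * nzip B q"
  assume "\<not> ?thesis"
  then have i: "i < 0" by (simp add: i_def)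
  then have "unzipped B q i" by (auto simp: unzipped_def)
  moreover have "arcpos B q i = arcpos B q j" using arcpos_left[OF i] by (simp add: i_def)
  ultimately show False using arcpos_inj assms i by fastforce
qed

text \<open>With k zips the surviving arcs of the interval from 0 to 4m - 2 occupy the positions 2k
  to 4m - 3 - 2k. This range is symmetric under the fold, so the partner lies in the same
  interval.\<close>

lemma partner_unzipped:
  assumes m: "m \<ge> 2" and j: "j \<in> {0..<4 * int m - 2}" and u: "unzipped B (m - 1) j"
  shows "partner m B j \<in> {0..<4 * int m - 2}" "unzipped B (m - 1) (partner m B j)"
    "arcpos B (m - 1) (partner m B j) = 4 * int m - 3 - arcpos B (m - 1) j"
proof -
  define k where "k = nzip B (m - 1)"
  obtain i where i: "unzipped B (m - 1) i" "arcpos B (m - 1) i = 4 * int m - 3 - arcpos B (m - 1) j"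
    using arcpos_surj by blast
  have "partner m B j = i"
    using j u i arcpos_inj[of B "m - 1"] by (auto simp: partner_def intro!: the_equality)
  moreover have "arcpos B (m - 1) j \<ge> 2 * k" using arcpos_nonneg[OF u] j by (simp add: k_def)
  moreover have "arcpos B (m - 1) j \<le> 4 * int m - 3 - 2 * k"
    using arcpos_less[OF u] arcpos_right[of "m - 1" j B] j m
    by (cases "j < 4 * int (m - 1)") (auto simp: k_def)
  ultimately have "\<not> i < 0" "\<not> i \<ge> 4 * int m - 2"
    using i(2) arcpos_left[of i B "m - 1"] arcpos_right[of "m - 1" i B] m by (auto simp: k_def)
  then show "partner m B j \<in> {0..<4 * int m - 2}" "unzipped B (m - 1) (partner m B j)"
    "arcpos B (m - 1) (partner m B j) = 4 * int m - 3 - arcpos B (m - 1) j"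
    using i \<open>partner m B j = i\<close> by auto
qed

lemma partner_zipped:
  assumes m: "m \<ge> 2" and i: "i < m - 1" "i \<in> B" "4 * int i \<le> j" "j < 4 * int i + 4"
  shows "partner m B j = 8 * int i + 3 - j"
proof -
  have "j div 4 = int i" using i(3,4) by presburger
  then show ?thesis using assms by (auto simp: partner_def unzipped_def)
qed

lemma zippedE:
  assumes "\<not> unzipped B q j"
  obtains i where "i < q" "i \<in> B" "4 * int i \<le> j" "j < 4 * int i + 4"
  using assms by (auto simp: unzipped_def)

lemma partner_involution:
  assumes m: "m \<ge> 2" and j: "j \<in> {0..<4 * int m}"
  shows "partner m B j \<in> {0..<4 * int m} \<and> partner m B j \<noteq> j \<and> partner m B (partner m B j) = j"
proof (cases "j \<in> {0..<4 * int m - 2}")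
  case False
  then have "j = 4 * int m - 1 \<or> j = 4 * int m - 2" using j by auto
  then show ?thesis
    using m by (elim disjE) (simp_all add: partner_def)
next
  case r: True
  show ?thesis
  proof (cases "unzipped B (m - 1) j")
    case True
    note p = partner_unzipped[OF m r True]
    note pp = partner_unzipped[OF m p(1,2)]
    have "partner m B (partner m B j) = j"
      by (rule arcpos_inj[OF pp(2) True]) (use p(3) pp(3) in simp)
    moreover have "partner m B j \<noteq> j"
    proof
      assume "partner m B j = j"
      \<comment> \<open>The fold centre 2m - 1 is an integer, hence an end of arcs and never the
        middle of one.\<close>
      with p(3) have "2 * arcpos B (m - 1) j = 4 * int m - 3" by simp
      then show False by presburger
    qed
    ultimately show ?thesis using p(1) by auto
  next
    case False
    then obtain i where i: "i < m - 1" "i \<in> B" "4 * int i \<le> j" "j < 4 * int i + 4"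
      by (rule zippedE)
    have p: "partner m B j = 8 * int i + 3 - j" using partner_zipped[OF m i] .
    moreover have "partner m B (8 * int i + 3 - j) = j"
      using partner_zipped[OF m i(1,2), of "8 * int i + 3 - j"] i by simp
    moreover have "8 * int i + 3 - j \<noteq> j" by presburger
    moreover have "8 * int i + 3 - j \<in> {0..<4 * int m}" using i(1,3,4) by auto
    ultimately show ?thesis by simp
  qed
qed

abbreviation zip_gluing :: "nat \<Rightarrow> nat set \<Rightarrow> real \<Rightarrow> real \<Rightarrow> bool" where
  "zip_gluing m B \<equiv> glued (of_int (4 * int m)) (int_points (4 * int m)) (flip (partner m B))"

lemma zip_gluing_step:
  assumes "m \<ge> 2" "j \<in> {0..<4 * int m}" "of_int j \<le> x" "x \<le> of_int j + 1"
  shows "zip_gluing m B (wrap (4 * int m) x) (wrap (4 * int m) (of_int (j + partner m B j) + 1 - x))"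
  using assms partner_involution[OF assms(1)] by (intro glued_flip_step) auto

lemma zip_gluing_zstep:
  assumes m: "m \<ge> 2" and z: "zstep B (m - 1) x y"
  shows "x \<in> {0..4 * real m - 4}" "y \<in> {0..4 * real m - 4}" "zip_gluing m B x y"
proof -
  obtain i where i: "i < m - 1" "i \<in> B" "\<bar>x - (4 * real i + 2)\<bar> \<le> 2" "x + y = 2 * (4 * real i + 2)"
    using z by (auto simp: zstep_def)
  have "real i + 2 \<le> real m" using i(1) by linarith
  then show xy: "x \<in> {0..4 * real m - 4}" "y \<in> {0..4 * real m - 4}"
    using i by (auto simp: abs_le_iff)
  \<comment> \<open>The minimum assigns the right end of the block to its last arc instead of the
    first arc of the next block.\<close>
  define j where "j = min \<lfloor>x\<rfloor> (4 * int i + 3)"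
  have x: "x \<ge> 4 * real i" "x \<le> 4 * real i + 4" using i by (auto simp: abs_le_iff)
  have j: "4 * int i \<le> j" "j < 4 * int i + 4"
    using x by (auto simp: j_def le_floor_iff)
  have jx: "of_int j \<le> x" "x \<le> of_int j + 1"
    using x unfolding j_def min_def by (simp_all; linarith)+
  have p: "partner m B j = 8 * int i + 3 - j" using partner_zipped[OF m i(1,2) j] .
  have "j \<in> {0..<4 * int m}" using j i(1) by auto
  from zip_gluing_step[OF m this jx, of B]
  moreover have "of_int (j + partner m B j) + 1 - x = y" using p i(4) by simp
  ultimately show "zip_gluing m B x y" using xy by (simp add: wrap_def)
qed

text \<open>The bound 4m - 4 is the right end of the last block that may be zipped; points outside
  the range are moved by no \<open>zstep\<close>, which is how the arguments about the folded edge
  exclude zips.\<close>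

lemma zip_gluing_zsteps:
  assumes m: "m \<ge> 2" and z: "(zstep B (m - 1))\<^sup>*\<^sup>* x y"
  shows "x = y \<or> (x \<in> {0..4 * real m - 4} \<and> y \<in> {0..4 * real m - 4} \<and> zip_gluing m B x y)"
  using z
proof induction
  case (step y z)
  then show ?case using zip_gluing_zstep[OF m step.hyps(2)] glued_trans by blast
qed simp

section \<open>Stereographic projection and Cayley transform\<close>

text \<open>Inverse stereographic projection from the north pole, which is reserved for the fold
  point.\<close>

definition stereo :: "complex \<Rightarrow> real^3" where
  "stereo w = vector [2 * Re w / (1 + (cmod w)\<^sup>2), 2 * Im w / (1 + (cmod w)\<^sup>2),
     ((cmod w)\<^sup>2 - 1) / (1 + (cmod w)\<^sup>2)]"

definition pole :: "real^3" where
  "pole = vector [0, 0, 1]"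

lemma norm_eq_1_3: "norm (v :: real^3) = 1 \<longleftrightarrow> (v$1)\<^sup>2 + (v$2)\<^sup>2 + (v$3)\<^sup>2 = 1"
  by (simp add: norm_eq_1 inner_vec_def sum_3 power2_eq_square)

lemma one_plus_cmod2_pos: "1 + (cmod w)\<^sup>2 > 0"
  by (simp add: add_pos_nonneg)

lemma stereo_third: "stereo w $ 3 = 1 - 2 / (1 + (cmod w)\<^sup>2)"
  using one_plus_cmod2_pos[of w] by (simp add: stereo_def field_simps)

lemma stereo_sphere: "stereo w \<in> sphere 0 1"
proof -
  define r where "r = 1 + (cmod w)\<^sup>2"
  have "r > 0" using one_plus_cmod2_pos by (simp add: r_def)
  have c: "(Re w)\<^sup>2 + (Im w)\<^sup>2 = r - 1" by (simp add: r_def cmod_power2)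
  have "(stereo w $ 1)\<^sup>2 + (stereo w $ 2)\<^sup>2 + (stereo w $ 3)\<^sup>2 =
      (4 * ((Re w)\<^sup>2 + (Im w)\<^sup>2) + (r - 2)\<^sup>2) / r\<^sup>2"
    by (simp add: stereo_def r_def[symmetric] power_divide power_mult_distrib add_divide_distrib)
       (simp add: r_def)
  also have "\<dots> = 1" unfolding c using \<open>r > 0\<close> by (simp add: field_simps power2_eq_square)
  finally show ?thesis by (simp add: norm_eq_1_3)
qed

lemma pole_sphere: "pole \<in> sphere 0 1"
  by (simp add: norm_eq_1_3 pole_def)

lemma stereo_neq_pole: "stereo w \<noteq> pole"
proof
  assume "stereo w = pole"
  then have "stereo w $ 3 = 1" by (simp add: pole_def)
  then show False using one_plus_cmod2_pos[of w] by (simp add: stereo_third)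
qed

lemma stereo_inj: "stereo v = stereo w \<Longrightarrow> v = w"
proof -
  assume eq: "stereo v = stereo w"
  have p: "1 + (cmod w)\<^sup>2 > 0" "1 + (cmod v)\<^sup>2 > 0" by (rule one_plus_cmod2_pos)+
  have "stereo v $ 3 = stereo w $ 3" using eq by simp
  then have r: "1 + (cmod v)\<^sup>2 = 1 + (cmod w)\<^sup>2" using p by (simp add: stereo_third field_simps)
  have "stereo v $ 1 = stereo w $ 1" "stereo v $ 2 = stereo w $ 2" using eq by simp_all
  then show "v = w" using p unfolding stereo_def r by (simp add: complex_eq_iff)
qed

lemma stereo_surj:
  assumes "v \<in> sphere 0 1" "v \<noteq> pole"
  shows "\<exists>w. stereo w = v"
proof -
  have n: "(v$1)\<^sup>2 + (v$2)\<^sup>2 + (v$3)\<^sup>2 = 1" using assms(1) by (simp add: norm_eq_1_3)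
  have v3: "v$3 \<noteq> 1"
  proof
    assume "v$3 = 1"
    with n have "(v$1)\<^sup>2 + (v$2)\<^sup>2 = 0" by simp
    then have "v$1 = 0" "v$2 = 0" by (simp_all add: sum_power2_eq_zero_iff)
    with \<open>v$3 = 1\<close> have "v = pole" by (simp add: pole_def vec_eq_iff forall_3)
    with assms(2) show False by simp
  qed
  define t where "t = 1 - v$3"
  have t: "t \<noteq> 0" using v3 by (simp add: t_def)
  define w where "w = Complex (v$1 / t) (v$2 / t)"
  have "(cmod w)\<^sup>2 = ((v$1)\<^sup>2 + (v$2)\<^sup>2) / t\<^sup>2"
    by (simp add: w_def cmod_power2 power_divide add_divide_distrib)
  also have "(v$1)\<^sup>2 + (v$2)\<^sup>2 = t * (2 - t)"
    using n by (simp add: t_def algebra_simps power2_eq_square)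
  finally have "(cmod w)\<^sup>2 = (2 - t) / t" using t by (simp add: power2_eq_square)
  then have r: "1 + (cmod w)\<^sup>2 = 2 / t" using t by (simp add: field_simps)
  have "stereo w $ 3 = v $ 3" unfolding stereo_third r using t by (simp add: t_def field_simps)
  moreover have "stereo w $ 1 = v $ 1" "stereo w $ 2 = v $ 2"
    unfolding stereo_def r using t by (simp_all add: w_def)
  ultimately have "stereo w = v" by (simp add: vec_eq_iff forall_3)
  then show ?thesis ..
qed

lemma continuous_on_stereo: "continuous_on A stereo"
proof -
  have nz: "1 + (cmod w)\<^sup>2 \<noteq> 0" for w using one_plus_cmod2_pos[of w] by simp
  have "\<forall>i. continuous_on A (\<lambda>w. stereo w $ i)"
    unfolding forall_3 stereo_def by (auto intro!: continuous_intros simp: nz)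
  then show ?thesis
    unfolding continuous_on_def by (auto intro!: vec_tendstoI)
qed

text \<open>All three coordinates differ from those of the pole by at most 2 / |w|.\<close>

lemma tendsto_stereo_at_infinity: "(stereo \<longlongrightarrow> pole) at_infinity"
proof (rule vec_tendstoI)
  fix i :: 3
  have lim: "((\<lambda>w::complex. 2 / norm w) \<longlongrightarrow> 0) at_infinity"
    by (intro tendsto_divide_0[OF tendsto_const] filterlim_at_top_imp_at_infinity filterlim_norm_at_top)
  have big: "eventually (\<lambda>w::complex. norm w > 0) at_infinity"
    using filterlim_at_top_dense[THEN iffD1, OF filterlim_norm_at_top] by blast
  have sq: "x / (1 + (cmod w)\<^sup>2) \<le> 1 / cmod w" if "0 \<le> x" "x \<le> cmod w" "cmod w > 0" for x w
  proof -
    have "x * cmod w \<le> cmod w * cmod w" using that by (intro mult_right_mono) auto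
    then have "x * cmod w \<le> 1 + (cmod w)\<^sup>2" by (simp add: power2_eq_square)
    then show ?thesis using that(3) one_plus_cmod2_pos[of w] by (simp add: field_simps)
  qed
  have a: "\<bar>2 * x / (1 + (cmod w)\<^sup>2)\<bar> \<le> 2 / cmod w" if "\<bar>x\<bar> \<le> cmod w" "cmod w > 0" for x w
    using sq[of "\<bar>x\<bar>" w] that one_plus_cmod2_pos[of w] by (simp add: abs_mult)
  have 1: "((\<lambda>w. stereo w $ 1) \<longlongrightarrow> 0) at_infinity"
    by (rule Lim_null_comparison[OF _ lim], rule eventually_mono[OF big])
       (use a abs_Re_le_cmod in \<open>simp add: stereo_def\<close>)
  have 2: "((\<lambda>w. stereo w $ 2) \<longlongrightarrow> 0) at_infinity"
    by (rule Lim_null_comparison[OF _ lim], rule eventually_mono[OF big])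
       (use a abs_Im_le_cmod in \<open>simp add: stereo_def\<close>)
  have "((\<lambda>w. 1 - stereo w $ 3) \<longlongrightarrow> 0) at_infinity"
  proof (rule Lim_null_comparison[OF _ lim], rule eventually_mono[OF big])
    fix w :: complex assume w: "cmod w > 0"
    have "0 \<le> (cmod w - 1)\<^sup>2" by simp
    then have "2 * cmod w \<le> 1 + (cmod w)\<^sup>2" by (simp add: power2_diff)
    then have "cmod w \<le> 1 + (cmod w)\<^sup>2" using w by linarith
    then show "norm (1 - stereo w $ 3) \<le> 2 / cmod w"
      using w one_plus_cmod2_pos[of w] by (simp add: stereo_third frac_le)
  qed
  from tendsto_diff[OF tendsto_const[of 1] this] have 3: "((\<lambda>w. stereo w $ 3) \<longlongrightarrow> 1) at_infinity" by simp
  have "\<forall>i. ((\<lambda>w. stereo w $ i) \<longlongrightarrow> pole $ i) at_infinity"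
    unfolding forall_3 using 1 2 3 by (simp add: pole_def)
  then show "((\<lambda>w. stereo w $ i) \<longlongrightarrow> pole $ i) at_infinity" by blast
qed

definition cayley :: "complex \<Rightarrow> complex" where
  "cayley w = \<i> * (1 + w) / (1 - w)"

lemma Im_cayley: "w \<noteq> 1 \<Longrightarrow> Im (cayley w) = (1 - (cmod w)\<^sup>2) / (cmod (1 - w))\<^sup>2"
  by (simp add: cayley_def Im_divide cmod_power2) (simp add: field_simps power2_eq_square)

lemma cayley_inverse: "w \<noteq> 1 \<Longrightarrow> (cayley w - \<i>) / (cayley w + \<i>) = w"
proof -
  assume w: "w \<noteq> 1"
  then have "cayley w - \<i> = 2 * \<i> * w / (1 - w)" "cayley w + \<i> = 2 * \<i> / (1 - w)"
    by (simp_all add: cayley_def field_simps)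
  then show ?thesis using w by simp
qed

lemma cayley_inj: "v \<noteq> 1 \<Longrightarrow> w \<noteq> 1 \<Longrightarrow> cayley v = cayley w \<Longrightarrow> v = w"
  using cayley_inverse by metis

lemma cayley_surj:
  assumes "Im z \<ge> 0"
  shows "\<exists>w. cmod w \<le> 1 \<and> w \<noteq> 1 \<and> cayley w = z"
proof -
  define w where "w = (z - \<i>) / (z + \<i>)"
  have nz: "z + \<i> \<noteq> 0"
  proof
    assume "z + \<i> = 0"
    then have "Im (z + \<i>) = 0" by simp
    with assms show False by simp
  qed
  have w1: "1 - w = 2 * \<i> / (z + \<i>)" using nz by (simp add: w_def field_simps)
  then have "w \<noteq> 1" using nz by auto
  have "1 + w = 2 * z / (z + \<i>)" using nz by (simp add: w_def field_simps)
  then have "cayley w = z" using w1 nz by (simp add: cayley_def)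
  moreover from this have "(1 - (cmod w)\<^sup>2) / (cmod (1 - w))\<^sup>2 \<ge> 0"
    using assms Im_cayley[OF \<open>w \<noteq> 1\<close>] by simp
  then have "(cmod w)\<^sup>2 \<le> 1" using \<open>w \<noteq> 1\<close> by (simp add: zero_le_divide_iff)
  then have "cmod w \<le> 1" using power2_le_imp_le[of "cmod w" 1] by simp
  ultimately show ?thesis using \<open>w \<noteq> 1\<close> by blast
qed

lemma continuous_on_cayley: "1 \<notin> A \<Longrightarrow> continuous_on A cayley"
  unfolding cayley_def by (auto intro!: continuous_intros)

lemma filterlim_cayley: "filterlim cayley at_infinity (at 1 within A)"
proof -
  have "((\<lambda>w::complex. 1 - w) \<longlongrightarrow> 1 - 1) (at 1 within A)" by (intro tendsto_intros)
  then have "filterlim (\<lambda>w::complex. 1 - w) (at 0) (at 1 within A)"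
    unfolding filterlim_at by (auto simp: eventually_at_filter)
  moreover have "((\<lambda>w. \<i> * (1 + w)) \<longlongrightarrow> \<i> * (1 + 1)) (at 1 within A)" by (intro tendsto_intros)
  ultimately show ?thesis
    unfolding cayley_def by (intro filterlim_divide_at_infinity[where c = "\<i> * (1 + 1)"]) (auto simp: complex_eq_iff)
qed

text \<open>Writing the angle as pi + 2t turns the Cayley transform on the circle into the tangent
  of the half-angle, with - 1 going to 0 and 1 to infinity.\<close>

lemma cayley_cis:
  assumes "cos t \<noteq> 0"
  shows "cis (pi + 2 * t) \<noteq> 1" "cayley (cis (pi + 2 * t)) = of_real (tan t)"
proof -
  have p: "cos t * cos t = 1 - sin t * sin t" using sin_cos_squared_add2[of t] by (simp add: power2_eq_square algebra_simps)
  have 1: "1 + cis (pi + 2 * t) = - 2 * \<i> * of_real (sin t) * cis t"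
    using p by (simp add: complex_eq_iff cos_double sin_double power2_eq_square)
  have 2: "1 - cis (pi + 2 * t) = 2 * of_real (cos t) * cis t"
    using p by (simp add: complex_eq_iff cos_double sin_double power2_eq_square)
  then show "cis (pi + 2 * t) \<noteq> 1" using assms by auto
  show "cayley (cis (pi + 2 * t)) = of_real (tan t)"
    unfolding cayley_def 1 2 using assms by (simp add: tan_def field_simps)
qed

section \<open>From the disc to the sphere\<close>

locale halving =
  fixes m :: nat
  assumes m: "m \<ge> 2"
begin

text \<open>
  A reparametrisation of the line, symmetric about \<open>2m - 1\<close>, that turns the Cayley coordinate of the boundary
  point \<open>t\<close> into \<open>t\<close> itself on \<open>[0, 4m - 2]\<close>, so that the zips act isometrically there.
\<close>

definition psi :: "real \<Rightarrow> real" where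
  "psi x = (let c = 2 * real m - 1; a = tan (pi * c / (4 * real m)) in
     c + max (- c) (min c (4 * real m / pi * arctan x)) + max (x - a) 0 - max (- x - a) 0)"

text \<open>The tangent occurring here is the Cayley coordinate of the boundary point 4m - 2. There
  the arctangent term of \<open>psi\<close> reaches its clamp c, and a piece of slope 1 takes
  over.\<close>

lemma psi_bound_arg:
  defines "c \<equiv> 2 * real m - 1"
  shows "c > 0" "0 < pi * c / (4 * real m)" "pi * c / (4 * real m) < pi / 2"
    "tan (pi * c / (4 * real m)) > 0" "4 * real m / pi * arctan (tan (pi * c / (4 * real m))) = c"
proof -
  show c: "c > 0" using m by (simp add: c_def)
  then show p: "0 < pi * c / (4 * real m)" using m by simp
  show q: "pi * c / (4 * real m) < pi / 2" using m by (simp add: c_def field_simps)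
  show "tan (pi * c / (4 * real m)) > 0" using p q by (intro tan_gt_zero) auto
  have "arctan (tan (pi * c / (4 * real m))) = pi * c / (4 * real m)"
    using p q by (intro arctan_tan) auto
  then show "4 * real m / pi * arctan (tan (pi * c / (4 * real m))) = c" using m by simp
qed

lemma psi_strict_mono: "x < y \<Longrightarrow> psi x < psi y"
proof -
  assume xy: "x < y"
  define c where "c = 2 * real m - 1"
  define a where "a = tan (pi * c / (4 * real m))"
  define T where "T x = 4 * real m / pi * arctan x" for x
  note b = psi_bound_arg[folded c_def, folded a_def, folded T_def]
  have mono: "T u \<le> T v" if "u \<le> v" for u v
    unfolding T_def using that m by (intro mult_left_mono arctan_monotone') auto
  have neg: "T (- a) = - c" using b(5) by (simp add: T_def arctan_minus)
  have "T x < T y" unfolding T_def using xy m by (intro mult_strict_left_mono) (auto simp: arctan_less_iff)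
  moreover have "T u \<le> c" if "u \<le> a" for u using mono[OF that] b by simp
  note this[of x] this[of y]
  moreover have "T u \<ge> - c" if "u \<ge> - a" for u using mono[OF that] neg by simp
  note this[of x] this[of y]
  ultimately show ?thesis
    unfolding psi_def Let_def c_def[symmetric] a_def[symmetric] T_def[symmetric]
    using xy b(1,4) by (auto simp: min_def max_def)
qed

lemma psi_eq_iff: "psi x = psi y \<longleftrightarrow> x = y"
  using psi_strict_mono by (metis less_irrefl linorder_neqE_linordered_idom)

lemma psi_minus: "psi (- x) = 2 * (2 * real m - 1) - psi x"
  using psi_bound_arg(1) by (auto simp: psi_def Let_def arctan_minus min_def max_def)

lemma continuous_on_psi: "continuous_on A psi"
  unfolding psi_def Let_def by (intro continuous_intros)

text \<open>A bounded distance from the identity gives surjectivity by the intermediate value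
  theorem and leaves the behaviour at infinity unchanged.\<close>

lemma psi_near: "\<exists>C. \<forall>x. \<bar>psi x - x\<bar> \<le> C"
proof -
  define c where "c = 2 * real m - 1"
  define a where "a = tan (pi * c / (4 * real m))"
  note b = psi_bound_arg[folded c_def, folded a_def]
  have "\<bar>psi x - x\<bar> \<le> 2 * c + a" for x
    unfolding psi_def Let_def c_def[symmetric] a_def[symmetric]
    using b(1,4) by (auto simp: min_def max_def)
  then show ?thesis by blast
qed

lemma psi_surj: "\<exists>x. psi x = y"
proof -
  obtain C where C: "\<And>x. \<bar>psi x - x\<bar> \<le> C" using psi_near by blast
  have "C \<ge> 0" using C[of 0] by linarith
  have "psi (y - C) \<le> y" "y \<le> psi (y + C)" using C[of "y - C"] C[of "y + C"] by linarith+
  from IVT'[OF this _ continuous_on_psi] \<open>C \<ge> 0\<close> show ?thesis by auto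
qed

lemma psi_tan:
  assumes "0 \<le> u" "u \<le> 4 * real m - 2"
  shows "psi (tan (pi * (u + 1 - 2 * real m) / (4 * real m))) = u"
proof -
  define c where "c = 2 * real m - 1"
  define a where "a = tan (pi * c / (4 * real m))"
  define y where "y = pi * (u - c) / (4 * real m)"
  note b = psi_bound_arg[folded c_def, folded a_def]
  have u: "\<bar>u - c\<bar> \<le> c" using assms by (auto simp: c_def)
  have y: "y \<le> pi * c / (4 * real m)" "- (pi * c / (4 * real m)) \<le> y"
    using u m unfolding y_def by (auto simp: field_simps abs_le_iff)
  then have yb: "- (pi / 2) < y" "y < pi / 2" using b by linarith+
  have "tan y \<le> a" unfolding a_def using y yb b by (intro tan_mono_le) auto
  moreover have "tan (- y) \<le> a" unfolding a_def using y yb b by (intro tan_mono_le) auto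
  moreover have "arctan (tan y) = y" using yb by (intro arctan_tan) auto
  then have "4 * real m / pi * arctan (tan y) = u - c" using m by (simp add: y_def)
  ultimately have "psi (tan y) = u"
    unfolding psi_def Let_def c_def[symmetric] a_def[symmetric] using u by (auto simp: min_def max_def abs_le_iff)
  then show ?thesis by (simp add: y_def c_def algebra_simps)
qed

text \<open>The place on the real line reached by the boundary point \<open>u\<close> when the disc
  is opened at the fold point. It is the identity on all arcs but the two halves of the folded edge,
  which are stretched into the two outer rays.\<close>

definition phi :: "real \<Rightarrow> real" where
  "phi u = psi (tan (pi * (u + 1 - 2 * real m) / (4 * real m)))"

lemma phi_arg_bounds:
  assumes "- 1 < u" "u < 4 * real m - 1"
  shows "- (pi / 2) < pi * (u + 1 - 2 * real m) / (4 * real m)" "pi * (u + 1 - 2 * real m) / (4 * real m) < pi / 2"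
proof -
  have "- (2 * real m) * pi < (u + 1 - 2 * real m) * pi" "(u + 1 - 2 * real m) * pi < (2 * real m) * pi"
    using assms by (intro mult_strict_right_mono; simp)+
  then show "- (pi / 2) < pi * (u + 1 - 2 * real m) / (4 * real m)" "pi * (u + 1 - 2 * real m) / (4 * real m) < pi / 2"
    using m by (simp_all add: field_simps)
qed

lemma phi_id: "0 \<le> u \<Longrightarrow> u \<le> 4 * real m - 2 \<Longrightarrow> phi u = u"
  unfolding phi_def by (rule psi_tan)

lemma phi_strict_mono: "- 1 < u \<Longrightarrow> u < v \<Longrightarrow> v < 4 * real m - 1 \<Longrightarrow> phi u < phi v"
  unfolding phi_def using phi_arg_bounds[of u] phi_arg_bounds[of v] m
  by (intro psi_strict_mono tan_monotone) (auto simp: divide_strict_right_mono)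

lemma phi_inj:
  "- 1 < u \<Longrightarrow> u < 4 * real m - 1 \<Longrightarrow> - 1 < v \<Longrightarrow> v < 4 * real m - 1 \<Longrightarrow> phi u = phi v \<Longrightarrow> u = v"
  using phi_strict_mono by (metis less_irrefl linorder_neqE_linordered_idom)

text \<open>The reflection of the circle fixing the fold point becomes the reflection of the line
  about 2m - 1, the one that the final squaring divides out.\<close>

lemma phi_reflect: "phi (4 * real m - 2 - u) = 4 * real m - 2 - phi u"
proof -
  have e: "pi * (4 * real m - 2 - u + 1 - 2 * real m) / (4 * real m) = - (pi * (u + 1 - 2 * real m) / (4 * real m))"
    by (simp add: minus_divide_left algebra_simps)
  show ?thesis unfolding phi_def e tan_minus psi_minus by simp
qed

section \<open>The disc, opened at the fold point, and its map to the sphere\<close>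

definition toUHP :: "complex \<Rightarrow> complex" where
  "toUHP w = Complex (psi (Re (cayley w))) (Im (cayley w))"

lemma Im_toUHP: 
  assumes "cmod w \<le> 1" "w \<noteq> 1"
  shows "Im (toUHP w) \<ge> 0" "Im (toUHP w) = 0 \<longleftrightarrow> cmod w = 1"
proof -
  have "(cmod w)\<^sup>2 \<le> 1" using assms by (simp add: power_le_one)
  then show "Im (toUHP w) \<ge> 0" using assms by (simp add: toUHP_def Im_cayley)
  show "Im (toUHP w) = 0 \<longleftrightarrow> cmod w = 1"
    using assms by (simp add: toUHP_def Im_cayley power2_eq_1_iff) (use norm_ge_zero[of w] in linarith)
qed

lemma toUHP_inj: "v \<noteq> 1 \<Longrightarrow> w \<noteq> 1 \<Longrightarrow> toUHP v = toUHP w \<Longrightarrow> v = w"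
  by (rule cayley_inj) (auto simp: toUHP_def psi_eq_iff complex_eq_iff)

lemma toUHP_surj:
  assumes "Im z \<ge> 0"
  shows "\<exists>w. cmod w \<le> 1 \<and> w \<noteq> 1 \<and> toUHP w = z"
proof -
  obtain x where x: "psi x = Re z" using psi_surj by blast
  obtain w where "cmod w \<le> 1" "w \<noteq> 1" "cayley w = Complex x (Im z)"
    using cayley_surj[of "Complex x (Im z)"] assms by auto
  then show ?thesis using x by (intro exI[of _ w]) (simp add: toUHP_def complex_eq_iff)
qed

lemma continuous_on_toUHP: "1 \<notin> A \<Longrightarrow> continuous_on A toUHP"
proof -
  assume A: "1 \<notin> A"
  have c: "continuous_on A (\<lambda>w. psi (Re (cayley w)))"
    by (rule continuous_on_compose2[OF continuous_on_psi[of UNIV]])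
       (auto intro!: continuous_intros continuous_on_cayley A)
  have "toUHP = (\<lambda>w. of_real (psi (Re (cayley w))) + \<i> * of_real (Im (cayley w)))"
    by (auto simp: toUHP_def complex_eq_iff)
  then show ?thesis
    by (simp only:) (intro continuous_intros c continuous_on_cayley A)
qed

text \<open>The summand 1 places the fold point 4m - 1 at the complex number 1, the pole of the
  Cayley transform.\<close>

definition bparam :: "real \<Rightarrow> complex" where
  "bparam x = cis (pi * (x + 1) / (2 * real m))"

lemma bparam_periodic: "bparam (x - 4 * real m) = bparam x"
proof -
  have e: "pi * (x - 4 * real m + 1) / (2 * real m) = pi * (x + 1) / (2 * real m) - 2 * pi"
    using m by (simp add: field_simps)
  show ?thesis unfolding bparam_def e by (simp add: cis_divide[symmetric])
qed

lemma bparam_end: "bparam (4 * real m - 1) = 1"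
  using m by (simp add: bparam_def)

lemma bparam_toUHP:
  assumes "- 1 < u" "u < 4 * real m - 1"
  shows "bparam u \<noteq> 1" "toUHP (bparam u) = of_real (phi u)"
proof -
  define t where "t = pi * (u + 1 - 2 * real m) / (4 * real m)"
  have "pi * (u + 1) / (2 * real m) = pi + 2 * t" using m by (simp add: t_def field_simps)
  then have b: "bparam u = cis (pi + 2 * t)" by (simp add: bparam_def)
  have "cos t > 0" using phi_arg_bounds[OF assms] by (intro cos_gt_zero_pi) (auto simp: t_def)
  then have "cos t \<noteq> 0" by simp
  from cayley_cis[OF this] show "bparam u \<noteq> 1" "toUHP (bparam u) = of_real (phi u)"
    by (simp_all add: b toUHP_def phi_def t_def[symmetric] complex_eq_iff)
qed

text \<open>Squaring about 2m - 1 maps the closed half-plane onto the plane. It is injective off the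
  real line and glues the line to itself by the reflection about 2m - 1, which is the final
  fold.\<close>

definition planar :: "nat set \<Rightarrow> complex \<Rightarrow> complex" where
  "planar B w = (zips B (m - 1) (toUHP w) - of_real (2 * real m - 1))\<^sup>2"

definition sphmap :: "nat set \<Rightarrow> complex \<Rightarrow> real^3" where
  "sphmap B w = (if w = 1 then pole else stereo (planar B w))"

lemma planar_near:
  "\<exists>K. \<forall>w. cmod w \<le> 1 \<longrightarrow> w \<noteq> 1 \<longrightarrow> cmod (planar B w) \<ge> - K + cmod (cayley w)"
proof -
  obtain C where C: "\<And>x. \<bar>psi x - x\<bar> \<le> C" using psi_near by blast
  define K where "K = C + 4 * real (m - 1) + (2 * real m - 1)"
  have K0: "K \<ge> 0" using C[of 0] m by (simp add: K_def)
  have "cmod (planar B w) \<ge> - (2 * K + 1) + cmod (cayley w)" if w: "cmod w \<le> 1" "w \<noteq> 1" for w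
  proof -
    define z where "z = toUHP w"
    have "Im z \<ge> 0" using Im_toUHP w by (simp add: z_def)
    then have "cmod (zips B (m - 1) z - z) \<le> 4 * real (m - 1)" by (rule cmod_zips_diff)
    moreover have "cmod (z - cayley w) \<le> C"
      using C[of "Re (cayley w)"] cmod_le[of "z - cayley w"] by (simp add: z_def toUHP_def)
    moreover have "cmod (of_real (2 * real m - 1)) = 2 * real m - 1"
      unfolding norm_of_real using m by simp
    moreover have "cmod (cayley w) \<le> cmod (zips B (m - 1) z - of_real (2 * real m - 1)) +
       cmod (zips B (m - 1) z - z) + cmod (z - cayley w) + cmod (of_real (2 * real m - 1))"
      by norm
    ultimately have x: "cmod (zips B (m - 1) z - of_real (2 * real m - 1)) \<ge> cmod (cayley w) - K"
      by (simp add: K_def)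
    have "cmod (planar B w) = (cmod (zips B (m - 1) z - of_real (2 * real m - 1)))\<^sup>2"
      by (simp add: planar_def z_def norm_power)
    \<comment> \<open>A linear bound for the square is enough, so the displacement constants only
      add up; \<open>2 * K + 1\<close> is what remains after discarding one copy of |cayley
      w|.\<close>
    moreover have "x\<^sup>2 \<ge> 2 * x - 1" for x :: real
      using zero_le_power2[of "x - 1"] by (simp add: power2_diff)
    ultimately have "cmod (planar B w) \<ge> 2 * cmod (zips B (m - 1) z - of_real (2 * real m - 1)) - 1" by simp
    then show ?thesis using x norm_ge_zero[of "cayley w"] K0
      norm_ge_zero[of "zips B (m - 1) z - of_real (2 * real m - 1)"] by linarith
  qed
  then show ?thesis by blast
qed

text \<open>Only w = 1 needs an argument: there the planar value tends to infinity because it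
  dominates the Cayley coordinate up to a constant.\<close>

lemma continuous_on_sphmap: "continuous_on (cball 0 1) (sphmap B)"
  unfolding continuous_on_def
proof
  fix w :: complex assume w: "w \<in> cball 0 1"
  show "(sphmap B \<longlongrightarrow> sphmap B w) (at w within cball 0 1)"
  proof (cases "w = 1")
    case True
    obtain K where K: "\<And>w. cmod w \<le> 1 \<Longrightarrow> w \<noteq> 1 \<Longrightarrow> cmod (planar B w) \<ge> - K + cmod (cayley w)"
      using planar_near[of B] by blast
    have "filterlim (\<lambda>w. - K + cmod (cayley w)) at_top (at 1 within cball 0 1)"
      by (intro filterlim_tendsto_add_at_top[OF tendsto_const]
          filterlim_compose[OF filterlim_norm_at_top filterlim_cayley])
    then have "filterlim (\<lambda>w. cmod (planar B w)) at_top (at 1 within cball 0 1)"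
      by (rule filterlim_at_top_mono) (use K in \<open>auto simp: eventually_at_filter\<close>)
    then have "filterlim (planar B) at_infinity (at 1 within cball 0 1)"
      by (rule filterlim_norm_at_top_imp_at_infinity)
    then have "((\<lambda>w. stereo (planar B w)) \<longlongrightarrow> pole) (at 1 within cball 0 1)"
      by (rule filterlim_compose[OF tendsto_stereo_at_infinity])
    then have "(sphmap B \<longlongrightarrow> pole) (at 1 within cball 0 1)"
      by (rule Lim_transform_eventually) (auto simp: eventually_at_filter sphmap_def)
    then show ?thesis using True by (simp add: sphmap_def)
  next
    case False
    have "continuous_on (- {1}) (\<lambda>w. stereo (planar B w))"
      unfolding planar_def
      by (rule continuous_on_compose2[OF continuous_on_stereo[of UNIV]])
         (auto intro!: continuous_intros continuous_on_compose2[OF continuous_on_zips[of UNIV]] continuous_on_toUHP)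
    then have "continuous_on (- {1}) (sphmap B)"
      by (rule continuous_on_eq) (simp add: sphmap_def)
    then have "(sphmap B \<longlongrightarrow> sphmap B w) (at w within - {1})"
      using False by (auto simp: continuous_on_def)
    moreover have "at w within - {1} = at w" using False by (intro at_within_open) auto
    ultimately have "(sphmap B \<longlongrightarrow> sphmap B w) (at w)" by simp
    then show ?thesis by (rule tendsto_within_subset[of _ _ _ UNIV, simplified])
  qed
qed

lemma sphmap_image: "sphmap B ` cball 0 1 = sphere 0 1"
proof (intro equalityI subsetI)
  fix v assume v: "v \<in> sphere (0 :: real^3) 1"
  show "v \<in> sphmap B ` cball 0 1"
  proof (cases "v = pole")
    case True
    then have "v = sphmap B 1" by (simp add: sphmap_def)
    then show ?thesis by (intro image_eqI[of _ _ 1]) auto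
  next
    case False
    then obtain y where y: "stereo y = v" using stereo_surj v by blast
    \<comment> \<open>Of the two square roots the one in the closed upper half-plane, which the zips
      reach.\<close>
    define r where "r = (if Im (csqrt y) \<ge> 0 then csqrt y else - csqrt y)"
    have r: "r\<^sup>2 = y" "Im r \<ge> 0" by (auto simp: r_def)
    then have "Im (r + of_real (2 * real m - 1)) \<ge> 0" by simp
    then obtain z where z: "Im z \<ge> 0" "zips B (m - 1) z = r + of_real (2 * real m - 1)"
      using zips_surj by blast
    obtain w where w: "cmod w \<le> 1" "w \<noteq> 1" "toUHP w = z" using toUHP_surj[OF z(1)] by blast
    then have "sphmap B w = v" using z r y by (simp add: sphmap_def planar_def)
    then show ?thesis using w by (intro image_eqI[of _ _ w]) auto
  qed
qed (auto simp: sphmap_def stereo_sphere[simplified] pole_sphere[simplified])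

lemma planar_eqD:
  assumes w: "cmod w \<le> 1" "w \<noteq> 1" "cmod v \<le> 1" "v \<noteq> 1" and eq: "planar B w = planar B v"
  shows "zips B (m - 1) (toUHP w) = zips B (m - 1) (toUHP v) \<or>
    (cmod w = 1 \<and> cmod v = 1 \<and>
     Re (zips B (m - 1) (toUHP w)) + Re (zips B (m - 1) (toUHP v)) = 4 * real m - 2)"
proof -
  define x y c where "x = zips B (m - 1) (toUHP w)" "y = zips B (m - 1) (toUHP v)" "c = complex_of_real (2 * real m - 1)"
  have im: "Im x \<ge> 0" "Im y \<ge> 0" using Im_toUHP w by (auto simp: x_y_c_def intro!: Im_zips_nonneg)
  have "x - c = y - c \<or> x - c = - (y - c)"
    using eq power2_eq_iff unfolding planar_def x_y_c_def by blast
  then show ?thesis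
  proof
    assume "x - c = - (y - c)"
    then have s: "x + y = 2 * c" by (simp add: algebra_simps)
    \<comment> \<open>Two nonnegative imaginary parts with sum zero both vanish, so the fold
      identifies boundary points only.\<close>
    have "Im (x + y) = 0" "Re (x + y) = 4 * real m - 2" unfolding s by (simp_all add: x_y_c_def)
    then have "Im x = 0" "Im y = 0" "Re x + Re y = 4 * real m - 2" using im by auto
    then show ?thesis using w Im_toUHP Im_zips_eq_0D unfolding x_y_c_def by blast
  qed (simp add: x_y_c_def)
qed

lemma sphmap_eqD:
  assumes "cmod w \<le> 1" "cmod v \<le> 1" "sphmap B w = sphmap B v" "w \<noteq> v"
  shows "cmod w = 1" "cmod v = 1"
proof -
  have "cmod w = 1 \<and> cmod v = 1"
  proof (cases "w = 1 \<or> v = 1")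
    case True
    then have "w = v" using assms(3) stereo_neq_pole stereo_neq_pole[symmetric] by (auto simp: sphmap_def split: if_splits)
    with assms(4) show ?thesis by simp
  next
    case False
    then have ne: "w \<noteq> 1" "v \<noteq> 1" by auto
    have "planar B w = planar B v" using assms(3) ne by (auto simp: sphmap_def dest: stereo_inj)
    from planar_eqD[OF assms(1) ne(1) assms(2) ne(2) this] show ?thesis
    proof
      assume "zips B (m - 1) (toUHP w) = zips B (m - 1) (toUHP v)"
      from zips_eqD[OF _ _ this] show ?thesis
        using Im_toUHP assms ne toUHP_inj by blast
    qed auto
  qed
  then show "cmod w = 1" "cmod v = 1" by auto
qed

section \<open>Fibres on the boundary circle\<close>

definition bdmap :: "nat set \<Rightarrow> real \<Rightarrow> real^3" where
  "bdmap B x = sphmap B (bparam x)"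

abbreviation zips' :: "nat set \<Rightarrow> complex \<Rightarrow> complex" where
  "zips' B \<equiv> zips B (m - 1)"

lemma bdmap_eq:
  "- 1 < u \<Longrightarrow> u < 4 * real m - 1 \<Longrightarrow>
    bdmap B u = stereo ((zips' B (of_real (phi u)) - of_real (2 * real m - 1))\<^sup>2)"
  using bparam_toUHP[of u] by (simp add: bdmap_def sphmap_def planar_def)

lemma bdmap_periodic: "bdmap B (x - 4 * real m) = bdmap B x"
  by (simp add: bdmap_def bparam_periodic)

lemma bdmap_wrap: "bdmap B (wrap (4 * int m) x) = bdmap B x"
  using bdmap_periodic[of B "4 * real m"] by (simp add: wrap_def)

lemma bdmap_end: "bdmap B (4 * real m - 1) = pole"
  by (simp add: bdmap_def sphmap_def bparam_end)

lemma bdmap_eqI_sum: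
  assumes "- 1 < u" "u < 4 * real m - 1" "- 1 < v" "v < 4 * real m - 1"
    and "zips' B (of_real (phi u)) + zips' B (of_real (phi v)) = of_real (4 * real m - 2)"
  shows "bdmap B u = bdmap B v"
proof -
  define x y c where "x = zips' B (of_real (phi u))" "y = zips' B (of_real (phi v))" "c = complex_of_real (2 * real m - 1)"
  have "x + y = 2 * c" using assms(5) by (simp add: x_y_c_def)
  then have "x - c = - (y - c)" by (simp add: algebra_simps)
  then have "(x - c)\<^sup>2 = (y - c)\<^sup>2" by (simp only: power2_minus)
  then show ?thesis using assms by (simp add: bdmap_eq x_y_c_def)
qed

lemma phi_right:
  assumes "4 * real m - 2 \<le> u" "u < 4 * real m - 1"
  shows "phi u \<ge> 4 * real m - 2"
  using phi_strict_mono[of "4 * real m - 2" u] phi_id[of "4 * real m - 2"] assms m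
  by (cases "u = 4 * real m - 2") auto

text \<open>The zips move the right ray by - 2k and the left ray by + 2k, so points that are mirror
  images about 2m - 1 remain mirror images.\<close>

lemma bdmap_fold_end:
  assumes x: "4 * real m - 2 \<le> x" "x \<le> 4 * real m - 1"
  shows "bdmap B (8 * real m - 2 - x) = bdmap B x"
proof (cases "x = 4 * real m - 1")
  case False
  define v where "v = 4 * real m - 2 - x"
  have "phi x \<ge> 4 * real m - 2" using phi_right x False by simp
  then have "zips' B (of_real (phi x)) = of_real (phi x - 2 * of_int (nzip B (m - 1)))"
    using m by (intro zips_right) auto
  moreover have "phi v = 4 * real m - 2 - phi x" unfolding v_def by (rule phi_reflect)
  then have "zips' B (of_real (phi v)) = of_real (4 * real m - 2 - phi x + 2 * of_int (nzip B (m - 1)))"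
    using \<open>phi x \<ge> 4 * real m - 2\<close> by (subst zips_left) auto
  ultimately have "bdmap B v = bdmap B x"
    using x False m by (intro bdmap_eqI_sum) (auto simp: v_def)
  moreover have "8 * real m - 2 - x - 4 * real m = v" by (simp add: v_def)
  ultimately show ?thesis using bdmap_periodic[of B "8 * real m - 2 - x"] by metis
qed simp

lemma real_arc_range:
  assumes "j \<in> {0..<4 * int m - 2}"
  shows "0 \<le> real_of_int j" "real_of_int j + 1 \<le> 4 * real m - 2"
proof -
  have "real_of_int (j + 1) \<le> real_of_int (4 * int m - 2)"
    unfolding of_int_le_iff using assms by simp
  then show "0 \<le> real_of_int j" "real_of_int j + 1 \<le> 4 * real m - 2" using assms by auto
qed

lemma bdmap_invariant:
  assumes j: "j \<in> {0..<4 * int m}" and x: "of_int j \<le> x" "x \<le> of_int j + 1"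
  shows "bdmap B x = bdmap B (of_int (j + partner m B j) + 1 - x)"
proof -
  consider "j = 4 * int m - 1" | "j = 4 * int m - 2" | "j \<in> {0..<4 * int m - 2}"
  proof -
    have "j = 4 * int m - 1 \<or> j = 4 * int m - 2 \<or> j < 4 * int m - 2" using j by auto
    then show ?thesis using that j by auto
  qed
  then show ?thesis
  proof cases
    case 1
    then have "of_int (j + partner m B j) + 1 - x = 8 * real m - 2 - x" by (simp add: partner_def)
    then show ?thesis using bdmap_fold_end[of "8 * real m - 2 - x" B] x 1 by simp
  next
    case 2
    then have "of_int (j + partner m B j) + 1 - x = 8 * real m - 2 - x" by (simp add: partner_def)
    then show ?thesis using bdmap_fold_end[of x B] x 2 by (simp only:)
  next
    case 3
    define y where "y = of_int (j + partner m B j) + 1 - x"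
    have ran: "x \<ge> 0" "x \<le> 4 * real m - 2" using x real_arc_range[OF 3] by auto
    show ?thesis
    proof (cases "unzipped B (m - 1) j")
      case True
      note p = partner_unzipped[OF m 3 True]
      have y: "of_int (partner m B j) \<le> y" "y \<le> of_int (partner m B j) + 1" "y \<ge> 0" "y \<le> 4 * real m - 2"
        using x real_arc_range[OF p(1)] by (auto simp: y_def)
      have "zips' B (of_real x) + zips' B (of_real y) = of_real (4 * real m - 2)"
        using zips_unzipped[OF True x] zips_unzipped[OF p(2) y(1,2)] p(3)
        by (simp add: y_def flip: of_real_add)
      then show ?thesis
        using ran y m unfolding y_def[symmetric] by (intro bdmap_eqI_sum) (auto simp: phi_id)
    next
      case False
      then obtain i where i: "i < m - 1" "i \<in> B" "4 * int i \<le> j" "j < 4 * int i + 4" by (rule zippedE)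
      have "real_of_int (4 * int i) \<le> real_of_int j" "real_of_int (j + 1) \<le> real_of_int (4 * int i + 4)"
        unfolding of_int_le_iff using i by auto
      then have xi: "x \<ge> 4 * real i" "x \<le> 4 * real i + 4" using x by auto
      have y: "y = 2 * (4 * real i + 2) - x" using partner_zipped[OF m i] by (simp add: y_def)
      have "zstep B (m - 1) x y" using i xi unfolding zstep_def y by (intro exI[of _ i]) (auto simp: abs_le_iff)
      from zips_zstep[OF this] zip_gluing_zstep(2)[OF m this] show ?thesis
        using ran m unfolding y_def[symmetric] by (simp add: bdmap_eq phi_id)
    qed
  qed
qed

section \<open>Boundary fibres are the glued classes\<close>

lemma zip_gluing_imp_bdmap_eq:
  assumes "zip_gluing m B s t"
  shows "bdmap B s = bdmap B t"
proof (rule glued_flip_invariant[OF _ _ _ assms])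
  show "4 * int m \<ge> 2" using m by simp
  show "\<And>j. j \<in> {0..<4 * int m} \<Longrightarrow> partner m B j \<in> {0..<4 * int m}"
    using partner_involution[OF m] by blast
  show "\<And>j x. j \<in> {0..<4 * int m} \<Longrightarrow> of_int j \<le> x \<Longrightarrow> x \<le> of_int j + 1 \<Longrightarrow>
       bdmap B (wrap (4 * int m) x) = bdmap B (wrap (4 * int m) (of_int (j + partner m B j) + 1 - x))"
    unfolding bdmap_wrap by (rule bdmap_invariant)
qed

text \<open>Lifts the circle cut at the fold point to the interval from - 1 to 4m - 1, the domain on
  which \<open>phi\<close> is injective.\<close>

definition unroll :: "real \<Rightarrow> real" where
  "unroll t = (if t < 4 * real m - 1 then t else t - 4 * real m)"

lemma bdmap_unroll: "bdmap B (unroll t) = bdmap B t"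
  by (simp add: unroll_def bdmap_periodic)

lemma unroll_range:
  "t \<in> {0..<4 * real m} \<Longrightarrow> t \<noteq> 4 * real m - 1 \<Longrightarrow> - 1 < unroll t \<and> unroll t < 4 * real m - 1"
  using m by (auto simp: unroll_def)

lemma phi_unroll_inj:
  assumes "s \<in> {0..<4 * real m}" "s \<noteq> 4 * real m - 1" "t \<in> {0..<4 * real m}" "t \<noteq> 4 * real m - 1"
    "phi (unroll s) = phi (unroll t)"
  shows "s = t"
proof -
  have "unroll s = unroll t" using phi_inj assms unroll_range by blast
  then show ?thesis using assms by (auto simp: unroll_def split: if_splits)
qed

lemma phi_unroll_id: "0 \<le> t \<Longrightarrow> t \<le> 4 * real m - 2 \<Longrightarrow> phi (unroll t) = t"
  by (auto simp: unroll_def phi_id)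

lemma phi_unroll_zsteps:
  assumes t: "t \<in> {0..<4 * real m}" "t \<noteq> 4 * real m - 1"
    and z: "(zstep B (m - 1))\<^sup>*\<^sup>* (phi (unroll t)) y" and y: "0 \<le> y" "y \<le> 4 * real m - 2"
  shows "zip_gluing m B t y"
proof -
  from zip_gluing_zsteps[OF m z] show ?thesis
  proof
    assume "phi (unroll t) = y"
    then have "t = y" using phi_unroll_inj[OF t, of y] y m phi_unroll_id[of y] by auto
    then show ?thesis using t by (auto intro: glued_refl)
  next
    assume *: "phi (unroll t) \<in> {0..4 * real m - 4} \<and> y \<in> {0..4 * real m - 4} \<and> zip_gluing m B (phi (unroll t)) y"
    then have "t = phi (unroll t)"
      using phi_unroll_inj[OF t, of "phi (unroll t)"] m phi_unroll_id[of "phi (unroll t)"] by auto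
    with * show ?thesis by metis
  qed
qed

lemma zips_real_zsteps:
  assumes "zips' B (of_real x) = zips' B (of_real y)"
  shows "(zstep B (m - 1))\<^sup>*\<^sup>* x y"
  using zips_eqD[OF _ _ assms] by auto

text \<open>A value at or beyond the image of 4m - 2 lies to the right of every zip, so
  \<open>s\<close> lies on the half of the folded edge that starts there. Then \<open>t\<close> is
  its mirror image, except for s = 4m - 2, whose mirror image 0 may be zipped to further
  points.\<close>

lemma end_glued:
  assumes s: "s \<in> {0..<4 * real m}" "s \<noteq> 4 * real m - 1" and t: "t \<in> {0..<4 * real m}" "t \<noteq> 4 * real m - 1"
    and v: "zips' B (of_real (phi (unroll s))) = of_real v"
       "zips' B (of_real (phi (unroll t))) = of_real (4 * real m - 2 - v)"
    and ge: "v \<ge> 4 * real m - 2 - 2 * of_int (nzip B (m - 1))"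
  shows "zip_gluing m B s t"
proof -
  define x where "x = v + 2 * of_int (nzip B (m - 1))"
  have x: "x \<ge> 4 * real m - 2" using ge by (simp add: x_def)
  have "zips' B (of_real x) = of_real v" using x m by (subst zips_right) (auto simp: x_def)
  then have "(zstep B (m - 1))\<^sup>*\<^sup>* (phi (unroll s)) x" using v by (intro zips_real_zsteps) simp
  from zip_gluing_zsteps[OF m this] have px: "phi (unroll s) = x" using x m by auto
  have us: "unroll s = s" "s \<ge> 4 * real m - 2" "s < 4 * real m - 1"
  proof -
    have "\<not> unroll s < 4 * real m - 2"
      using phi_strict_mono[of "unroll s" "4 * real m - 2"] phi_id[of "4 * real m - 2"] px x unroll_range[OF s] m
      by auto
    then show "unroll s = s" "s \<ge> 4 * real m - 2" "s < 4 * real m - 1"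
      using s m by (auto simp: unroll_def split: if_splits)
  qed
  define y where "y = 4 * real m - 2 - x"
  have "zips' B (of_real y) = of_real (4 * real m - 2 - v)"
    using x by (subst zips_left) (auto simp: x_def y_def)
  then have zy: "(zstep B (m - 1))\<^sup>*\<^sup>* (phi (unroll t)) y" using v by (intro zips_real_zsteps) simp
  have step: "zip_gluing m B s (wrap (4 * int m) (8 * real m - 2 - s))"
  proof -
    have "4 * int m - 2 \<in> {0..<4 * int m}" using m by auto
    from zip_gluing_step[OF m this, of s B] us m show ?thesis by (simp add: partner_def wrap_def)
  qed
  show ?thesis
  proof (cases "s = 4 * real m - 2")
    case True
    then have "x = 4 * real m - 2" using px us phi_id m by simp
    then have "y = 0" by (simp add: y_def)
    then have "zip_gluing m B t 0" using phi_unroll_zsteps[OF t] zy m by simp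
    moreover have "zip_gluing m B s 0" using step True by (simp add: wrap_def)
    ultimately show ?thesis by (metis glued_sym glued_trans)
  next
    case False
    have "x > 4 * real m - 2"
      using phi_strict_mono[of "4 * real m - 2" s] phi_id[of "4 * real m - 2"] us False px m by auto
    then have "phi (unroll t) = y" using zip_gluing_zsteps[OF m zy] by (auto simp: y_def)
    define t' where "t' = 8 * real m - 2 - s"
    have t': "t' \<in> {0..<4 * real m}" "t' \<noteq> 4 * real m - 1" "unroll t' = 4 * real m - 2 - s"
      using us False m by (auto simp: t'_def unroll_def)
    have "phi (unroll t') = y" unfolding t'(3) phi_reflect y_def using px us by simp
    then have "t = t'" using phi_unroll_inj[OF t t'(1,2)] \<open>phi (unroll t) = y\<close> by simp
    then show ?thesis using step t' by (simp add: t'_def wrap_def)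
  qed
qed

lemma bdmap_eq_endD:
  assumes t: "t \<in> {0..<4 * real m}" and eq: "bdmap B (4 * real m - 1) = bdmap B t"
  shows "t = 4 * real m - 1"
proof (rule ccontr)
  assume ne: "t \<noteq> 4 * real m - 1"
  have "pole = bdmap B (unroll t)" using eq bdmap_end bdmap_unroll by simp
  then show False using bdmap_eq[of "unroll t" B] unroll_range[OF t ne] stereo_neq_pole by metis
qed

lemma bdmap_eqD:
  assumes s: "s \<in> {0..<4 * real m}" "s \<noteq> 4 * real m - 1" and t: "t \<in> {0..<4 * real m}" "t \<noteq> 4 * real m - 1"
    and eq: "bdmap B s = bdmap B t"
  shows "zips' B (of_real (phi (unroll s))) = zips' B (of_real (phi (unroll t))) \<or>
    (\<exists>v. zips' B (of_real (phi (unroll s))) = of_real v \<and>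
         zips' B (of_real (phi (unroll t))) = of_real (4 * real m - 2 - v))"
proof -
  define z w where "z = zips' B (of_real (phi (unroll s)))" "w = zips' B (of_real (phi (unroll t)))"
  have im: "Im z \<ge> 0" "Im w \<ge> 0" by (auto simp: z_w_def intro!: Im_zips_nonneg)
  have "stereo ((z - of_real (2 * real m - 1))\<^sup>2) = stereo ((w - of_real (2 * real m - 1))\<^sup>2)"
    using eq bdmap_eq[of "unroll s" B] bdmap_eq[of "unroll t" B] unroll_range[OF s] unroll_range[OF t]
    by (simp add: bdmap_unroll z_w_def)
  then have "(z - of_real (2 * real m - 1))\<^sup>2 = (w - of_real (2 * real m - 1))\<^sup>2" by (rule stereo_inj)
  then have "z - of_real (2 * real m - 1) = w - of_real (2 * real m - 1) \<or>
      z - of_real (2 * real m - 1) = - (w - of_real (2 * real m - 1))"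
    by (simp only: power2_eq_iff)
  then have "z = w \<or> (\<exists>v. z = of_real v \<and> w = of_real (4 * real m - 2 - v))"
  proof
    assume "z - of_real (2 * real m - 1) = - (w - of_real (2 * real m - 1))"
    then have "z + w = of_real (4 * real m - 2)" by (simp add: algebra_simps)
    then have "Im (z + w) = 0" "Re (z + w) = 4 * real m - 2" by simp_all
    then have "z = of_real (Re z)" "w = of_real (4 * real m - 2 - Re z)"
      using im by (auto simp: complex_eq_iff)
    then show ?thesis by blast
  next
    assume "z - of_real (2 * real m - 1) = w - of_real (2 * real m - 1)"
    then show ?thesis by (metis diff_add_cancel)
  qed
  then show ?thesis by (simp only: z_w_def)
qed

lemma bdmap_eq_imp_zip_gluing:
  assumes s: "s \<in> {0..<4 * real m}" and t: "t \<in> {0..<4 * real m}" and eq: "bdmap B s = bdmap B t"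
  shows "zip_gluing m B s t"
proof (cases "s = 4 * real m - 1 \<or> t = 4 * real m - 1")
  case True
  then have "s = t" using bdmap_eq_endD s t eq by metis
  then show ?thesis using s by (auto intro: glued_refl)
next
  case False
  then have ns: "s \<noteq> 4 * real m - 1" and nt: "t \<noteq> 4 * real m - 1" by auto
  from bdmap_eqD[OF s ns t nt eq] show ?thesis
  proof (elim disjE exE conjE)
    assume "zips' B (of_real (phi (unroll s))) = zips' B (of_real (phi (unroll t)))"
    then have "(zstep B (m - 1))\<^sup>*\<^sup>* (phi (unroll s)) (phi (unroll t))"
      by (rule zips_real_zsteps)
    from zip_gluing_zsteps[OF m this] show ?thesis
    proof
      assume "phi (unroll s) = phi (unroll t)"
      then have "s = t" using phi_unroll_inj s t ns nt by blast
      then show ?thesis using s by (auto intro: glued_refl)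
    next
      assume a: "phi (unroll s) \<in> {0..4 * real m - 4} \<and> phi (unroll t) \<in> {0..4 * real m - 4} \<and>
        zip_gluing m B (phi (unroll s)) (phi (unroll t))"
      have "r = phi (unroll r)" if "r \<in> {0..<4 * real m}" "r \<noteq> 4 * real m - 1" "phi (unroll r) \<in> {0..4 * real m - 4}" for r
        using phi_unroll_inj[OF that(1,2), of "phi (unroll r)"] that(3) phi_unroll_id[of "phi (unroll r)"] by auto
      then have "s = phi (unroll s)" "t = phi (unroll t)" using a s t ns nt by blast+
      with a show ?thesis by metis
    qed
  next
    fix v assume z: "zips' B (of_real (phi (unroll s))) = of_real v"
      and w: "zips' B (of_real (phi (unroll t))) = of_real (4 * real m - 2 - v)"
    define k where "k = nzip B (m - 1)"
    \<comment> \<open>Outside the middle range one of the two points lies on the right half of the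
      folded edge; inside it, \<open>v\<close> comes from a surviving arc.\<close>
    consider "v \<ge> 4 * real m - 2 - 2 * of_int k" | "4 * real m - 2 - v \<ge> 4 * real m - 2 - 2 * of_int k"
      | "2 * of_int k < v" "v < 4 * real m - 2 - 2 * of_int k" by linarith
    then show ?thesis
    proof cases
      case 1
      from end_glued[OF s ns t nt z w this[unfolded k_def]] show ?thesis .
    next
      case 2
      have "zip_gluing m B t s"
        using end_glued[OF t nt s ns w _ 2[unfolded k_def]] z by simp
      then show ?thesis by (rule glued_sym)
    next
      case 3
      obtain f :: int where f: "of_int f \<le> v" "v < of_int f + 1"
        using that[of "\<lfloor>v\<rfloor>"] floor_correct[of v] by simp
      obtain j where j: "unzipped B (m - 1) j" "arcpos B (m - 1) j = f" using arcpos_surj by blast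
      have "real_of_int (2 * k) < real_of_int (f + 1)" "real_of_int f < real_of_int (4 * int m - 2 - 2 * k)"
        using 3 f by auto
      then have fv: "f \<ge> 2 * k" "f < 4 * int m - 2 - 2 * k" unfolding of_int_less_iff by auto
      have "\<not> j < 0"
      proof
        assume "j < 0"
        from arcpos_left[OF this, of B "m - 1"] show False using fv(1) j(2) \<open>j < 0\<close> unfolding k_def by presburger
      qed
      moreover have "\<not> j \<ge> 4 * int m - 2"
      proof
        assume a: "j \<ge> 4 * int m - 2"
        have "int (m - 1) = int m - 1" using m by simp
        with a have "j \<ge> 4 * int (m - 1)" by simp
        from arcpos_right[OF this, of B] show False using fv(2) j(2) a unfolding k_def by presburger
      qed
      ultimately have jr: "j \<in> {0..<4 * int m - 2}" by auto
      note p = partner_unzipped[OF m jr j(1)]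
      \<comment> \<open>The point of arc \<open>j\<close> with image \<open>v\<close>. It need not
        be \<open>s\<close> itself, since zips can give several points the same image, so the chain
        runs from \<open>s\<close> to \<open>x\<close>, across the pair of arcs to \<open>y\<close>,
        and on to \<open>t\<close>.\<close>
      define x where "x = of_int j + (v - of_int f)"
      define y where "y = of_int (j + partner m B j) + 1 - x"
      have x: "of_int j \<le> x" "x \<le> of_int j + 1" using f by (auto simp: x_def)
      then have y: "of_int (partner m B j) \<le> y" "y \<le> of_int (partner m B j) + 1" by (auto simp: y_def)
      have r: "0 \<le> x" "x \<le> 4 * real m - 2" "0 \<le> y" "y \<le> 4 * real m - 2"
        using x y real_arc_range[OF jr] real_arc_range[OF p(1)] by auto
      have "zips' B (of_real x) = of_real v" using zips_unzipped[OF j(1) x] j(2) by (simp add: x_def)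
      then have "zips' B (of_real (phi (unroll s))) = zips' B (of_real x)" using z by metis
      then have 1: "zip_gluing m B s x"
        using r(1,2) by (rule phi_unroll_zsteps[OF s ns zips_real_zsteps])
      have "zips' B (of_real y) = of_real (4 * real m - 2 - v)"
        using zips_unzipped[OF p(2) y] j(2) p(3) by (simp add: x_def y_def)
      then have "zips' B (of_real (phi (unroll t))) = zips' B (of_real y)" using w by metis
      then have 2: "zip_gluing m B t y"
        using r(3,4) by (rule phi_unroll_zsteps[OF t nt zips_real_zsteps])
      have "j \<in> {0..<4 * int m}" using jr by auto
      from zip_gluing_step[OF m this x, of B]
      have "zip_gluing m B (wrap (4 * int m) x) (wrap (4 * int m) y)" by (simp only: y_def)
      then have "zip_gluing m B x y" using r m by (simp add: wrap_def)
      from glued_trans[OF glued_trans[OF 1 this] glued_sym[OF 2]] show ?thesis .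
    qed
  qed
qed

lemma zip_gluing_range: "zip_gluing m B s t \<Longrightarrow> s \<in> {0..<4 * real m} \<and> t \<in> {0..<4 * real m}"
  by (simp add: glued_def)

end

section \<open>The star polygon\<close>

lemma rcis_unique:
  assumes "rcis r a = rcis s b" "r > 0" "s > 0" "0 \<le> a" "a < 2 * pi" "0 \<le> b" "b < 2 * pi"
  shows "r = s" "a = b"
proof -
  have "cmod (rcis r a) = cmod (rcis s b)" using assms(1) by simp
  then show "r = s" using assms(2,3) by simp
  have "Arg2pi (rcis r a) = a" using assms by (intro Arg2pi_unique[of r]) (auto simp: rcis_def cis_conv_exp)
  moreover have "Arg2pi (rcis s b) = b" using assms by (intro Arg2pi_unique[of s]) (auto simp: rcis_def cis_conv_exp)
  ultimately show "a = b" using assms(1) by simp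
qed

text \<open>The strict bound on the angle comes from r sin (d - a) = A sin d > 0.\<close>

lemma sector_polar:
  assumes "0 < d" "d < pi" "A > 0" "B \<ge> 0"
  shows "\<exists>r a. r > 0 \<and> 0 \<le> a \<and> a < d \<and> of_real A + of_real B * cis d = rcis r a"
proof -
  define z where "z = of_real A + of_real B * cis d"
  define r a where "r = cmod z" "a = Arg2pi z"
  have sd: "sin d > 0" using assms by (simp add: sin_gt_zero)
  have z: "z = rcis r a" unfolding r_a_def rcis_def cis_conv_exp by (simp add: Arg2pi_eq[symmetric])
  have a: "0 \<le> a" "a \<le> pi"
    using Arg2pi[of z] Arg2pi_le_pi[of z] assms sd by (auto simp: r_a_def z_def)
  have re: "r * cos a = A + B * cos d" and im: "r * sin a = B * sin d"
    using arg_cong[OF z, of Re] arg_cong[OF z, of Im] by (simp_all add: z_def)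
  have "r * sin (d - a) = sin d * (r * cos a) - cos d * (r * sin a)"
    by (simp add: sin_diff algebra_simps)
  also have "\<dots> = A * sin d" unfolding re im by (simp add: algebra_simps)
  finally have p: "r * sin (d - a) > 0" using assms sd by simp
  then have "r > 0" using norm_ge_zero[of z] unfolding r_a_def(1)[symmetric] by (cases "r = 0") auto
  with p have "sin (d - a) > 0" by (simp add: zero_less_mult_iff)
  have "a < d"
  proof (rule ccontr)
    assume "\<not> a < d"
    then have "sin (a - d) \<ge> 0" using a assms by (intro sin_ge_zero) auto
    moreover have "sin (a - d) = - sin (d - a)" by (simp add: sin_diff)
    ultimately show False using \<open>sin (d - a) > 0\<close> by linarith
  qed
  moreover have "of_real A + of_real B * cis d = rcis r a" using z z_def by metis
  ultimately show ?thesis using \<open>r > 0\<close> a(1) by (intro exI conjI)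
qed

text \<open>The coefficients are the oblique coordinates given by the law of sines.\<close>

lemma sector_coords:
  assumes "0 < d" "d < pi" "0 \<le> a" "a < d" "r > 0"
  shows "\<exists>A B. A > 0 \<and> B \<ge> 0 \<and> of_real A + of_real B * cis d = rcis r a"
proof -
  have sd: "sin d > 0" "sin (d - a) > 0" "sin a \<ge> 0" using assms by (auto intro!: sin_gt_zero sin_ge_zero)
  have "sin (d - a) + sin a * cos d = cos a * sin d" by (simp add: sin_diff)
  then have "r * sin (d - a) / sin d + r * sin a / sin d * cos d = r * cos a"
    using sd by (simp add: field_simps distrib_left[symmetric])
  then have "of_real (r * sin (d - a) / sin d) + of_real (r * sin a / sin d) * cis d = rcis r a"
    using sd by (simp add: complex_eq_iff)
  moreover have "r * sin (d - a) / sin d > 0" "r * sin a / sin d \<ge> 0" using sd assms(5) by auto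
  ultimately show ?thesis by blast
qed

context halving begin

text \<open>
  \<open>dl\<close> is the angle between consecutive vertices seen from the centre and \<open>ep\<close> half the angle at a tip;
  the radii come from the law of sines for edges of length 2.
\<close>

definition dl :: real where "dl = pi / real m"
definition ep :: real where "ep = pi / (real m)\<^sup>2"

definition rad :: "nat \<Rightarrow> real" where
  "rad i = (if even i then 2 * sin (dl + ep) / sin dl else 2 * sin ep / sin dl)"

definition star :: "nat \<Rightarrow> complex" where
  "star i = of_real (rad i) * cis (dl * real i)"

lemma dl_ep: "0 < dl" "dl < pi" "0 < ep" "dl + ep < pi" "ep \<le> dl" "dl * (2 * real m) = 2 * pi" "real m * ep = dl"
proof -
  have m0: "real m \<ge> 2" using m by simp
  show "0 < dl" "dl < pi" "0 < ep" using m0 by (auto simp: dl_def ep_def field_simps)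
  show md: "real m * ep = dl" "dl * (2 * real m) = 2 * pi" using m0 by (auto simp: dl_def ep_def power2_eq_square)
  have "2 * ep \<le> real m * ep" using m0 \<open>0 < ep\<close> by (intro mult_right_mono) auto
  moreover have "2 * dl \<le> real m * dl" using m0 \<open>0 < dl\<close> by (intro mult_right_mono) auto
  moreover have "real m * dl = pi" using m0 by (simp add: dl_def)
  ultimately have "2 * ep \<le> dl" "2 * dl \<le> pi" using md(1) by simp_all
  then show "dl + ep < pi" "ep \<le> dl" using \<open>0 < ep\<close> \<open>0 < dl\<close> by linarith+
qed

lemma sin_dl_pos: "sin dl > 0" using dl_ep by (simp add: sin_gt_zero)

lemma rad_pos: "rad i > 0"
  using dl_ep sin_dl_pos by (auto simp: rad_def intro!: divide_pos_pos sin_gt_zero)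

lemma cis_Suc: "cis (x * real (Suc i)) = cis (x * real i) * cis x"
  by (simp add: cis_mult distrib_left add.commute)

lemma star_sector: "star (Suc i) = cis (dl * real i) * (of_real (rad (Suc i)) * cis dl)"
  unfolding star_def cis_Suc by simp

lemma star_period: "star (2 * m) = star 0"
proof -
  have "cis (dl * real (2 * m)) = 1" using dl_ep(6) by (metis cis_2pi of_nat_mult of_nat_numeral)
  then show ?thesis by (simp add: star_def rad_def)
qed

text \<open>At a tip the edge deviates from the inward radius by the angle \<open>ep\<close>; the
  radii are scaled to make its length 2.\<close>

lemma star_diff_even:
  assumes "even i"
  shows "star (Suc i) - star i = - 2 * cis (dl * real i - ep)"
proof -
  have *: "of_real (rad (Suc i)) * cis dl - of_real (rad i) = - 2 * cis (- ep)"
    using assms sin_dl_pos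
    by (simp add: complex_eq_iff rad_def sin_add) (simp add: field_simps)
  have "star (Suc i) - star i = cis (dl * real i) * (of_real (rad (Suc i)) * cis dl - of_real (rad i))"
    unfolding star_sector by (simp add: star_def right_diff_distrib)
  also have "\<dots> = - 2 * cis (dl * real i - ep)" unfolding * by (simp add: cis_mult)
  finally show ?thesis .
qed

lemma star_diff_odd:
  assumes "odd i"
  shows "star (Suc i) - star i = 2 * cis (dl * real (Suc i) + ep)"
proof -
  have s: "cos dl * cos dl = 1 - sin dl * sin dl"
    using sin_cos_squared_add2[of dl] by (simp add: power2_eq_square algebra_simps)
  have "2 * (sin dl * cos ep + cos dl * sin ep) * cos dl / sin dl - 2 * sin ep / sin dl
      = 2 * (sin dl * cos ep * cos dl + (cos dl * cos dl - 1) * sin ep) / sin dl"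
    by (simp add: algebra_simps diff_divide_distrib add_divide_distrib)
  also have "\<dots> = 2 * (cos dl * cos ep - sin dl * sin ep)"
    unfolding s using sin_dl_pos by (simp add: field_simps)
  finally have *: "of_real (rad (Suc i)) * cis dl - of_real (rad i) = 2 * cis (dl + ep)"
    using assms sin_dl_pos
    by (simp add: complex_eq_iff rad_def sin_add cos_add)
  have "star (Suc i) - star i = cis (dl * real i) * (of_real (rad (Suc i)) * cis dl - of_real (rad i))"
    unfolding star_sector by (simp add: star_def right_diff_distrib)
  also have "\<dots> = 2 * cis (dl * real (Suc i) + ep)" unfolding * by (simp add: cis_mult distrib_left add_ac)
  finally show ?thesis .
qed

lemma star_mod: "i < 2 * m \<Longrightarrow> star (Suc i mod (2 * m)) = star (Suc i)"
  using star_period by (cases "Suc i = 2 * m") auto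

lemma elen_star: "i < 2 * m \<Longrightarrow> elen (2 * m) star i = 2"
  by (cases "even i") (simp_all add: elen_def star_mod star_diff_even star_diff_odd norm_mult)

lemma cum_star: "i \<le> 2 * m \<Longrightarrow> cum (2 * m) star i = 2 * real i"
  by (simp add: cum_def elen_star)

lemma perim_star: "perim (2 * m) star = 4 * real m"
  by (simp add: perim_def cum_star)

lemma eidx_star:
  assumes "i < 2 * m" "2 * real i \<le> t" "t < 2 * real i + 2"
  shows "eidx (2 * m) star t = i"
proof -
  have "{j. 1 \<le> j \<and> j < 2 * m \<and> cum (2 * m) star j \<le> t} = {1..i}"
    using assms by (auto simp: cum_star)
  then show ?thesis by (simp add: eidx_def)
qed

lemma bpt_star:
  assumes "i < 2 * m" "2 * real i \<le> t" "t < 2 * real i + 2"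
  shows "bpt (2 * m) star t = star i + of_real ((t - 2 * real i) / 2) * (star (Suc i) - star i)"
  using assms by (simp add: bpt_def eidx_star Let_def elen_star cum_star star_mod)

lemma edge_ex:
  assumes "t \<in> {0..<4 * real m}"
  obtains i where "i < 2 * m" "2 * real i \<le> t" "t < 2 * real i + 2"
proof
  define i where "i = nat \<lfloor>t / 2\<rfloor>"
  have i: "real i \<le> t / 2" "t / 2 < real i + 1" using assms unfolding i_def by (simp_all; linarith)+
  then show "2 * real i \<le> t" "t < 2 * real i + 2" by auto
  then have "real i < real (2 * m)" using assms by simp
  then show "i < 2 * m" by linarith
qed

lemma bpt_star_sector:
  assumes "i < 2 * m" "2 * real i \<le> t" "t < 2 * real i + 2"
  defines "x \<equiv> (t - 2 * real i) / 2"
  shows "bpt (2 * m) star t = cis (dl * real i) * (of_real ((1 - x) * rad i) + of_real (x * rad (Suc i)) * cis dl)"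
  using bpt_star[OF assms(1-3)] unfolding x_def[symmetric] star_sector by (simp add: star_def algebra_simps)

lemma bpt_star_polar:
  assumes i: "i < 2 * m" "2 * real i \<le> t" "t < 2 * real i + 2"
  shows "\<exists>r a. r > 0 \<and> 0 \<le> a \<and> a < dl \<and> bpt (2 * m) star t = rcis r (dl * real i + a)"
proof -
  define x where "x = (t - 2 * real i) / 2"
  have x: "0 \<le> x" "x < 1" using i by (auto simp: x_def)
  obtain r a where *: "r > 0" "0 \<le> a" "a < dl"
    "of_real ((1 - x) * rad i) + of_real (x * rad (Suc i)) * cis dl = rcis r a"
    using sector_polar[of dl "(1 - x) * rad i" "x * rad (Suc i)"] dl_ep x rad_pos[of i] rad_pos[of "Suc i"] by auto
  have "bpt (2 * m) star t = rcis r (dl * real i + a)"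
    unfolding bpt_star_sector[OF i] x_def[symmetric] *(4) by (simp add: rcis_def cis_mult[symmetric])
  then show ?thesis using * by blast
qed

lemma bpt_star_neq_0: "t \<in> {0..<4 * real m} \<Longrightarrow> bpt (2 * m) star t \<noteq> 0"
  using edge_ex bpt_star_polar by (metis rcis_eq_zero_iff less_irrefl)

lemma sector_angle_range:
  assumes "i < 2 * m" "0 \<le> a" "a < dl"
  shows "0 \<le> dl * real i + a" "dl * real i + a < 2 * pi"
proof -
  show "0 \<le> dl * real i + a" using assms dl_ep by simp
  have "dl * (real i + 1) \<le> dl * (2 * real m)" using assms dl_ep by (intro mult_left_mono) auto
  then show "dl * real i + a < 2 * pi" using assms dl_ep by (simp add: algebra_simps)
qed

text \<open>Every edge spans its own half-open angular sector, so the argument determines the edge,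
  and inside a sector the coefficients along the two end vertices determine the rest. With both
  factors 1 this is simplicity of the boundary; with general factors it makes radial coordinates
  unique.\<close>

lemma star_ray_unique:
  assumes s: "s > 0" "s' > 0" and t: "t \<in> {0..<4 * real m}" "t' \<in> {0..<4 * real m}"
    and eq: "of_real s * bpt (2 * m) star t = of_real s' * bpt (2 * m) star t'"
  shows "s = s'" "t = t'"
proof -
  obtain i where i: "i < 2 * m" "2 * real i \<le> t" "t < 2 * real i + 2" using edge_ex[OF t(1)] .
  obtain i' where i': "i' < 2 * m" "2 * real i' \<le> t'" "t' < 2 * real i' + 2" using edge_ex[OF t(2)] .
  obtain r a where ra: "r > 0" "0 \<le> a" "a < dl" "bpt (2 * m) star t = rcis r (dl * real i + a)"
    using bpt_star_polar[OF i] by blast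
  obtain r' a' where ra': "r' > 0" "0 \<le> a'" "a' < dl" "bpt (2 * m) star t' = rcis r' (dl * real i' + a')"
    using bpt_star_polar[OF i'] by blast
  have "rcis (s * r) (dl * real i + a) = rcis (s' * r') (dl * real i' + a')"
    using eq ra ra' by (simp add: rcis_def algebra_simps)
  then have ang: "dl * real i + a = dl * real i' + a'"
    by (rule rcis_unique(2)) (use s ra ra' i i' sector_angle_range in auto)
  have "\<not> i < i'" if "dl * real i + a = dl * real i' + a'" "0 \<le> a'" "a < dl" for i i' a a'
  proof
    assume "i < i'"
    then have "dl * (real i + 1) \<le> dl * real i'" using dl_ep by (intro mult_left_mono) auto
    then show False using that by (simp add: algebra_simps)
  qed
  from this[of i a i' a'] this[of i' a' i a] have ii: "i = i'" using ang ra ra' by auto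
  define x x' where "x = (t - 2 * real i) / 2" "x' = (t' - 2 * real i) / 2"
  have "cis (dl * real i) * (of_real s * (of_real ((1 - x) * rad i) + of_real (x * rad (Suc i)) * cis dl)) =
     cis (dl * real i) * (of_real s' * (of_real ((1 - x') * rad i) + of_real (x' * rad (Suc i)) * cis dl))"
    using eq unfolding bpt_star_sector[OF i] bpt_star_sector[OF i'] ii x_x'_def by (simp only: mult.left_commute)
  then have e: "of_real s * (of_real ((1 - x) * rad i) + of_real (x * rad (Suc i)) * cis dl) =
     of_real s' * (of_real ((1 - x') * rad i) + of_real (x' * rad (Suc i)) * cis dl)" by simp
  have "s * (x * rad (Suc i)) * sin dl = s' * (x' * rad (Suc i)) * sin dl"
    using arg_cong[OF e, of Im] by (simp add: algebra_simps)
  then have im: "s * x = s' * x'" using sin_dl_pos rad_pos[of "Suc i"] by (auto simp: algebra_simps)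
  have "s * ((1 - x) * rad i) + (s * x) * rad (Suc i) * cos dl = s' * ((1 - x') * rad i) + (s' * x') * rad (Suc i) * cos dl"
    using arg_cong[OF e, of Re] by (simp add: algebra_simps)
  then have "s * (1 - x) * rad i = s' * (1 - x') * rad i" unfolding im by (simp add: algebra_simps)
  then have "s * (1 - x) = s' * (1 - x')" using rad_pos[of i] by simp
  then show "s = s'" using im by (simp add: algebra_simps)
  with im s have "x = x'" by simp
  then show "t = t'" by (simp add: x_x'_def)
qed

lemma star_ray_ex:
  "\<exists>s t. s \<ge> 0 \<and> t \<in> {0..<4 * real m} \<and> z = of_real s * bpt (2 * m) star t"
proof (cases "z = 0")
  case True
  then show ?thesis using m by (intro exI[of _ 0]) auto
next
  case False
  define th where "th = Arg2pi z"
  define i where "i = nat \<lfloor>th / dl\<rfloor>"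
  define a where "a = th - dl * real i"
  have th: "0 \<le> th" "th < 2 * pi" "z = rcis (cmod z) th"
    using Arg2pi[of z] Arg2pi_eq[of z] by (auto simp: th_def rcis_def cis_conv_exp)
  have "0 \<le> th / dl" using th dl_ep by simp
  then have i: "real i \<le> th / dl" "th / dl < real i + 1" unfolding i_def by (simp; linarith)+
  then have a: "0 \<le> a" "a < dl" using dl_ep by (auto simp: a_def field_simps)
  have "dl * real i < 2 * pi" using a(1) th(2) by (simp add: a_def)
  then have "dl * real i < dl * (2 * real m)" by (simp only: dl_ep(6))
  then have "real i < 2 * real m" using mult_less_cancel_left_pos[OF dl_ep(1)] by blast
  then have im: "i < 2 * m" by linarith
  obtain A B where AB: "A > 0" "B \<ge> 0" "of_real A + of_real B * cis dl = rcis (cmod z) a"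
    using sector_coords[OF dl_ep(1,2) a, of "cmod z"] False by auto
  \<comment> \<open>\<open>A / rad i\<close> and \<open>B / rad (Suc i)\<close> are the coordinates
    with respect to the two ends of the edge: their sum is the radial factor, and the normalised
    second one is the position on the edge.\<close>
  define s where "s = A / rad i + B / rad (Suc i)"
  define x where "x = B / rad (Suc i) / s"
  define t where "t = 2 * real i + 2 * x"
  note rp = rad_pos[of i] rad_pos[of "Suc i"]
  have "A / rad i > 0" "B / rad (Suc i) \<ge> 0" using AB rp by auto
  then have s: "s > 0" by (simp add: s_def)
  have x: "0 \<le> x" "x < 1"
  proof -
    have "B / rad (Suc i) < s" using \<open>A / rad i > 0\<close> by (simp add: s_def)
    then show "x < 1" unfolding x_def using s by (subst divide_less_eq_1_pos)
    show "0 \<le> x" unfolding x_def using s \<open>B / rad (Suc i) \<ge> 0\<close> by (rule divide_nonneg_pos[rotated])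
  qed
  have t: "2 * real i \<le> t" "t < 2 * real i + 2" using x by (auto simp: t_def)
  have sx: "s * x = B / rad (Suc i)" using s by (simp add: x_def)
  then have "s * (1 - x) = s - B / rad (Suc i)" by (simp only: right_diff_distrib mult_1_right)
  then have "s * (1 - x) = A / rad i" by (simp add: s_def)
  with sx have sAB: "s * (1 - x) * rad i = A" "s * x * rad (Suc i) = B" using rp by auto
  have "of_real s * bpt (2 * m) star t = cis (dl * real i) * (of_real (s * (1 - x) * rad i) + of_real (s * x * rad (Suc i)) * cis dl)"
    unfolding bpt_star_sector[OF im t] by (simp add: t_def algebra_simps)
  also have "\<dots> = cis (dl * real i) * rcis (cmod z) a" unfolding sAB AB(3) ..
  also have "\<dots> = rcis (cmod z) th" by (simp add: rcis_def cis_mult a_def)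
  also have "\<dots> = z" using th by simp
  finally have "z = of_real s * bpt (2 * m) star t" ..
  moreover have "t \<in> {0..<4 * real m}"
  proof -
    have "real i + 1 \<le> 2 * real m" using im by linarith
    then show ?thesis using t by auto
  qed
  ultimately show ?thesis using s by (metis less_eq_real_def)
qed

end

text \<open>A continuous map from a compact space to a Hausdorff space is closed onto its image,
  hence a quotient map. This avoids writing down an inverse of radial coordinates.\<close>

lemma continuous_on_compact_quotient:
  fixes q :: "'a :: topological_space \<Rightarrow> 'b :: t2_space" and h :: "'b \<Rightarrow> 'c :: topological_space"
  assumes K: "compact K" and q: "continuous_on K q" and hq: "continuous_on K (\<lambda>x. h (q x))"
  shows "continuous_on (q ` K) h"
proof -
  have c: "closed (q ` K)" using K q by (intro compact_imp_closed compact_continuous_image)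
  show ?thesis
    unfolding continuous_on_closed_vimage[OF c]
  proof (intro allI impI)
    fix C :: "'c set" assume C: "closed C"
    have "compact (K \<inter> (\<lambda>x. h (q x)) -` C)"
    proof -
      have "closedin (top_of_set K) (K \<inter> (\<lambda>x. h (q x)) -` C)"
        using hq C by (rule continuous_closedin_preimage)
      then show ?thesis using K by (rule closedin_compact[rotated])
    qed
    then have "closed (q ` (K \<inter> (\<lambda>x. h (q x)) -` C))"
      using q by (intro compact_imp_closed compact_continuous_image) (auto intro: continuous_on_subset)
    moreover have "q ` (K \<inter> (\<lambda>x. h (q x)) -` C) = h -` C \<inter> q ` K" by auto
    ultimately show "closed (h -` C \<inter> q ` K)" by simp
  qed
qed

context halving begin

section \<open>Angles and simplicity of the star\<close>

lemma star_back_even: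
  assumes "i < 2 * m" "even i"
  shows "star i - star (prv (2 * m) i) = 2 * cis (dl * real i + ep)"
proof (cases i)
  case 0
  have "prv (2 * m) i = 2 * m - 1" using m by (simp add: prv_def 0)
  moreover have "odd (2 * m - 1)" using m by simp
  from star_diff_odd[OF this] have "star (2 * m) - star (2 * m - 1) = 2 * cis (dl * real (2 * m) + ep)"
    using m by simp
  moreover have "cis (dl * real (2 * m) + ep) = cis ep"
    using dl_ep(6) by (metis cis_2pi cis_mult mult_1 of_nat_mult of_nat_numeral)
  ultimately show ?thesis using star_period by (simp add: 0)
next
  case (Suc j)
  then have "prv (2 * m) i = j" using assms by (simp add: prv_def)
  then show ?thesis using star_diff_odd[of j] assms Suc by simp
qed

lemma star_back_odd:
  assumes "i < 2 * m" "odd i"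
  shows "star i - star (prv (2 * m) i) = - 2 * cis (dl * (real i - 1) - ep)"
proof (cases i)
  case (Suc j)
  then have "prv (2 * m) i = j" using assms by (simp add: prv_def)
  then show ?thesis using star_diff_even[of j] assms Suc by simp
qed (use assms in simp)

lemma turn_even: "i < 2 * m \<Longrightarrow> even i \<Longrightarrow> turn (2 * m) star i = cis (pi - 2 * ep)"
proof -
  assume i: "i < 2 * m" "even i"
  have "turn (2 * m) star i = - (cis (dl * real i - ep) / cis (dl * real i + ep))"
    using i by (simp add: turn_def star_mod star_diff_even star_back_even)
  also have "\<dots> = - cis (- 2 * ep)" by (simp add: cis_divide)
  finally show ?thesis by (simp add: complex_eq_iff)
qed

lemma turn_odd: "i < 2 * m \<Longrightarrow> odd i \<Longrightarrow> turn (2 * m) star i = cis (2 * dl + 2 * ep - pi)"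
proof -
  assume i: "i < 2 * m" "odd i"
  have "turn (2 * m) star i = - (cis (dl * real (Suc i) + ep) / cis (dl * (real i - 1) - ep))"
    using i by (simp add: turn_def star_mod star_diff_odd star_back_odd)
  also have "\<dots> = - cis (2 * dl + 2 * ep)" by (simp add: cis_divide algebra_simps)
  finally show ?thesis by (simp add: complex_eq_iff)
qed

lemma iangle_even: "i < 2 * m \<Longrightarrow> even i \<Longrightarrow> iangle (2 * m) star i = 2 * ep"
  using dl_ep by (simp add: iangle_def turn_even Arg_cis)

lemma iangle_odd: "i < 2 * m \<Longrightarrow> odd i \<Longrightarrow> iangle (2 * m) star i = 2 * pi - 2 * dl - 2 * ep"
  using dl_ep by (simp add: iangle_def turn_odd Arg_cis)

lemma inj_on_bpt_star: "inj_on (bpt (2 * m) star) {0..<4 * real m}"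
  using star_ray_unique(2)[of 1 1] by (auto simp: inj_on_def)

lemma sarea_star: "sarea (2 * m) star > 0"
proof -
  have "Im (cnj (star i) * star (Suc i mod (2 * m))) > 0" if "i < 2 * m" for i
  proof -
    have "cnj (star i) * star (Suc i) = (cnj (cis (dl * real i)) * cis (dl * real i)) * (of_real (rad i * rad (Suc i)) * cis dl)"
      unfolding star_sector by (simp add: star_def)
    also have "cnj (cis (dl * real i)) * cis (dl * real i) = 1"
      by (simp add: cis_cnj cis_mult)
    finally have "Im (cnj (star i) * star (Suc i)) = rad i * rad (Suc i) * sin dl" by simp
    then show ?thesis using that rad_pos sin_dl_pos by (simp add: star_mod)
  qed
  moreover have "0 \<in> {..<2 * m}" using m by simp
  then have "{..<2 * m} \<noteq> {}" by blast
  ultimately show ?thesis unfolding sarea_def by (intro sum_pos) auto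
qed

lemma simple_polygon_star:
  assumes "m \<ge> 4"
  shows "simple_polygon (2 * m) star"
  unfolding simple_polygon_def perim_star
proof (intro conjI allI impI inj_on_bpt_star sarea_star)
  show "3 \<le> 2 * m" using assms by simp
next
  fix i assume i: "i < 2 * m"
  have "star (Suc i) - star i \<noteq> 0" by (cases "even i") (simp_all add: star_diff_even star_diff_odd)
  then show "star (Suc i mod (2 * m)) \<noteq> star i" using i by (simp add: star_mod)
  \<comment> \<open>For m at least 4 these bounds make \<open>2 * dl + 2 * ep\<close> less than pi,
    so tips turn strictly left and the other vertices strictly right.\<close>
  have "4 * dl \<le> real m * dl" using assms dl_ep(1) by (intro mult_right_mono) auto
  moreover have "4 * ep \<le> real m * ep" using assms dl_ep(3) by (intro mult_right_mono) auto
  moreover have "real m * dl = pi" using m by (simp add: dl_def)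
  ultimately have "4 * dl \<le> pi" "4 * ep \<le> dl" using dl_ep(7) by simp_all
  moreover have "Arg (turn (2 * m) star i) = (if even i then pi - 2 * ep else 2 * dl + 2 * ep - pi)"
    using dl_ep i by (simp add: turn_even turn_odd Arg_cis)
  ultimately show "Arg (turn (2 * m) star i) \<noteq> 0" using dl_ep(1,3) by auto
qed

text \<open>The boundary as a loop on a closed interval: Jordan's theorem and the quotient argument
  both need the compact domain.\<close>

definition closed_bpt :: "real \<Rightarrow> complex" where
  "closed_bpt t = bpt (2 * m) star (if t = 4 * real m then 0 else t)"

lemma closed_bpt_edge:
  assumes i: "i < 2 * m" "2 * real i \<le> t" "t \<le> 2 * real i + 2"
  shows "closed_bpt t = star i + of_real ((t - 2 * real i) / 2) * (star (Suc i) - star i)"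
proof (cases "t = 2 * real i + 2")
  case False
  have "real i + 1 \<le> 2 * real m" using i(1) by linarith
  then have "closed_bpt t = bpt (2 * m) star t" using False i by (simp add: closed_bpt_def)
  then show ?thesis using bpt_star[of i t] i False by simp
next
  case True
  have "closed_bpt t = star (Suc i)"
  proof (cases "Suc i = 2 * m")
    case e: True
    then have "t = 4 * real m" using True by linarith
    then show ?thesis using bpt_star[of 0 0] m e star_period by (simp add: closed_bpt_def)
  next
    case False
    then have "Suc i < 2 * m" using i by simp
    moreover from this have "real (Suc i) < real (2 * m)" by (simp only: of_nat_less_iff)
    ultimately show ?thesis using bpt_star[of "Suc i" t] True by (simp add: closed_bpt_def)
  qed
  then show ?thesis using True by simp
qed

lemma continuous_on_closed_bpt: "continuous_on {0..4 * real m} closed_bpt"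
proof -
  have "k \<le> 2 * m \<Longrightarrow> continuous_on {0..2 * real k} closed_bpt" for k
  proof (induction k)
    case (Suc k)
    have "continuous_on {2 * real k..2 * real k + 2} (\<lambda>t. star k + of_real ((t - 2 * real k) / 2) * (star (Suc k) - star k))"
      by (intro continuous_intros) auto
    then have "continuous_on {2 * real k..2 * real k + 2} closed_bpt"
      using closed_bpt_edge[of k] Suc.prems by (subst continuous_on_cong[OF refl]) auto
    then have "continuous_on ({0..2 * real k} \<union> {2 * real k..2 * real k + 2}) closed_bpt"
      using Suc by (intro continuous_on_closed_Un) auto
    moreover have "{0..2 * real k} \<union> {2 * real k..2 * real k + 2} = {0..2 * real (Suc k)}" by auto
    ultimately show ?case by simp
  qed simp
  from this[of "2 * m"] show ?thesis by simp
qed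

lemma closed_bpt_eq: "t \<in> {0..<4 * real m} \<Longrightarrow> closed_bpt t = bpt (2 * m) star t"
  by (simp add: closed_bpt_def)

lemma closed_bpt_end: "closed_bpt (4 * real m) = closed_bpt 0"
  by (simp add: closed_bpt_def)

lemma closed_bpt_image: "closed_bpt ` {0..4 * real m} = bdry (2 * m) star"
proof -
  have "{0..4 * real m} = insert (4 * real m) {0..<4 * real m}" by auto
  then have "closed_bpt ` {0..4 * real m} = closed_bpt ` {0..<4 * real m}"
    using closed_bpt_end m by auto
  then show ?thesis by (simp add: bdry_def perim_star closed_bpt_eq)
qed

lemma star_Jordan:
  "inside (bdry (2 * m) star) \<noteq> {}" "connected (outside (bdry (2 * m) star))"
  "inside (bdry (2 * m) star) \<inter> outside (bdry (2 * m) star) = {}"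
  "inside (bdry (2 * m) star) \<union> outside (bdry (2 * m) star) = - bdry (2 * m) star"
  "bounded (inside (bdry (2 * m) star))"
proof -
  define c where "c u = closed_bpt (4 * real m * u)" for u
  have im: "(\<lambda>u. 4 * real m * u) ` {0..1} = {0..4 * real m}"
    using m by (simp add: image_mult_atLeastAtMost)
  have "path c"
    unfolding path_def c_def
    by (rule continuous_on_compose2[OF continuous_on_closed_bpt]) (use im in \<open>auto intro!: continuous_intros\<close>)
  moreover have pi: "path_image c = bdry (2 * m) star"
    unfolding path_image_def c_def using im closed_bpt_image by (metis image_image)
  moreover have "u = v \<or> (u = 0 \<and> v = 1) \<or> (u = 1 \<and> v = 0)"
    if "u \<in> {0..1}" "v \<in> {0..1}" "c u = c v" for u v
  proof -
    define f where "f u = (if u = 1 then 0 else 4 * real m * u)" for u :: real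
    have "c w = bpt (2 * m) star (f w)" "f w \<in> {0..<4 * real m}" if "w \<in> {0..1}" for w
      using that m by (auto simp: c_def f_def closed_bpt_def)
    then have "f u = f v" using that inj_on_bpt_star by (metis inj_onD)
    then show ?thesis using m by (auto simp: f_def split: if_splits)
  qed
  ultimately have "simple_path c" by (simp add: simple_path_def loop_free_def)
  moreover have "pathfinish c = pathstart c" using closed_bpt_end by (simp add: pathfinish_def pathstart_def c_def)
  ultimately show "inside (bdry (2 * m) star) \<noteq> {}" "connected (outside (bdry (2 * m) star))"
  "inside (bdry (2 * m) star) \<inter> outside (bdry (2 * m) star) = {}"
  "inside (bdry (2 * m) star) \<union> outside (bdry (2 * m) star) = - bdry (2 * m) star"
  "bounded (inside (bdry (2 * m) star))"
    using Jordan_inside_outside[of c] by (auto simp: pi)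
qed

definition cone :: "real \<times> real \<Rightarrow> complex" where
  "cone = (\<lambda>(s, t). of_real s * closed_bpt t)"

lemma continuous_on_cone: "continuous_on (S \<times> {0..4 * real m}) cone"
  unfolding cone_def case_prod_unfold
  by (intro continuous_intros continuous_on_compose2[OF continuous_on_closed_bpt]) auto

lemma cone_inner_outer_disjoint:
  "0 \<le> s \<Longrightarrow> s \<noteq> 1 \<Longrightarrow> t \<in> {0..4 * real m} \<Longrightarrow> cone (s, t) \<notin> bdry (2 * m) star"
proof
  assume s: "0 \<le> s" "s \<noteq> 1" and t: "t \<in> {0..4 * real m}" and b: "cone (s, t) \<in> bdry (2 * m) star"
  define u where "u = (if t = 4 * real m then 0 else t)"
  have u: "u \<in> {0..<4 * real m}" using t m by (auto simp: u_def)
  have e: "cone (s, t) = of_real s * bpt (2 * m) star u" by (simp add: cone_def closed_bpt_def u_def)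
  obtain v where v: "v \<in> {0..<4 * real m}" "cone (s, t) = bpt (2 * m) star v"
    using b by (auto simp: bdry_def perim_star)
  show False
  proof (cases "s = 0")
    case True
    then show False using e v bpt_star_neq_0 by simp
  next
    case False
    have "of_real s * bpt (2 * m) star u = of_real 1 * bpt (2 * m) star v" using e v by simp
    from star_ray_unique(1)[OF _ _ u v(1) this] show False using s False by simp
  qed
qed

text \<open>The points with radial factor below 1 and those with factor above 1 form connected sets
  that miss the boundary and, with it, cover the plane. The second set is unbounded, hence outside;
  so the nonempty inside meets the first set and therefore equals it.\<close>

lemma region_star: "region (2 * m) star = cone ` ({0..1} \<times> {0..4 * real m})"
proof -
  define B where "B = bdry (2 * m) star"
  define U where "U = cone ` ({0..<1} \<times> {0..4 * real m})"
  define V where "V = cone ` ({1<..} \<times> {0..4 * real m})"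
  note J = star_Jordan[folded B_def]
  have cov: "z \<in> U \<union> V \<union> B" for z
  proof -
    obtain s t where st: "s \<ge> 0" "t \<in> {0..<4 * real m}" "z = of_real s * bpt (2 * m) star t"
      using star_ray_ex by blast
    then have z: "z = cone (s, t)" by (simp add: cone_def closed_bpt_eq)
    consider "s < 1" | "s = 1" | "s > 1" by linarith
    then show ?thesis
    proof cases
      case 1
      then have "z \<in> U" unfolding U_def z using st by (intro imageI) auto
      then show ?thesis by blast
    next
      case 2
      then have "z \<in> B" unfolding B_def bdry_def perim_star using st by auto
      then show ?thesis by blast
    next
      case 3
      then have "z \<in> V" unfolding V_def z using st by (intro imageI) auto
      then show ?thesis by blast
    qed
  qed
  have dis: "U \<inter> B = {}" "V \<inter> B = {}"
    unfolding U_def V_def B_def using cone_inner_outer_disjoint by fastforce+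
  have conn: "connected U" "connected V"
    unfolding U_def V_def
    by (intro connected_continuous_image continuous_on_cone connected_Times; simp)+
  have ub: "\<not> bounded V"
  proof
    assume "bounded V"
    then obtain C where C: "\<And>z. z \<in> V \<Longrightarrow> cmod z \<le> C" by (auto simp: bounded_iff)
    define b where "b = cmod (closed_bpt 0)"
    have "b > 0" using bpt_star_neq_0[of 0] m by (simp add: b_def closed_bpt_def)
    define s where "s = max 2 ((C + 1) / b)"
    have "cone (s, 0) \<in> V" unfolding V_def by (intro imageI) (auto simp: s_def)
    then have "s * b \<le> C" using C[of "cone (s, 0)"] by (simp add: cone_def norm_mult b_def s_def)
    moreover have "(C + 1) / b * b \<le> s * b" using \<open>b > 0\<close> by (intro mult_right_mono) (auto simp: s_def)
    ultimately show False using \<open>b > 0\<close> by simp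
  qed
  have Vout: "V \<subseteq> outside B"
  proof
    fix z assume z: "z \<in> V"
    have "V \<subseteq> connected_component_set (- B) z"
      using z conn dis by (intro connected_component_maximal) auto
    then show "z \<in> outside B" using ub bounded_subset by (auto simp: outside)
  qed
  have inU: "inside B \<subseteq> U" using cov Vout J(3) J(4) by blast
  then obtain w where w: "w \<in> inside B" "w \<in> U" using J(1) by blast
  have "U \<subseteq> connected_component_set (- B) w"
    using w conn dis by (intro connected_component_maximal) auto
  then have "U \<subseteq> inside B"
    using w inside_same_component by blast
  with inU have "inside B = U" by blast
  then have "region (2 * m) star = B \<union> U" by (simp add: region_def B_def)
  also have "B = cone ` ({1} \<times> {0..4 * real m})"
    unfolding B_def closed_bpt_image[symmetric] by (force simp: cone_def)
  also have "\<dots> \<union> U = cone ` ({0..1} \<times> {0..4 * real m})"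
  proof -
    have "{0..1} = insert 1 {0..<1 :: real}" by auto
    then have "{0..1 :: real} \<times> {0..4 * real m} = {1} \<times> {0..4 * real m} \<union> {0..<1} \<times> {0..4 * real m}"
      by auto
    then show ?thesis unfolding U_def by (simp only: image_Un)
  qed
  finally show ?thesis .
qed

section \<open>The star region as a disc\<close>

lemma bparam_rcis: "of_real s * bparam t = rcis s (pi * (t + 1) / (2 * real m))"
  by (simp add: rcis_def bparam_def)

lemma bparam_ray_unique:
  assumes s: "s > 0" "s' > 0" and t: "t \<in> {0..<4 * real m}" "t' \<in> {0..<4 * real m}"
    and eq: "of_real s * bparam t = of_real s' * bparam t'"
  shows "s = s'" "t = t'"
proof -
  define a where "a t = pi * t / (2 * real m)" for t
  have ad: "pi * (t + 1) / (2 * real m) = a t + a 1" for t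
    by (simp add: a_def distrib_left add_divide_distrib)
  have "rcis s (a t) * cis (a 1) = rcis s' (a t') * cis (a 1)"
    using eq unfolding bparam_rcis ad by (simp add: rcis_def cis_mult[symmetric])
  then have e: "rcis s (a t) = rcis s' (a t')" by simp
  have r: "0 \<le> a t \<and> a t < 2 * pi" if "t \<in> {0..<4 * real m}" for t
  proof -
    have "pi * t < pi * (4 * real m)" using that by (intro mult_strict_left_mono) auto
    then show ?thesis using that m by (simp add: a_def field_simps)
  qed
  show "s = s'" using rcis_unique(1)[OF e s] r[OF t(1)] r[OF t(2)] by blast
  have "a t = a t'" using rcis_unique(2)[OF e s] r[OF t(1)] r[OF t(2)] by blast
  then show "t = t'" using m by (simp add: a_def)
qed

lemma bparam_ray_ex:
  assumes "cmod w \<le> 1"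
  shows "\<exists>s t. s \<in> {0..1} \<and> t \<in> {0..<4 * real m} \<and> w = of_real s * bparam t"
proof -
  define th where "th = Arg2pi w"
  have th: "0 \<le> th" "th < 2 * pi" "w = rcis (cmod w) th"
    using Arg2pi[of w] Arg2pi_eq[of w] by (auto simp: th_def rcis_def cis_conv_exp)
  define t where "t = 2 * real m * th / pi - 1"
  have "2 * real m * th < 2 * real m * (2 * pi)" using th m by (intro mult_strict_left_mono) auto
  then have t: "-1 \<le> t" "t < 4 * real m" using th by (auto simp: t_def field_simps)
  have "pi * (t + 1) / (2 * real m) = th" using m by (simp add: t_def)
  then have w: "w = of_real (cmod w) * bparam t" using th(3) unfolding bparam_rcis by simp
  show ?thesis
  proof (cases "t \<ge> 0")
    case True
    then show ?thesis using w t assms by (intro exI[of _ "cmod w"] exI[of _ t]) auto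
  next
    case False
    have "w = of_real (cmod w) * bparam (t + 4 * real m)" using w bparam_periodic[of "t + 4 * real m"] by simp
    then show ?thesis using False t assms m by (intro exI[of _ "cmod w"] exI[of _ "t + 4 * real m"]) auto
  qed
qed

text \<open>The radial map that keeps the factor and replaces the boundary point of the star by that
  of the circle. Uniqueness of radial coordinates makes the description definite; at the centre the
  boundary parameter is ambiguous, but the value is 0.\<close>

definition to_disc :: "complex \<Rightarrow> complex" where
  "to_disc z = (THE w. \<exists>s t. s \<in> {0..1} \<and> t \<in> {0..<4 * real m} \<and>
     z = of_real s * bpt (2 * m) star t \<and> w = of_real s * bparam t)"

lemma to_disc_eq:
  assumes s: "s \<in> {0..1}" and t: "t \<in> {0..<4 * real m}"
  shows "to_disc (of_real s * bpt (2 * m) star t) = of_real s * bparam t"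
  unfolding to_disc_def
proof (rule the_equality)
  show "\<exists>s' t'. s' \<in> {0..1} \<and> t' \<in> {0..<4 * real m} \<and>
     of_real s * bpt (2 * m) star t = of_real s' * bpt (2 * m) star t' \<and> of_real s * bparam t = of_real s' * bparam t'"
    using s t by blast
next
  fix w assume "\<exists>s' t'. s' \<in> {0..1} \<and> t' \<in> {0..<4 * real m} \<and>
     of_real s * bpt (2 * m) star t = of_real s' * bpt (2 * m) star t' \<and> w = of_real s' * bparam t'"
  then obtain s' t' where st': "s' \<in> {0..1}" "t' \<in> {0..<4 * real m}"
     "of_real s * bpt (2 * m) star t = of_real s' * bpt (2 * m) star t'" "w = of_real s' * bparam t'" by blast
  show "w = of_real s * bparam t"
  proof (cases "s = 0 \<or> s' = 0")
    case True
    then have "s = 0 \<and> s' = 0" using st'(3) bpt_star_neq_0[OF t] bpt_star_neq_0[OF st'(2)] by auto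
    then show ?thesis using st'(4) by simp
  next
    case False
    then have p: "s > 0" "s' > 0" using s st' by auto
    from star_ray_unique[OF p t st'(2,3)] show ?thesis using st'(4) by simp
  qed
qed

lemma to_disc_cone:
  assumes "s \<in> {0..1}" "t \<in> {0..4 * real m}"
  shows "to_disc (cone (s, t)) = of_real s * bparam t"
proof (cases "t = 4 * real m")
  case True
  then have "to_disc (cone (s, t)) = of_real s * bparam 0"
    using to_disc_eq[OF assms(1), of 0] m by (simp add: cone_def closed_bpt_def)
  then show ?thesis using bparam_periodic[of "4 * real m"] True by simp
next
  case False
  then show ?thesis using to_disc_eq[OF assms(1), of t] assms by (simp add: cone_def closed_bpt_def)
qed

lemma region_cases:
  assumes "z \<in> region (2 * m) star"
  obtains s t where "s \<in> {0..1}" "t \<in> {0..<4 * real m}" "z = of_real s * bpt (2 * m) star t"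
proof -
  obtain s t where st: "s \<in> {0..1}" "t \<in> {0..4 * real m}" "z = cone (s, t)"
    using assms unfolding region_star by auto
  define u where "u = (if t = 4 * real m then 0 else t)"
  have "u \<in> {0..<4 * real m}" using st m by (auto simp: u_def)
  moreover have "z = of_real s * bpt (2 * m) star u" using st by (simp add: cone_def closed_bpt_def u_def)
  ultimately show thesis using that st by blast
qed

text \<open>In radial coordinates the map is plainly continuous; the collapse at the centre and
  along the seam is absorbed by the quotient argument.\<close>

lemma continuous_on_to_disc: "continuous_on (region (2 * m) star) to_disc"
  unfolding region_star
proof (rule continuous_on_compact_quotient)
  show "compact ({0..1 :: real} \<times> {0..4 * real m})" by (intro compact_Times compact_Icc)
  show "continuous_on ({0..1} \<times> {0..4 * real m}) cone" by (rule continuous_on_cone)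
  have "continuous_on ({0..1} \<times> {0..4 * real m}) (\<lambda>x. of_real (fst x) * bparam (snd x))"
    unfolding bparam_def using m by (intro continuous_intros) auto
  then show "continuous_on ({0..1} \<times> {0..4 * real m}) (\<lambda>x. to_disc (cone x))"
    by (rule continuous_on_eq) (use to_disc_cone in auto)
qed

lemma norm_bparam [simp]: "cmod (bparam t) = 1"
  by (simp add: bparam_def)

lemma to_disc_image: "to_disc ` region (2 * m) star = cball 0 1"
proof (intro equalityI subsetI)
  fix w :: complex assume "w \<in> cball 0 1"
  then obtain s t where st: "s \<in> {0..1}" "t \<in> {0..<4 * real m}" "w = of_real s * bparam t"
    using bparam_ray_ex[of w] by auto
  then have "w = to_disc (cone (s, t))" using to_disc_cone by auto
  moreover have "cone (s, t) \<in> region (2 * m) star" unfolding region_star using st by (intro imageI) auto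
  ultimately show "w \<in> to_disc ` region (2 * m) star" by blast
next
  fix w assume "w \<in> to_disc ` region (2 * m) star"
  then obtain z where z: "z \<in> region (2 * m) star" "w = to_disc z" by blast
  from z(1) obtain s t where "s \<in> {0..1}" "t \<in> {0..<4 * real m}" "z = of_real s * bpt (2 * m) star t"
    by (rule region_cases)
  then show "w \<in> cball 0 1" using z to_disc_eq[of s t] by (simp add: norm_mult)
qed

lemma to_disc_inj:
  assumes "x \<in> region (2 * m) star" "y \<in> region (2 * m) star" "to_disc x = to_disc y"
  shows "x = y"
proof -
  obtain s t where st: "s \<in> {0..1}" "t \<in> {0..<4 * real m}" "x = of_real s * bpt (2 * m) star t"
    using assms(1) by (rule region_cases)
  obtain s' t' where st': "s' \<in> {0..1}" "t' \<in> {0..<4 * real m}" "y = of_real s' * bpt (2 * m) star t'"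
    using assms(2) by (rule region_cases)
  have eq: "of_real s * bparam t = of_real s' * bparam t'" using assms(3) st st' by (simp add: to_disc_eq)
  then have "cmod (of_real s * bparam t) = cmod (of_real s' * bparam t')" by simp
  then have ss: "s = s'" using st st' by (simp add: norm_mult)
  show ?thesis
  proof (cases "s = 0")
    case False
    then have "s > 0" "s' > 0" using st ss by auto
    from bparam_ray_unique(2)[OF this st(2) st'(2) eq] show ?thesis using ss st st' by simp
  qed (use st st' ss in simp)
qed

lemma glues_to_sphere_zip: "glues_to_sphere (2 * m) star (zip_gluing m B)"
  unfolding glues_to_sphere_def
proof (intro exI conjI ballI)
  show "continuous_on (region (2 * m) star) (\<lambda>z. sphmap B (to_disc z))"
    using continuous_on_to_disc to_disc_image
    by (intro continuous_on_compose2[OF continuous_on_sphmap]) auto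
  show "(\<lambda>z. sphmap B (to_disc z)) ` region (2 * m) star = sphere 0 1"
    using sphmap_image[of B] to_disc_image by (metis image_image)
next
  fix x y assume x: "x \<in> region (2 * m) star" and y: "y \<in> region (2 * m) star"
  show "sphmap B (to_disc x) = sphmap B (to_disc y) \<longleftrightarrow> pt_rel (2 * m) star (zip_gluing m B) x y"
  proof
    assume eq: "sphmap B (to_disc x) = sphmap B (to_disc y)"
    show "pt_rel (2 * m) star (zip_gluing m B) x y"
    proof (cases "x = y")
      case False
      then have ne: "to_disc x \<noteq> to_disc y" using to_disc_inj x y by blast
      have le: "cmod (to_disc x) \<le> 1" "cmod (to_disc y) \<le> 1" using to_disc_image x y by auto
      have one: "cmod (to_disc x) = 1" "cmod (to_disc y) = 1"
        using sphmap_eqD[OF le eq ne] by auto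
      have b: "\<exists>t\<in>{0..<4 * real m}. z = bpt (2 * m) star t \<and> to_disc z = bparam t"
        if zr: "z \<in> region (2 * m) star" and z1: "cmod (to_disc z) = 1" for z
      proof -
        obtain s t where st: "s \<in> {0..1}" "t \<in> {0..<4 * real m}" "z = of_real s * bpt (2 * m) star t"
          using zr by (rule region_cases)
        then have "s = 1" using z1 by (simp add: to_disc_eq norm_mult)
        then show ?thesis using st to_disc_eq[OF st(1,2)] by auto
      qed
      obtain s where s: "s \<in> {0..<4 * real m}" "x = bpt (2 * m) star s" "to_disc x = bparam s"
        using b[OF x one(1)] by blast
      obtain t where t: "t \<in> {0..<4 * real m}" "y = bpt (2 * m) star t" "to_disc y = bparam t"
        using b[OF y one(2)] by blast
      have "bdmap B s = bdmap B t" using eq s t by (simp add: bdmap_def)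
      then have "zip_gluing m B s t" using s t by (intro bdmap_eq_imp_zip_gluing)
      then show ?thesis using s t unfolding pt_rel_def perim_star by blast
    qed (simp add: pt_rel_def)
  next
    assume "pt_rel (2 * m) star (zip_gluing m B) x y"
    then consider "x = y" | s t where "s \<in> {0..<4 * real m}" "t \<in> {0..<4 * real m}" "zip_gluing m B s t"
        "x = bpt (2 * m) star s" "y = bpt (2 * m) star t"
      unfolding pt_rel_def perim_star by blast
    then show "sphmap B (to_disc x) = sphmap B (to_disc y)"
    proof cases
      case 2
      then show ?thesis
        using zip_gluing_imp_bdmap_eq[OF 2(3)] to_disc_eq[of 1 s] to_disc_eq[of 1 t] by (simp add: bdmap_def)
    qed simp
  qed
qed

lemma is_gluing_zip: "is_gluing (2 * m) star (zip_gluing m B)"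
proof -
  have "gluing_data (perim (2 * m) star) (int_points (4 * int m)) (flip (partner m B))"
    using gluing_data_flip[of "4 * int m" "partner m B"] partner_involution[OF m] m by (simp add: perim_star)
  then show ?thesis unfolding is_gluing_def by (auto simp: perim_star intro!: exI)
qed

end

section \<open>Classes of glued points and their angles\<close>

text \<open>Its own zip lifts the point into the open half-plane, and no later zip returns it to the
  real line. Interior points of zipped blocks therefore escape the final fold.\<close>

lemma Im_zips_zip_interior:
  "i < q \<Longrightarrow> i \<in> B \<Longrightarrow> \<bar>x - (4 * real i + 2)\<bar> < 2 \<Longrightarrow> Im (zips B q (of_real x)) \<noteq> 0"
proof (induction q)
  case (Suc q)
  define c where "c = real_of_int (4 * int q + 2 - 2 * nzip B q)"
  have Suc_eq: "zips B (Suc q) (of_real x) = (if q \<in> B then zipm c (zips B q (of_real x)) else zips B q (of_real x))"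
    by (simp add: c_def)
  show ?case
  proof (cases "i = q")
    case True
    then have "x \<ge> 4 * real q" using Suc.prems by (auto simp: abs_less_iff)
    then have z: "zips B q (of_real x) = of_real (x - 2 * of_int (nzip B q))" by (rule zips_right)
    have d: "x - 2 * of_int (nzip B q) - c = x - (4 * real q + 2)" by (simp add: c_def)
    have "Im (zipm c (of_real (x - 2 * of_int (nzip B q)))) \<noteq> 0"
      using Suc.prems(3) True by (subst zipm_real(1)) (auto simp: d)
    then show ?thesis unfolding Suc_eq z using True Suc.prems(2) by simp
  next
    case False
    then have "Im (zips B q (of_real x)) \<noteq> 0" using Suc by simp
    moreover have "Im (zips B q (of_real x)) \<ge> 0" by (rule Im_zips_nonneg) simp
    ultimately show ?thesis unfolding Suc_eq using Im_zipm_eq_0D(1) by auto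
  qed
qed simp

text \<open>Chains of reflections pass from one block to another only through block ends, which are
  multiples of 4; elsewhere an orbit is a mirror pair.\<close>

lemma zsteps_orbit:
  assumes z: "(zstep B q)\<^sup>*\<^sup>* x y" and x: "\<And>k. k \<le> q \<Longrightarrow> x \<noteq> 4 * real k"
  shows "y = x \<or> (\<exists>i<q. i \<in> B \<and> \<bar>x - (4 * real i + 2)\<bar> < 2 \<and> y = 8 * real i + 4 - x)"
  using z
proof induction
  case (step y z)
  obtain k where k: "k < q" "k \<in> B" "\<bar>y - (4 * real k + 2)\<bar> \<le> 2" "y + z = 2 * (4 * real k + 2)"
    using step.hyps(2) by (auto simp: zstep_def)
  from step.IH show ?case
  proof (elim disjE exE conjE)
    assume "y = x"
    moreover have "x \<noteq> 4 * real k" "x \<noteq> 4 * real (Suc k)" using x[of k] x[of "Suc k"] k(1) by auto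
    ultimately have "\<bar>x - (4 * real k + 2)\<bar> < 2" using k(3) by (auto simp: abs_if split: if_splits)
    then show ?thesis using k \<open>y = x\<close> by (intro disjI2 exI[of _ k]) auto
  next
    fix i assume i: "i < q" "i \<in> B" "\<bar>x - (4 * real i + 2)\<bar> < 2" "y = 8 * real i + 4 - x"
    have "real i < real k + 1" "real k < real i + 1" using i(3,4) k(3) by (auto simp: abs_if split: if_splits)
    then have "i = k" by linarith
    then show ?thesis using i k by simp
  qed
qed simp

context halving begin

text \<open>Away from the tips a point can be glued to itself, to its mirror image in a zip, or
  through the fold to a point with complementary position.\<close>

lemma zip_gluing_cases:
  assumes st: "zip_gluing m B s t" and s4: "\<And>k. s \<noteq> 4 * real k"
  shows "t = s \<or> (\<exists>i<m - 1. i \<in> B \<and> \<bar>s - (4 * real i + 2)\<bar> < 2 \<and> t = 8 * real i + 4 - s) \<or>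
    (zips' B (of_real (phi (unroll s))) \<noteq> zips' B (of_real (phi (unroll t))) \<and>
     (\<exists>v. zips' B (of_real (phi (unroll s))) = of_real v \<and>
         zips' B (of_real (phi (unroll t))) = of_real (4 * real m - 2 - v)))"
proof -
  have r: "s \<in> {0..<4 * real m}" "t \<in> {0..<4 * real m}" using zip_gluing_range[OF st] by auto
  have eq: "bdmap B s = bdmap B t" using st by (rule zip_gluing_imp_bdmap_eq)
  show ?thesis
  proof (cases "s = 4 * real m - 1 \<or> t = 4 * real m - 1")
    case True
    then have "s = t" using bdmap_eq_endD r eq by metis
    then show ?thesis by simp
  next
    case False
    then have n: "s \<noteq> 4 * real m - 1" "t \<noteq> 4 * real m - 1" by auto
    show ?thesis
    proof (cases "zips' B (of_real (phi (unroll s))) = zips' B (of_real (phi (unroll t)))")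
      case False
      then show ?thesis using bdmap_eqD[OF r(1) n(1) r(2) n(2) eq] by blast
    next
      case True
      then have z: "(zstep B (m - 1))\<^sup>*\<^sup>* (phi (unroll s)) (phi (unroll t))" by (rule zips_real_zsteps)
      show ?thesis
      proof (cases "phi (unroll s) = phi (unroll t)")
        case True
        then have "s = t" using phi_unroll_inj r n by blast
        then show ?thesis by simp
      next
        case ne: False
        with zip_gluing_zsteps[OF m z]
        have ran: "phi (unroll s) \<in> {0..4 * real m - 4}" "phi (unroll t) \<in> {0..4 * real m - 4}" by auto
        have "x = phi (unroll x)" if "x \<in> {0..<4 * real m}" "x \<noteq> 4 * real m - 1" "phi (unroll x) \<in> {0..4 * real m - 4}" for x
          using phi_unroll_inj[OF that(1,2), of "phi (unroll x)"] that(3) phi_unroll_id[of "phi (unroll x)"] by auto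
        then have "phi (unroll s) = s" "phi (unroll t) = t" using r n ran by metis+
        then have "(zstep B (m - 1))\<^sup>*\<^sup>* s t" using z by simp
        from zsteps_orbit[OF this] s4 show ?thesis by blast
      qed
    qed
  qed
qed

lemma zip_interior_not_real:
  assumes "i < m - 1" "i \<in> B" "\<bar>s - (4 * real i + 2)\<bar> < 2"
  shows "zips' B (of_real (phi (unroll s))) \<noteq> of_real v"
proof -
  have "real i + 2 \<le> real m" using assms(1) by linarith
  then have "0 \<le> s" "s \<le> 4 * real m - 2" using assms(3) by (auto simp: abs_if split: if_splits)
  then have "phi (unroll s) = s" by (rule phi_unroll_id)
  then show ?thesis using Im_zips_zip_interior[OF assms] by (metis Im_complex_of_real)
qed

text \<open>Every pair of arcs is exchanged by x \<mapsto> 2l - x with an integer l, so gluing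
  preserves the even integers, which are the vertices.\<close>

lemma partner_parity:
  assumes j: "j \<in> {0..<4 * int m}"
  shows "even (j + partner m B j + 1)"
proof (cases "j \<in> {0..<4 * int m - 2}")
  case False
  then have "j = 4 * int m - 1 \<or> j = 4 * int m - 2" using j by auto
  then show ?thesis by (elim disjE) (simp_all add: partner_def)
next
  case r: True
  show ?thesis
  proof (cases "unzipped B (m - 1) j")
    case True
    note p = partner_unzipped[OF m r True]
    have "even (arcpos B (m - 1) i) \<longleftrightarrow> even i" for i
      using arcpos_mod4[of B "m - 1" i] by presburger
    from this[of j] this[of "partner m B j"] show ?thesis using p(3) by presburger
  next
    case False
    then obtain i where i: "i < m - 1" "i \<in> B" "4 * int i \<le> j" "j < 4 * int i + 4" by (rule zippedE)
    show ?thesis using partner_zipped[OF m i] by simp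
  qed
qed

definition is_vertex :: "real \<Rightarrow> bool" where
  "is_vertex t \<longleftrightarrow> (\<exists>k::int. t = 2 * of_int k)"

lemma zip_gluing_is_vertex:
  assumes "zip_gluing m B s t"
  shows "is_vertex s \<longleftrightarrow> is_vertex t"
proof (rule glued_flip_invariant[OF _ _ _ assms])
  show "4 * int m \<ge> 2" using m by simp
  show "\<And>j. j \<in> {0..<4 * int m} \<Longrightarrow> partner m B j \<in> {0..<4 * int m}"
    using partner_involution[OF m] by blast
next
  fix j x assume j: "j \<in> {0..<4 * int m}"
  have w: "is_vertex (wrap (4 * int m) y) \<longleftrightarrow> is_vertex y" for y
  proof (cases "y = 4 * real m")
    case True
    have "is_vertex (2 * of_int (2 * int m))" "is_vertex (2 * of_int 0)" unfolding is_vertex_def by blast+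
    then show ?thesis using True by (simp add: wrap_def)
  qed (simp add: wrap_def)
  obtain l where l: "j + partner m B j + 1 = 2 * l" using partner_parity[OF j, of B] by (elim evenE)
  have rl: "of_int (j + partner m B j) + 1 = 2 * real_of_int l"
    using arg_cong[OF l, of real_of_int] by simp
  have "is_vertex (2 * of_int l - y)" if y: "is_vertex y" for y
  proof -
    obtain k where "y = 2 * of_int k" using y unfolding is_vertex_def by blast
    then have "2 * of_int l - y = 2 * of_int (l - k)" by simp
    then show ?thesis unfolding is_vertex_def by blast
  qed
  from this[of x] this[of "2 * of_int l - x"] have "is_vertex (2 * of_int l - x) \<longleftrightarrow> is_vertex x" by auto
  then show "is_vertex (wrap (4 * int m) x) \<longleftrightarrow> is_vertex (wrap (4 * int m) (of_int (j + partner m B j) + 1 - x))"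
    unfolding w rl by blast
qed

text \<open>Zip and fold cannot both act nontrivially on the point: inside a zip its image is not
  real, and elsewhere the fold prescribes one complementary position. At most two straight angles
  therefore meet there.\<close>

lemma nonvertex_class:
  assumes s: "\<not> is_vertex s" and t: "zip_gluing m B s t" "t \<noteq> s" and u: "zip_gluing m B s u" "u \<noteq> s"
  shows "t = u"
proof -
  have n4: "x \<noteq> 4 * real k" if "\<not> is_vertex x" for x k
  proof
    assume "x = 4 * real k"
    then have "x = 2 * of_int (2 * int k)" by simp
    then show False using that unfolding is_vertex_def by blast
  qed
  note cs = zip_gluing_cases[OF t(1) n4[OF s]] zip_gluing_cases[OF u(1) n4[OF s]]
  show ?thesis
  proof (cases "\<exists>i<m - 1. i \<in> B \<and> \<bar>s - (4 * real i + 2)\<bar> < 2")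
    case True
    then obtain i where i: "i < m - 1" "i \<in> B" "\<bar>s - (4 * real i + 2)\<bar> < 2" by blast
    have "x = 8 * real i + 4 - s" if zx: "zip_gluing m B s x" and xs: "x \<noteq> s" for x
    proof -
      obtain k where k: "\<bar>s - (4 * real k + 2)\<bar> < 2" "x = 8 * real k + 4 - s"
        using zip_gluing_cases[OF zx n4[OF s]] xs zip_interior_not_real[OF i] by blast
      have "real i < real k + 1" "real k < real i + 1" using i(3) k(1) by (auto simp: abs_if split: if_splits)
      then have "i = k" by linarith
      then show ?thesis using k by simp
    qed
    then show ?thesis using t u by metis
  next
    case False
    obtain v where v: "zips' B (of_real (phi (unroll s))) = of_real v"
      "zips' B (of_real (phi (unroll t))) = of_real (4 * real m - 2 - v)"
      using cs(1) False t(2) by blast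
    obtain v' where v': "zips' B (of_real (phi (unroll s))) = of_real v'"
      "zips' B (of_real (phi (unroll u))) = of_real (4 * real m - 2 - v')"
      using cs(2) False u(2) by blast
    have "v' = v" using v(1) v'(1) by (metis of_real_eq_iff)
    have tu: "zip_gluing m B t u" using glued_trans[OF glued_sym[OF t(1)] u(1)] .
    have "\<not> is_vertex t" using zip_gluing_is_vertex[OF t(1)] s by blast
    from zip_gluing_cases[OF tu n4[OF this]] show ?thesis
    proof (elim disjE exE conjE)
      fix i assume "i < m - 1" "i \<in> B" "\<bar>t - (4 * real i + 2)\<bar> < 2"
      from zip_interior_not_real[OF this] v(2) show ?thesis by blast
    qed (use v(2) v'(2) \<open>v' = v\<close> in simp_all)
  qed
qed

end

lemma Collect_neq_singletonI: "P x \<Longrightarrow> x \<noteq> a \<Longrightarrow> {t. P t} \<noteq> {a}"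
  by auto

context halving begin

lemma cum_star_image: "cum (2 * m) star ` {..<2 * m} = (\<lambda>i. 2 * real i) ` {..<2 * m}"
  by (intro image_cong refl) (simp add: cum_star)

lemma is_vertexE:
  assumes "is_vertex t" "t \<in> {0..<4 * real m}"
  obtains i where "i < 2 * m" "t = 2 * real i"
proof -
  obtain k :: int where k: "t = 2 * of_int k" using assms(1) unfolding is_vertex_def by blast
  then have "0 \<le> k" using assms(2) by simp
  have "real_of_int k < real_of_int (2 * int m)" using assms(2) k by simp
  then have "k < 2 * int m" by (simp only: of_int_less_iff)
  then have "nat k < 2 * m" "t = 2 * real (nat k)" using k \<open>0 \<le> k\<close> by auto
  then show thesis by (rule that)
qed

lemma is_vertex_real: "is_vertex (2 * real i)"
  unfolding is_vertex_def by (rule exI[of _ "int i"]) simp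

lemma fangle_vertex: "i < 2 * m \<Longrightarrow> fangle (2 * m) star (2 * real i) = iangle (2 * m) star i"
  by (auto simp: fangle_def cum_star_image eidx_star)

lemma fangle_nonvertex: "\<not> is_vertex t \<Longrightarrow> fangle (2 * m) star t = pi"
  using is_vertex_real by (auto simp: fangle_def cum_star_image)

lemma item_of_vertex: "i < 2 * m \<Longrightarrow> item_of (2 * m) star (2 * real i) = Vtx i"
  by (auto simp: item_of_def cum_star_image eidx_star)

lemma item_of_eq_Vtx:
  assumes "item_of (2 * m) star t = Vtx i"
  shows "t = 2 * real i"
proof -
  have "t \<in> cum (2 * m) star ` {..<2 * m}" using assms by (auto simp: item_of_def split: if_splits)
  then obtain k where "k < 2 * m" "t = 2 * real k" by (auto simp: cum_star_image)
  then show ?thesis using assms by (simp add: item_of_vertex)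
qed

lemma reflex_zipped_class:
  assumes i: "i < m - 1" "i \<in> B"
  shows "{t. zip_gluing m B (4 * real i + 2) t} = {4 * real i + 2}"
proof -
  define s where "s = 4 * real i + 2"
  have s4: "s \<noteq> 4 * real k" for k
  proof
    assume "s = 4 * real k"
    then have "real (2 * i + 1) = real (2 * k)" by (simp add: s_def)
    then have "2 * i + 1 = 2 * k" by (simp only: of_nat_eq_iff)
    then show False by presburger
  qed
  have near: "\<bar>s - (4 * real i + 2)\<bar> < 2" by (simp add: s_def)
  have "t = s" if g: "zip_gluing m B s t" for t
  proof -
    from zip_gluing_cases[OF g s4] show ?thesis
    proof (elim disjE exE conjE)
      fix k assume k: "\<bar>s - (4 * real k + 2)\<bar> < 2" "t = 8 * real k + 4 - s"
      have "real i < real k + 1" "real k < real i + 1" using k(1) by (auto simp: s_def abs_if split: if_splits)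
      then have "i = k" by linarith
      then show ?thesis using k(2) by (simp add: s_def)
    qed (use zip_interior_not_real[OF i near] in auto)
  qed
  moreover have "real i + 2 \<le> real m" using i by linarith
  then have "zip_gluing m B s s" by (intro glued_refl) (auto simp: s_def)
  ultimately show ?thesis unfolding s_def[symmetric] by blast
qed

lemma reflex_unzipped_class:
  assumes i: "i < m" "i \<notin> B"
  shows "{t. zip_gluing m B (4 * real i + 2) t} \<noteq> {4 * real i + 2}"
proof (cases "i = m - 1")
  case True
  define s where "s = 4 * real i + 2"
  have s: "s = 4 * real m - 2" using True m by (simp add: s_def)
  have "4 * int m - 2 \<in> {0..<4 * int m}" using m by simp
  from zip_gluing_step[OF m this, of s B]
  \<comment> \<open>This reflex vertex and tip 0 are the two ends of the folded edge.\<close>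
  have "zip_gluing m B s 0" using s m by (simp add: partner_def wrap_def)
  then show ?thesis unfolding s_def[symmetric] by (rule Collect_neq_singletonI) (use s m in simp)
next
  case False
  then have im: "i < m - 1" using i by simp
  \<comment> \<open>The arc that starts at the reflex vertex; reversal glues its left end to the
    right end of its partner.\<close>
  define j where "j = 4 * int i + 2"
  have "unzipped B (m - 1) j"
    unfolding unzipped_def
  proof (intro allI impI)
    fix k assume "k < m - 1" "k \<in> B"
    then have "k \<noteq> i" using i by auto
    then show "j < 4 * int k \<or> 4 * int k + 4 \<le> j" unfolding j_def by linarith
  qed
  moreover have jr: "j \<in> {0..<4 * int m - 2}" using im by (auto simp: j_def)
  ultimately have p: "partner m B j \<in> {0..<4 * int m - 2}"
    "arcpos B (m - 1) (partner m B j) = 4 * int m - 3 - arcpos B (m - 1) j"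
    using partner_unzipped[OF m] by blast+
  have rj: "real_of_int j = 4 * real i + 2" by (simp add: j_def)
  have "j \<in> {0..<4 * int m}" using jr by auto
  from zip_gluing_step[OF m this, of "of_int j" B]
  have "zip_gluing m B (wrap (4 * int m) (of_int j)) (wrap (4 * int m) (of_int (partner m B j) + 1))"
    by simp
  then have "zip_gluing m B (4 * real i + 2) (of_int (partner m B j) + 1)"
    using real_arc_range[OF p(1)] real_arc_range[OF jr] rj by (simp add: wrap_def)
  moreover have "real_of_int (partner m B j) + 1 \<noteq> 4 * real i + 2"
  proof
    assume "real_of_int (partner m B j) + 1 = 4 * real i + 2"
    then have "real_of_int (partner m B j + 1) = real_of_int j" by (simp add: rj)
    then have "partner m B j + 1 = j" by (simp only: of_int_eq_iff)
    then have pj: "partner m B j = j - 1" by simp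
    \<comment> \<open>The two neighbouring arcs have positions with sum 3 modulo 4, but the fold
      requires 4m - 3.\<close>
    have "(arcpos B (m - 1) j - j - 2 * nzip B (m - 1)) mod 4 = 0"
      "(arcpos B (m - 1) (j - 1) - (j - 1) - 2 * nzip B (m - 1)) mod 4 = 0"
      by (rule arcpos_mod4)+
    moreover have "arcpos B (m - 1) (j - 1) = 4 * int m - 3 - arcpos B (m - 1) j" using p(2) pj by simp
    ultimately show False unfolding j_def by presburger
  qed
  ultimately show ?thesis by (rule Collect_neq_singletonI)
qed

text \<open>Two distinct reflex vertices could only meet through the fold. After k zips both
  positions are 2 + 2k modulo 4, so their sum is divisible by 4 and differs from 4m - 2.\<close>

lemma reflex_unique_in_class:
  assumes g: "zip_gluing m B (4 * real i + 2) (4 * real l + 2)"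
  shows "i = l"
proof (rule ccontr)
  assume ne: "i \<noteq> l"
  define s t where "s = 4 * real i + 2" "t = 4 * real l + 2"
  have r: "s \<in> {0..<4 * real m}" "t \<in> {0..<4 * real m}"
    using zip_gluing_range[OF g] by (auto simp: s_t_def)
  have il: "i < m" "l < m" using r by (auto simp: s_t_def)
  have s4: "s \<noteq> 4 * real k" for k
  proof
    assume "s = 4 * real k"
    then have "real (2 * i + 1) = real (2 * k)" by (simp add: s_t_def)
    then have "2 * i + 1 = 2 * k" by (simp only: of_nat_eq_iff)
    then show False by presburger
  qed
  have not_z: "\<not> (k < m - 1 \<and> k \<in> B)" if "k = i \<or> k = l" for k
  proof
    assume k: "k < m - 1 \<and> k \<in> B"
    have "zip_gluing m B s t" using g by (simp add: s_t_def)
    moreover from this have "zip_gluing m B t s" by (rule glued_sym)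
    ultimately have "s \<in> {x. zip_gluing m B t x}" "t \<in> {x. zip_gluing m B s x}" by simp_all
    then have "s = t"
      using reflex_zipped_class[of k B] k that unfolding s_t_def by (metis singletonD)
    then show False using ne by (simp add: s_t_def)
  qed
  have val: "zips' B (of_real (phi (unroll (4 * real k + 2)))) = of_int (arcpos B (m - 1) (4 * int k + 2))"
    if k: "k = i \<or> k = l" for k
  proof -
    have km: "k < m" using il k by auto
    then have "real k + 1 \<le> real m" by linarith
    then have "phi (unroll (4 * real k + 2)) = 4 * real k + 2" by (intro phi_unroll_id) auto
    moreover have "unzipped B (m - 1) (4 * int k + 2)"
      unfolding unzipped_def
    proof (intro allI impI)
      fix n assume "n < m - 1" "n \<in> B"
      then have "n \<noteq> k" using not_z[OF k] by auto
      then show "4 * int k + 2 < 4 * int n \<or> 4 * int n + 4 \<le> 4 * int k + 2" by linarith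
    qed
    from zips_unzipped[OF this, of "4 * real k + 2"]
    have "zips' B (of_real (4 * real k + 2)) = of_int (arcpos B (m - 1) (4 * int k + 2))" by simp
    ultimately show ?thesis by simp
  qed
  have "zip_gluing m B s t" using g by (simp add: s_t_def)
  from zip_gluing_cases[OF this s4] show False
  proof (elim disjE exE conjE)
    assume "t = s"
    then show False using ne by (simp add: s_t_def)
  next
    fix k assume k: "k < m - 1" "k \<in> B" "\<bar>s - (4 * real k + 2)\<bar> < 2"
    have "real i < real k + 1" "real k < real i + 1" using k(3) by (auto simp: s_t_def abs_if split: if_splits)
    then have "k = i" by linarith
    then show False using k not_z by blast
  next
    fix v assume "zips' B (of_real (phi (unroll s))) = of_real v"
      "zips' B (of_real (phi (unroll t))) = of_real (4 * real m - 2 - v)"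
    then have "complex_of_int (arcpos B (m - 1) (4 * int i + 2)) = of_real v"
      "complex_of_int (arcpos B (m - 1) (4 * int l + 2)) = of_real (4 * real m - 2 - v)"
      using val by (simp_all add: s_t_def)
    then have "real_of_int (arcpos B (m - 1) (4 * int i + 2)) = v"
      "real_of_int (arcpos B (m - 1) (4 * int l + 2)) = 4 * real m - 2 - v"
      by (metis of_real_eq_iff of_real_of_int_eq)+
    then have "real_of_int (arcpos B (m - 1) (4 * int i + 2) + arcpos B (m - 1) (4 * int l + 2)) = real_of_int (4 * int m - 2)"
      by simp
    then have "arcpos B (m - 1) (4 * int i + 2) + arcpos B (m - 1) (4 * int l + 2) = 4 * int m - 2"
      by (simp only: of_int_eq_iff)
    then show False using arcpos_mod4[of B "m - 1" "4 * int i + 2"] arcpos_mod4[of B "m - 1" "4 * int l + 2"]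
      by presburger
  qed
qed

section \<open>Total angles and recognition of the gluing trees\<close>

lemma nonvertex_angle:
  fixes B :: "nat set"
  assumes s: "s \<in> {0..<4 * real m}" "\<not> is_vertex s"
  defines "C \<equiv> {t. zip_gluing m B s t}"
  shows "finite C" "(\<Sum>t\<in>C. fangle (2 * m) star t) \<le> 2 * pi"
proof -
  have "\<exists>t. C \<subseteq> {s, t}"
  proof (cases "C \<subseteq> {s}")
    case False
    then obtain t where "zip_gluing m B s t" "t \<noteq> s" by (auto simp: C_def)
    then have "C \<subseteq> {s, t}" using nonvertex_class[OF s(2)] by (auto simp: C_def)
    then show ?thesis ..
  qed auto
  then obtain t where t: "C \<subseteq> {s, t}" ..
  then show fin: "finite C" by (rule finite_subset) simp
  have "card C \<le> card {s, t}" using t by (intro card_mono) auto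
  also have "\<dots> \<le> 2" by (simp add: card_insert_if)
  finally have c: "card C \<le> 2" .
  have "(\<Sum>t\<in>C. fangle (2 * m) star t) = (\<Sum>t\<in>C. pi)"
    by (intro sum.cong refl fangle_nonvertex) (use zip_gluing_is_vertex s in \<open>auto simp: C_def\<close>)
  also have "\<dots> = real (card C) * pi" by simp
  also have "\<dots> \<le> 2 * pi" using c by (intro mult_right_mono) auto
  finally show "(\<Sum>t\<in>C. fangle (2 * m) star t) \<le> 2 * pi" .
qed

text \<open>A class has at most one reflex vertex and at most m tips, so its angle is at most (2 pi
  - 2 \<open>dl\<close> - 2 \<open>ep\<close>) + 2m \<open>ep\<close>, and m \<open>ep\<close> =
  \<open>dl\<close> leaves a margin of 2 \<open>ep\<close>.\<close>

lemma vertex_angle: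
  fixes B :: "nat set"
  assumes s: "s \<in> {0..<4 * real m}" "is_vertex s"
  defines "C \<equiv> {t. zip_gluing m B s t}"
  shows "finite C" "(\<Sum>t\<in>C. fangle (2 * m) star t) \<le> 2 * pi"
proof -
  define Tips Refl where "Tips = (\<lambda>i. 4 * real i) ` {..<m}" "Refl = (\<lambda>i. 4 * real i + 2) ` {..<m}"
  have sub: "C \<subseteq> Tips \<union> Refl"
  proof
    fix t assume "t \<in> C"
    then have "is_vertex t" "t \<in> {0..<4 * real m}"
      using zip_gluing_is_vertex zip_gluing_range s by (auto simp: C_def)
    then obtain i where i: "i < 2 * m" "t = 2 * real i" by (rule is_vertexE)
    show "t \<in> Tips \<union> Refl"
    proof (cases "even i")
      case True
      then obtain k where "i = 2 * k" by (elim evenE)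
      then show ?thesis using i by (auto simp: Tips_Refl_def)
    next
      case False
      then obtain k where "i = 2 * k + 1" by (elim oddE)
      then show ?thesis using i by (auto simp: Tips_Refl_def)
    qed
  qed
  have fin': "finite Tips" "finite Refl" by (simp_all add: Tips_Refl_def)
  then show fin: "finite C" using sub finite_subset by blast
  have ft: "fangle (2 * m) star t = 2 * ep" if "t \<in> Tips" for t
  proof -
    obtain i where "i < m" "t = 2 * real (2 * i)" using \<open>t \<in> Tips\<close> by (auto simp: Tips_Refl_def)
    then show ?thesis using fangle_vertex[of "2 * i"] iangle_even[of "2 * i"] by simp
  qed
  have fr: "fangle (2 * m) star t = 2 * pi - 2 * dl - 2 * ep" if "t \<in> Refl" for t
  proof -
    obtain i where "i < m" "t = 2 * real (2 * i + 1)" using \<open>t \<in> Refl\<close> by (auto simp: Tips_Refl_def)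
    then show ?thesis using fangle_vertex[of "2 * i + 1"] iangle_odd[of "2 * i + 1"] by simp
  qed
  have "C \<inter> Refl = {} \<or> (\<exists>t. C \<inter> Refl = {t})"
  proof -
    have "t = u" if tu: "t \<in> C \<inter> Refl" "u \<in> C \<inter> Refl" for t u
    proof -
      obtain i l where "t = 4 * real i + 2" "u = 4 * real l + 2" using tu by (auto simp: Tips_Refl_def)
      moreover have "zip_gluing m B s t" "zip_gluing m B s u" using tu by (auto simp: C_def)
      then have "zip_gluing m B t u" using glued_trans[OF glued_sym] by metis
      ultimately show ?thesis using reflex_unique_in_class by simp
    qed
    then show ?thesis by blast
  qed
  then have "card (C \<inter> Refl) \<le> 1" by auto
  have beta: "0 \<le> 2 * pi - 2 * dl - 2 * ep" using dl_ep by simp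
  have "(\<Sum>t\<in>C \<inter> Refl. fangle (2 * m) star t) = real (card (C \<inter> Refl)) * (2 * pi - 2 * dl - 2 * ep)"
    using fr by simp
  also have "\<dots> \<le> 1 * (2 * pi - 2 * dl - 2 * ep)"
    using \<open>card (C \<inter> Refl) \<le> 1\<close> beta by (intro mult_right_mono) auto
  finally have 1: "(\<Sum>t\<in>C \<inter> Refl. fangle (2 * m) star t) \<le> 2 * pi - 2 * dl - 2 * ep" by simp
  have "card (C - Refl) \<le> card Tips" using sub fin' by (intro card_mono) auto
  also have "\<dots> \<le> m" using card_image_le[of "{..<m}"] by (simp add: Tips_Refl_def)
  finally have "real (card (C - Refl)) * (2 * ep) \<le> real m * (2 * ep)"
    using dl_ep by (intro mult_right_mono) auto
  moreover have "(\<Sum>t\<in>C - Refl. fangle (2 * m) star t) = real (card (C - Refl)) * (2 * ep)"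
  proof -
    have "(\<Sum>t\<in>C - Refl. fangle (2 * m) star t) = (\<Sum>t\<in>C - Refl. 2 * ep)"
      by (intro sum.cong refl ft) (use sub in auto)
    then show ?thesis by simp
  qed
  ultimately have 2: "(\<Sum>t\<in>C - Refl. fangle (2 * m) star t) \<le> 2 * dl" using dl_ep(7) by simp
  have "(\<Sum>t\<in>C. fangle (2 * m) star t) = (\<Sum>t\<in>C \<inter> Refl. fangle (2 * m) star t) + (\<Sum>t\<in>C - Refl. fangle (2 * m) star t)"
    using fin by (rule sum.Int_Diff)
  then show "(\<Sum>t\<in>C. fangle (2 * m) star t) \<le> 2 * pi" using 1 2 dl_ep(3) by linarith
qed

lemma aleksandrov_zip: "aleksandrov_gluing (2 * m) star (zip_gluing m B)"
  unfolding aleksandrov_gluing_def perim_star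
  using is_gluing_zip glues_to_sphere_zip nonvertex_angle vertex_angle by blast

text \<open>A label consisting of one vertex forces the class to be that single boundary point, and
  a reflex vertex is alone in its class exactly when it is zipped.\<close>

lemma leaf_label_iff:
  assumes i: "i < m - 1"
  shows "(\<exists>C\<in>tree_nodes (2 * m) star (zip_gluing m B). node_label (2 * m) star C = {Vtx (2 * i + 1)}) \<longleftrightarrow> i \<in> B"
proof -
  have r: "4 * real i + 2 \<in> {0..<4 * real m}"
  proof -
    have "real i + 2 \<le> real m" using i by linarith
    then show ?thesis by auto
  qed
  have it: "item_of (2 * m) star (4 * real i + 2) = Vtx (2 * i + 1)"
  proof -
    have "2 * real (2 * i + 1) = 4 * real i + 2" by simp
    then show ?thesis using item_of_vertex[of "2 * i + 1"] i by (simp only:)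
  qed
  show ?thesis
  proof
    assume "i \<in> B"
    then have c: "{t. zip_gluing m B (4 * real i + 2) t} = {4 * real i + 2}" by (rule reflex_zipped_class[OF i])
    then have "{4 * real i + 2} \<in> tree_nodes (2 * m) star (zip_gluing m B)"
      unfolding tree_nodes_def perim_star using r by fastforce
    moreover have "node_label (2 * m) star {4 * real i + 2} = {Vtx (2 * i + 1)}"
      using it by (simp add: node_label_def)
    ultimately show "\<exists>C\<in>tree_nodes (2 * m) star (zip_gluing m B). node_label (2 * m) star C = {Vtx (2 * i + 1)}"
      by blast
  next
    assume "\<exists>C\<in>tree_nodes (2 * m) star (zip_gluing m B). node_label (2 * m) star C = {Vtx (2 * i + 1)}"
    then obtain C s where C: "s \<in> {0..<4 * real m}" "C = {t. zip_gluing m B s t}"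
      "node_label (2 * m) star C = {Vtx (2 * i + 1)}"
      unfolding tree_nodes_def perim_star by blast
    have only: "t = 4 * real i + 2" if "t \<in> C" for t
    proof -
      have "item_of (2 * m) star t = Vtx (2 * i + 1)" using C(3) that by (auto simp: node_label_def)
      from item_of_eq_Vtx[OF this] show ?thesis by simp
    qed
    have "s \<in> C" unfolding C(2) using C(1) by (auto intro: glued_refl)
    then have "C = {4 * real i + 2}" "s = 4 * real i + 2" using only by auto
    then have "{t. zip_gluing m B (4 * real i + 2) t} = {4 * real i + 2}" using C(2) by simp
    moreover have im: "i < m" using i by linarith
    ultimately show "i \<in> B" using reflex_unzipped_class[OF im, of B] by blast
  qed
qed

text \<open>An isomorphism carries nodes to nodes with the same label, so the singleton reflex
  labels, and with them the zipped set, can be read off either tree.\<close>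

lemma same_gluing_tree_zip_imp_eq:
  assumes B: "B \<subseteq> {..<m - 1}" "B' \<subseteq> {..<m - 1}"
    and same: "same_gluing_tree (2 * m) star (zip_gluing m B) (zip_gluing m B')"
  shows "B = B'"
proof -
  obtain h where h: "bij_betw h (tree_nodes (2 * m) star (zip_gluing m B)) (tree_nodes (2 * m) star (zip_gluing m B'))"
    "\<forall>C\<in>tree_nodes (2 * m) star (zip_gluing m B). node_label (2 * m) star (h C) = node_label (2 * m) star C"
    using same unfolding same_gluing_tree_def by blast
  have im: "h ` tree_nodes (2 * m) star (zip_gluing m B) = tree_nodes (2 * m) star (zip_gluing m B')"
    using h(1) by (rule bij_betw_imp_surj_on)
  have "i \<in> B \<longleftrightarrow> i \<in> B'" if "i < m - 1" for i
    unfolding leaf_label_iff[OF that, symmetric] im[symmetric] using h(2) by (auto simp: bex_simps)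
  then show ?thesis using B by blast
qed

lemma same_gluing_tree_refl: "same_gluing_tree n p R R"
  unfolding same_gluing_tree_def by (rule exI[of _ id]) simp

end

theorem theorem6:
  shows "\<exists>c>0. \<exists>N. \<forall>n\<ge>N. even n \<longrightarrow>
    (\<exists>p. simple_polygon n p \<and>
      (\<exists>G. finite G \<and> card G \<ge> 2 powr (c * real n) \<and>
         (\<forall>R\<in>G. aleksandrov_gluing n p R) \<and>
         (\<forall>R1\<in>G. \<forall>R2\<in>G. R1 \<noteq> R2 \<longrightarrow> \<not> same_gluing_tree n p R1 R2)))"
proof (rule exI[of _ "1 / 4"], intro conjI exI[of _ "8 :: nat"] allI impI)
  fix n :: nat assume n: "8 \<le> n" "even n"
  define m where "m = n div 2"
  have nm: "n = 2 * m" and m4: "m \<ge> 4" using n by (auto simp: m_def)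
  interpret halving m by standard (use m4 in simp)
  define G where "G = zip_gluing m ` Pow {..<m - 1}"
  have inj: "inj_on (zip_gluing m) (Pow {..<m - 1})"
  proof (rule inj_onI)
    fix B B' assume "B \<in> Pow {..<m - 1}" "B' \<in> Pow {..<m - 1}" "zip_gluing m B = zip_gluing m B'"
    then show "B = B'"
      using same_gluing_tree_zip_imp_eq[of B B'] same_gluing_tree_refl[of "2 * m" star "zip_gluing m B"] by simp
  qed
  have "card G = 2 ^ (m - 1)" unfolding G_def card_image[OF inj] by (simp add: card_Pow)
  \<comment> \<open>With n = 2m the exponent n / 4 is m / 2, which is at most m - 1.\<close>
  moreover have "2 powr (1 / 4 * real n) \<le> 2 powr real (m - 1)"
    using m4 by (intro powr_mono) (auto simp: nm)
  then have "2 powr (1 / 4 * real n) \<le> (2 :: real) ^ (m - 1)" by (simp add: powr_realpow)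
  ultimately have "2 powr (1 / 4 * real n) \<le> real (card G)" by simp
  moreover have "finite G" by (simp add: G_def)
  moreover have "\<forall>R\<in>G. aleksandrov_gluing n star R" unfolding G_def nm using aleksandrov_zip by blast
  moreover have "\<forall>R1\<in>G. \<forall>R2\<in>G. R1 \<noteq> R2 \<longrightarrow> \<not> same_gluing_tree n star R1 R2"
    unfolding G_def nm using same_gluing_tree_zip_imp_eq by blast
  moreover have "simple_polygon n star" unfolding nm by (rule simple_polygon_star[OF m4])
  ultimately show "\<exists>p. simple_polygon n p \<and>
      (\<exists>G. finite G \<and> card G \<ge> 2 powr (1 / 4 * real n) \<and>
         (\<forall>R\<in>G. aleksandrov_gluing n p R) \<and>
         (\<forall>R1\<in>G. \<forall>R2\<in>G. R1 \<noteq> R2 \<longrightarrow> \<not> same_gluing_tree n p R1 R2))" by blast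
qed simp

end
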